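(* Let $\varsigma\ge0$ and let $\mathcal{T}_\Psi\colon\mathbb{R}^d\times[0,1]\to\mathbb{R}$, $\Psi\in\mathcal{P}_1(\mathbb{R}^d\times[0,1])$, satisfy: (T1) there is $L_{\mathcal{T}}>0$ with $|\mathcal{T}_{\Psi_1}(x_1,\lambda_1)-\mathcal{T}_{\Psi_2}(x_2,\lambda_2)|\le L_{\mathcal{T}}(\|x_1-x_2\|+|\lambda_1-\lambda_2|+W_1(\Psi_1,\Psi_2))$ for all $\Psi_1,\Psi_2\in\mathcal{P}_1(\mathbb{R}^d\times[0,1])$ and $(x_1,\lambda_1),(x_2,\lambda_2)\in\mathbb{R}^d\times[0,1]$; (T2) there is $\theta>0$ with $\lambda+\theta\mathcal{T}_\Psi(x,\lambda)\in[0,1]$ for all $\Psi\in\mathcal{P}_1(\mathbb{R}^d\times[0,1])$ and $(x,\lambda)\in\mathbb{R}^d\times[0,1]$; (T3) $\mathcal{T}_\Psi(x,0)>0$ for all $\Psi\in\mathcal{P}_1(\mathbb{R}^d\times[0,1])$ and $x\in\mathbb{R}^d$. Let $B\colon\Omega\to C([0,+\infty),\mathbb{R}^d)$ be a $d$-dimensional standard Brownian motion defined on a filtered probability space $(\Omega,\mathscr{F},(\mathscr{F}_t)_{t\in[0,+\infty)},\mathbb{P})$, let $\widehat X_0\colon\Omega\to\mathbb{R}^d$ be an $\mathscr{F}_0$-measurable random variable belonging to $L^4(\Omega,\mathscr{F},\mathbb{P})$, and let $\widehat\Lambda_0\colon\Omega\to[0,1]$ be an $\mathscr{F}_0$-measurable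 random variable. Let $Y=(X,\Lambda)\colon\Omega\to C([0,+\infty),\mathbb{R}^d\times[0,1])$ be the $(\mathscr{F}_t)_t$-adapted continuous stochastic process solving $$dX_t=\big(-X_t+(1-\Lambda_t)e(\mu_t)\big)dt+\varsigma\,\|X_t-(1-\Lambda_t)e(\mu_t)\|\,dB_t,\qquad d\Lambda_t=\mathcal{T}_{\Psi_t}(X_t,\Lambda_t)\,dt,$$ with $(X_0,\Lambda_0)=(\widehat X_0,\widehat\Lambda_0)$, $\Psi_t=\mathrm{Law}(X_t,\Lambda_t)$, $\mu_t=\mathrm{Law}(X_t)$. If $\varsigma^2d<2$, then $$\lim_{t\to+\infty}\mathbb{E}(\|X_t\|^2)=0.$$
   Context: Here $d>1$, $\|\cdot\|$ is the Euclidean norm, $\mathcal{P}_1$ denotes Borel probability measures with finite first moment, $W_1$ is the 1-Wasserstein distance, and $e(\mu)=\int_{\mathbb{R}^d}x\,d\mu(x)$. The solution is the pathwise unique strong solution for which $t\mapsto\int\|x\|\,d\mu_t(x)$ is bounded on every bounded time interval. *)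

theory Defs
  imports "HOL-Probability.Probability"
begin

section \<open>Probability measures with finite first moment and the Wasserstein distance\<close>

text \<open>Borel probability measures on a subset \<open>S\<close> are measures whose \<open>\<sigma>\<close>-algebra is the trace
  of the Borel \<open>\<sigma>\<close>-algebra on \<open>S\<close>, so their underlying space is \<open>S\<close> itself.\<close>

definition P1 :: "('a::euclidean_space) set \<Rightarrow> 'a measure set" where
  "P1 S = {\<mu>. prob_space \<mu> \<and> sets \<mu> = sets (restrict_space borel S) \<and> integrable \<mu> norm}"

definition couplings :: "'a measure \<Rightarrow> 'a measure \<Rightarrow> ('a \<times> 'a) measure set" where
  "couplings \<mu> \<nu> = {\<gamma>. sets \<gamma> = sets (\<mu> \<Otimes>\<^sub>M \<nu>) \<and> distr \<gamma> \<mu> fst = \<mu> \<and> distr \<gamma> \<nu> snd = \<nu>}"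

text \<open>The transport cost is finite for measures in \<open>P1 S\<close>. On a product space, \<open>dist\<close> is the
  Euclidean product distance.\<close>

definition W1 :: "('a::euclidean_space) measure \<Rightarrow> 'a measure \<Rightarrow> real" where
  "W1 \<mu> \<nu> = enn2real (INF \<gamma>\<in>couplings \<mu> \<nu>. \<integral>\<^sup>+z. ennreal (dist (fst z) (snd z)) \<partial>\<gamma>)"

definition barycenter :: "('a::euclidean_space) measure \<Rightarrow> 'a" where
  "barycenter \<mu> = (\<integral>x. x \<partial>\<mu>)"

section \<open>Filtrations and Brownian motion\<close>

text \<open>Time ranges over the nonnegative reals; values of processes and filtrations at negative
  times are irrelevant throughout. Filtrations are not assumed complete or right-continuous.\<close>

definition filtered_prob_space :: "'w measure \<Rightarrow> (real \<Rightarrow> 'w measure) \<Rightarrow> bool" where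
  "filtered_prob_space M F \<longleftrightarrow>
     prob_space M \<and> (\<forall>t\<ge>0. subalgebra M (F t)) \<and> (\<forall>s\<ge>0. \<forall>t\<ge>s. subalgebra (F t) (F s))"

definition adapted :: "(real \<Rightarrow> 'w measure) \<Rightarrow> (real \<Rightarrow> 'w \<Rightarrow> 'b::topological_space) \<Rightarrow> bool" where
  "adapted F X \<longleftrightarrow> (\<forall>t\<ge>0. X t \<in> borel_measurable (F t))"

definition continuous_paths :: "'w measure \<Rightarrow> (real \<Rightarrow> 'w \<Rightarrow> 'b::topological_space) \<Rightarrow> bool" where
  "continuous_paths M X \<longleftrightarrow> (\<forall>\<omega>\<in>space M. continuous_on {0..} (\<lambda>t. X t \<omega>))"

definition progressive :: "(real \<Rightarrow> 'w measure) \<Rightarrow> (real \<Rightarrow> 'w \<Rightarrow> real) \<Rightarrow> bool" where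
  "progressive F H \<longleftrightarrow>
     (\<forall>t\<ge>0. (\<lambda>(s, \<omega>). H s \<omega>) \<in> borel_measurable (restrict_space borel {0..t} \<Otimes>\<^sub>M F t))"

definition brownian_motion ::
  "'w measure \<Rightarrow> (real \<Rightarrow> 'w measure) \<Rightarrow> (real \<Rightarrow> 'w \<Rightarrow> real^'d) \<Rightarrow> bool" where
  "brownian_motion M F B \<longleftrightarrow>
     adapted F B \<and> continuous_paths M B \<and> (AE \<omega> in M. B 0 \<omega> = 0) \<and>
     (\<forall>s t. 0 \<le> s \<and> s < t \<longrightarrow>
        distributed M lborel (\<lambda>\<omega>. B t \<omega> - B s \<omega>)
          (\<lambda>x. ennreal (\<Prod>i\<in>UNIV. normal_density 0 (sqrt (t - s)) (x $ i))) \<and>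
        prob_space.indep_set M (sets (F s))
          (sets (vimage_algebra (space M) (\<lambda>\<omega>. B t \<omega> - B s \<omega>) borel)))"

section \<open>The Ito integral\<close>

definition conv_in_prob ::
  "'w measure \<Rightarrow> (nat \<Rightarrow> 'w \<Rightarrow> 'b::metric_space) \<Rightarrow> ('w \<Rightarrow> 'b) \<Rightarrow> bool" where
  "conv_in_prob M X Y \<longleftrightarrow>
     (\<forall>\<epsilon>>0. (\<lambda>k. measure M {\<omega>\<in>space M. dist (X k \<omega>) (Y \<omega>) > \<epsilon>}) \<longlonglongrightarrow> 0)"

text \<open>The data \<open>(n, \<tau>, h)\<close> encode the simple process
  \<open>(s, \<omega>) \<mapsto> \<Sum>i<n. h i \<omega> * indicator {\<tau> i<..\<tau> (i + 1)} s\<close> with bounded coefficients \<open>h i\<close> measurable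
  with respect to the left end points.\<close>

definition simple_data ::
  "'w measure \<Rightarrow> (real \<Rightarrow> 'w measure) \<Rightarrow> nat \<Rightarrow> (nat \<Rightarrow> real) \<Rightarrow> (nat \<Rightarrow> 'w \<Rightarrow> real) \<Rightarrow> bool" where
  "simple_data M F n \<tau> h \<longleftrightarrow> 0 \<le> \<tau> 0 \<and>
     (\<forall>i<n. \<tau> i < \<tau> (Suc i) \<and> h i \<in> borel_measurable (F (\<tau> i)) \<and> bounded (h i ` space M))"

definition simple_proc ::
  "nat \<Rightarrow> (nat \<Rightarrow> real) \<Rightarrow> (nat \<Rightarrow> 'w \<Rightarrow> real) \<Rightarrow> real \<Rightarrow> 'w \<Rightarrow> real" where
  "simple_proc n \<tau> h s \<omega> = (\<Sum>i<n. h i \<omega> * indicator {\<tau> i<..\<tau> (Suc i)} s)"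

definition simple_ito ::
  "(real \<Rightarrow> 'w \<Rightarrow> real^'d) \<Rightarrow> nat \<Rightarrow> (nat \<Rightarrow> real) \<Rightarrow> (nat \<Rightarrow> 'w \<Rightarrow> real) \<Rightarrow> real \<Rightarrow> 'w \<Rightarrow> real^'d" where
  "simple_ito B n \<tau> h t \<omega> = (\<Sum>i<n. h i \<omega> *\<^sub>R (B (min t (\<tau> (Suc i))) \<omega> - B (min t (\<tau> i)) \<omega>))"

text \<open>\<open>has_ito_integral M F B H t J\<close> states that \<open>J\<close> is (a version of) the Ito integral over
  \<open>[0, t]\<close> of the scalar integrand \<open>H\<close> against the vector-valued Brownian motion \<open>B\<close>. The integrand
  is progressively measurable with almost surely square-integrable paths; the integral is the limit
  in probability of the integrals of simple processes \<open>H\<^sub>k\<close> for which the integral of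
  \<open>(H\<^sub>k - H)\<^sup>2\<close> over \<open>[0, t]\<close> tends to zero in probability. The limit does not depend, up to null
  sets, on the approximating sequence.\<close>

definition has_ito_integral ::
  "'w measure \<Rightarrow> (real \<Rightarrow> 'w measure) \<Rightarrow> (real \<Rightarrow> 'w \<Rightarrow> real^'d) \<Rightarrow> (real \<Rightarrow> 'w \<Rightarrow> real)
     \<Rightarrow> real \<Rightarrow> ('w \<Rightarrow> real^'d) \<Rightarrow> bool" where
  "has_ito_integral M F B H t J \<longleftrightarrow>
     progressive F H \<and>
     (AE \<omega> in M. set_integrable lborel {0..t} (\<lambda>s. (H s \<omega>)\<^sup>2)) \<and>
     J \<in> borel_measurable M \<and>
     (\<exists>n \<tau> h. (\<forall>k. simple_data M F (n k) (\<tau> k) (h k)) \<and>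
        conv_in_prob M
          (\<lambda>k \<omega>. LINT s:{0..t}|lborel. (simple_proc (n k) (\<tau> k) (h k) s \<omega> - H s \<omega>)\<^sup>2) (\<lambda>\<omega>. 0) \<and>
        conv_in_prob M (\<lambda>k. simple_ito B (n k) (\<tau> k) (h k) t) J)"

definition ito_integral_process ::
  "'w measure \<Rightarrow> (real \<Rightarrow> 'w measure) \<Rightarrow> (real \<Rightarrow> 'w \<Rightarrow> real^'d) \<Rightarrow> (real \<Rightarrow> 'w \<Rightarrow> real)
     \<Rightarrow> (real \<Rightarrow> 'w \<Rightarrow> real^'d) \<Rightarrow> bool" where
  "ito_integral_process M F B H J \<longleftrightarrow>
     continuous_paths M J \<and> (\<forall>t\<ge>0. has_ito_integral M F B H t (J t))"

section \<open>The mean-field system\<close>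

abbreviation state_space :: "((real^'d) \<times> real) set" where
  "state_space \<equiv> UNIV \<times> {0..1}"

definition joint_law ::
  "'w measure \<Rightarrow> (real \<Rightarrow> 'w \<Rightarrow> real^'d) \<Rightarrow> (real \<Rightarrow> 'w \<Rightarrow> real) \<Rightarrow> real \<Rightarrow> ((real^'d) \<times> real) measure" where
  "joint_law M X \<Lambda> t = distr M (restrict_space borel state_space) (\<lambda>\<omega>. (X t \<omega>, \<Lambda> t \<omega>))"

definition law :: "'w measure \<Rightarrow> (real \<Rightarrow> 'w \<Rightarrow> real^'d) \<Rightarrow> real \<Rightarrow> (real^'d) measure" where
  "law M X t = distr M borel (X t)"

text \<open>The vector \<open>X\<^sub>t - (1 - \<Lambda>\<^sub>t) e(\<mu>\<^sub>t)\<close>: its negative is the drift of \<open>X\<close>, and \<open>\<sigma>\<close> times its norm is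
  the diffusion coefficient.\<close>

definition deviation ::
  "'w measure \<Rightarrow> (real \<Rightarrow> 'w \<Rightarrow> real^'d) \<Rightarrow> (real \<Rightarrow> 'w \<Rightarrow> real) \<Rightarrow> real \<Rightarrow> 'w \<Rightarrow> real^'d" where
  "deviation M X \<Lambda> t \<omega> = X t \<omega> - (1 - \<Lambda> t \<omega>) *\<^sub>R barycenter (law M X t)"

text \<open>Strong solutions, on the given filtered probability space, with values in
  \<open>state_space\<close>. The two integrability conditions are part of the usual notion of solution and make
  the (total) Lebesgue integral meaningful.\<close>

definition mean_field_solution ::
  "'w measure \<Rightarrow> (real \<Rightarrow> 'w measure) \<Rightarrow> (real \<Rightarrow> 'w \<Rightarrow> real^'d) \<Rightarrow> real
     \<Rightarrow> (((real^'d) \<times> real) measure \<Rightarrow> (real^'d) \<times> real \<Rightarrow> real)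
     \<Rightarrow> ('w \<Rightarrow> real^'d) \<Rightarrow> ('w \<Rightarrow> real)
     \<Rightarrow> (real \<Rightarrow> 'w \<Rightarrow> real^'d) \<Rightarrow> (real \<Rightarrow> 'w \<Rightarrow> real) \<Rightarrow> bool" where
  "mean_field_solution M F B \<sigma> T X0 \<Lambda>0 X \<Lambda> \<longleftrightarrow>
     adapted F X \<and> adapted F \<Lambda> \<and> continuous_paths M X \<and> continuous_paths M \<Lambda> \<and>
     (\<forall>t\<ge>0. \<forall>\<omega>\<in>space M. \<Lambda> t \<omega> \<in> {0..1}) \<and>
     (AE \<omega> in M. X 0 \<omega> = X0 \<omega> \<and> \<Lambda> 0 \<omega> = \<Lambda>0 \<omega>) \<and>
     (AE \<omega> in M. \<forall>t\<ge>0. set_integrable lborel {0..t} (\<lambda>s. - deviation M X \<Lambda> s \<omega>) \<and>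
        set_integrable lborel {0..t} (\<lambda>s. T (joint_law M X \<Lambda> s) (X s \<omega>, \<Lambda> s \<omega>))) \<and>
     (\<exists>J. ito_integral_process M F B (\<lambda>s \<omega>. \<sigma> * norm (deviation M X \<Lambda> s \<omega>)) J \<and>
        (AE \<omega> in M. \<forall>t\<ge>0.
           X t \<omega> = X 0 \<omega> + (LINT s:{0..t}|lborel. - deviation M X \<Lambda> s \<omega>) + J t \<omega>)) \<and>
     (AE \<omega> in M. \<forall>t\<ge>0.
        \<Lambda> t \<omega> = \<Lambda> 0 \<omega> + (LINT s:{0..t}|lborel. T (joint_law M X \<Lambda> s) (X s \<omega>, \<Lambda> s \<omega>)))"

end

theory Submission
  imports Defs
begin

text \<open>Write \<open>m t\<close> for the mean of \<open>X t\<close>, \<open>V t\<close> for its second moment, \<open>ell t\<close> for the mean of \<open>\<Lambda> t\<close>,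
  \<open>p t\<close> for the squared norm of \<open>m t\<close> and \<open>W t = V t - p t\<close> for the variance. Taking expectations,
  \<open>m' = - ell m\<close>, hence \<open>p' = - 2 ell p\<close>, while with \<open>c = d \<sigma>\<^sup>2 < 2\<close> and \<open>\<kappa> = (2 - c) / 2\<close> one finds
  \<open>V' \<le> - \<kappa> W + ell p / \<kappa>\<close>. So \<open>V + p / (2 \<kappa>)\<close> is a Lyapunov function that dissipates \<open>\<kappa> W\<close>; it follows
  that \<open>W\<close> is integrable in time and tends to zero.
  If \<open>ell\<close> has infinite integral, then \<open>p\<close> and therefore \<open>V\<close> tend to zero. Otherwise \<open>m\<close> converges to
  some \<open>v\<close>, and since \<open>W\<close> vanishes, the drift of \<open>\<Lambda>\<close> stays, up to errors that are small or integrable in time, above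
  the value of \<open>T\<close> at the Dirac mass in \<open>(v, 0)\<close>, which is positive by (T3). So \<open>ell\<close> grows linearly, contradicting
  \<open>\<Lambda> \<le> 1\<close>. No compactness of the family of laws is needed.

  The inequality for \<open>V\<close> is obtained without Ito's formula: the isometry and the martingale property give
  \<open>V t - V s\<close> up to an error of order \<open>(t - s)\<^bsup>3/2\<^esup>\<close>, which disappears along finer and finer partitions.
  Finiteness of \<open>V\<close> comes from the isometry localized to the events on which the energy of the
  integrand is below \<open>K\<close>, Gronwall's inequality uniformly in \<open>K\<close>, and Fatou's lemma.\<close>

section \<open>Increments, Gronwall's inequality and Gaussian components\<close>

text \<open>The Ito integral is given only as a limit in probability. Isometry and martingale
  property therefore become available only once the energy of the integrand has finite expectation,
  and this energy is itself a second moment of \<open>X\<close>. The circle is broken by switching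
  off each approximating simple integrand in the cells where its own accumulated energy exceeds
  \<open>K\<close>: the result is again a simple process, so this truncation takes the place of
  stopping times. The one a priori input is the local bound on first moments; it keeps
  \<open>m\<close> locally bounded, so that \<open>D\<close> grows at most linearly in
  \<open>X\<close>. (T3) gives positivity without a lower bound uniform in the law and the point, so
  \<open>T\<close> has to be compared with its value at one fixed state. That state exists because a
  bounded \<open>L\<close> forces \<open>m\<close> to converge, and (T1) prices the comparison in
  terms of \<open>W1\<close>, which is easy to bound when one of the two laws is a Dirac mass. The
  part of the price due to \<open>ell\<close> is not estimated at individual times; only its time
  integral matters, and this is an increment of \<open>L\<close>.\<close>

lemma nonincreasing_if_small_increments:
  fixes \<phi> :: "real \<Rightarrow> real"
  assumes "a \<le> b"
    and incr: "\<And>s t. a \<le> s \<Longrightarrow> s \<le> t \<Longrightarrow> t \<le> b \<Longrightarrow> \<phi> t - \<phi> s \<le> C * ((t - s) * sqrt (t - s))"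
  shows "\<phi> b \<le> \<phi> a"
proof -
  \<comment> \<open>With \<open>Suc n\<close> equal cells of length \<delta>, the errors
    \<open>\<delta> * sqrt \<delta>\<close> add up to \<open>(b - a) * sqrt \<delta>\<close>, which
    vanishes as the mesh is refined.\<close>
  have bound: "\<phi> b - \<phi> a \<le> C * ((b - a) * sqrt ((b - a) / real (Suc n)))" for n
  proof -
    define \<delta> where "\<delta> = (b - a) / real (Suc n)"
    define x where "x i = a + real i * \<delta>" for i
    have d: "\<delta> \<ge> 0" using assms(1) by (simp add: \<delta>_def)
    have x0: "x 0 = a" and xs: "\<And>i. x (Suc i) = x i + \<delta>"
      by (simp_all add: x_def algebra_simps)
    have xn: "x (Suc n) = b" unfolding x_def \<delta>_def by (simp del: of_nat_Suc)
    have mono: "i \<le> j \<Longrightarrow> x i \<le> x j" for i j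
      unfolding x_def using d by (simp add: mult_right_mono)
    have step: "\<phi> (x (Suc i)) - \<phi> (x i) \<le> C * (\<delta> * sqrt \<delta>)" if "i < Suc n" for i
    proof -
      have "a \<le> x i" "x (Suc i) \<le> b" using mono[of 0 i] mono[of "Suc i" "Suc n"] that x0 xn by auto
      then show ?thesis using incr[of "x i" "x (Suc i)"] d by (simp add: xs)
    qed
    have "\<phi> b - \<phi> a = (\<Sum>i<Suc n. \<phi> (x (Suc i)) - \<phi> (x i))"
      using sum_lessThan_telescope[of "\<lambda>i. \<phi> (x i)" "Suc n"] by (simp only: x0 xn)
    also have "\<dots> \<le> (\<Sum>i<Suc n. C * (\<delta> * sqrt \<delta>))" by (rule sum_mono) (use step in auto)
    also have "\<dots> = C * ((b - a) * sqrt ((b - a) / real (Suc n)))" by (simp add: \<delta>_def field_simps)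
    finally show ?thesis .
  qed
  have "(\<lambda>n. C * ((b - a) * sqrt ((b - a) / real (Suc n)))) \<longlonglongrightarrow> C * ((b - a) * sqrt 0)"
    by (intro tendsto_intros LIMSEQ_Suc[OF lim_const_over_n])
  then have "\<phi> b - \<phi> a \<le> C * ((b - a) * sqrt 0)"
    by (rule LIMSEQ_le_const) (use bound in auto)
  then show ?thesis by simp
qed

text \<open>The weight \<open>exp (- (2 * b * t))\<close> decays at twice the rate \<open>b\<close>,
  so the weighted integral term is at most half of the weighted supremum \<open>S\<close> and can be
  absorbed. Absorption requires \<open>S\<close> to be finite; this is what the bound
  \<open>C\<close> is for, and \<open>C\<close> does not enter the conclusion. The argument works
  for merely measurable \<open>u\<close>, which suits moments whose continuity in time is
  unknown.\<close>

lemma Gronwall_nn_integral: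
  fixes u :: "real \<Rightarrow> ennreal" and a b C \<tau> :: real
  assumes [measurable]: "u \<in> borel_measurable borel" and "0 < b" "0 \<le> a"
    and bounded: "\<And>t. 0 \<le> t \<Longrightarrow> t \<le> \<tau> \<Longrightarrow> u t \<le> ennreal C"
    and le: "\<And>t. 0 \<le> t \<Longrightarrow> t \<le> \<tau> \<Longrightarrow> u t \<le> ennreal a + ennreal b * (\<integral>\<^sup>+s\<in>{0..t}. u s \<partial>lborel)"
    and t: "0 \<le> t" "t \<le> \<tau>"
  shows "u t \<le> ennreal (2 * a * exp (2 * b * t))"
proof -
  define v where "v t = u t * ennreal (exp (- (2 * b * t)))" for t
  define S where "S = (SUP t\<in>{0..\<tau>}. v t)"
  have uv: "u t = v t * ennreal (exp (2 * b * t))" for t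
    by (simp add: v_def mult.assoc flip: ennreal_mult exp_add)
  have vS: "v t \<le> S" if "0 \<le> t" "t \<le> \<tau>" for t
    unfolding S_def using that by (auto intro: SUP_upper)
  have "v t \<le> ennreal \<bar>C\<bar>" if "0 \<le> t" "t \<le> \<tau>" for t
  proof -
    have "v t \<le> ennreal \<bar>C\<bar> * ennreal 1"
      unfolding v_def using assms that by (intro mult_mono order.trans[OF bounded] ennreal_leI) auto
    then show ?thesis by simp
  qed
  then have "S \<le> ennreal \<bar>C\<bar>" unfolding S_def by (auto intro: SUP_least)
  then have Sfin: "S < top" using ennreal_less_top le_less_trans by blast
  have exp_int: "(\<integral>\<^sup>+s\<in>{0..t}. ennreal (exp (2 * b * s)) \<partial>lborel) \<le> ennreal (exp (2 * b * t) / (2 * b))"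
    if "0 \<le> t" for t
  proof -
    have "(\<integral>\<^sup>+s\<in>{0..t}. ennreal (exp (2 * b * s)) \<partial>lborel)
        = ennreal (exp (2 * b * t) / (2 * b) - exp (2 * b * 0) / (2 * b))"
      using that \<open>0 < b\<close>
      by (intro nn_integral_FTC_Icc) (auto intro!: derivative_eq_intros simp: field_simps)
    also have "\<dots> \<le> ennreal (exp (2 * b * t) / (2 * b))" using \<open>0 < b\<close> by (intro ennreal_leI) auto
    finally show ?thesis .
  qed
  have "v t \<le> ennreal a + S / 2" if "0 \<le> t" "t \<le> \<tau>" for t
  proof -
    have "(\<integral>\<^sup>+s\<in>{0..t}. u s \<partial>lborel) \<le> (\<integral>\<^sup>+s. S * (ennreal (exp (2 * b * s)) * indicator {0..t} s) \<partial>lborel)"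
      using that by (intro nn_integral_mono) (auto simp: uv indicator_def intro!: mult_right_mono vS)
    also have "\<dots> = S * (\<integral>\<^sup>+s\<in>{0..t}. ennreal (exp (2 * b * s)) \<partial>lborel)"
      by (rule nn_integral_cmult) auto
    also have "\<dots> \<le> S * ennreal (exp (2 * b * t) / (2 * b))"
      using exp_int that by (intro mult_left_mono) auto
    finally have "u t \<le> ennreal a + ennreal b * (S * ennreal (exp (2 * b * t) / (2 * b)))"
      using le[OF that] by (meson add_left_mono dual_order.trans mult_left_mono zero_le)
    then have "v t \<le> (ennreal a + ennreal b * (S * ennreal (exp (2 * b * t) / (2 * b)))) * ennreal (exp (- (2 * b * t)))"
      unfolding v_def by (intro mult_right_mono) auto
    also have "\<dots> = ennreal a * ennreal (exp (- (2 * b * t)))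
        + S * (ennreal b * ennreal (exp (2 * b * t) / (2 * b)) * ennreal (exp (- (2 * b * t))))"
      by (simp add: algebra_simps)
    also have "ennreal b * ennreal (exp (2 * b * t) / (2 * b)) * ennreal (exp (- (2 * b * t))) = ennreal (1/2)"
      using \<open>0 < b\<close> by (simp add: exp_minus field_simps flip: ennreal_mult)
    also have "ennreal a * ennreal (exp (- (2 * b * t))) \<le> ennreal a * ennreal 1"
      using assms that by (intro mult_left_mono ennreal_leI) auto
    finally show ?thesis
      by (simp add: divide_ennreal_def inverse_ennreal[symmetric] ennreal_divide_numeral
            add_right_mono flip: ennreal_numeral)
  qed
  then have S_le: "S \<le> ennreal a + S / 2" unfolding S_def by (auto intro: SUP_least)
  \<comment> \<open>In \<open>ennreal\<close> the term \<open>S / 2\<close> cannot be subtracted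
    from an infinite \<open>S\<close>, hence the passage to a real value.\<close>
  obtain r where r: "S = ennreal r" "0 \<le> r" using Sfin by (cases S) auto
  have "S / 2 = ennreal (r / 2)" using r by (simp add: ennreal_divide_numeral)
  then have "ennreal r \<le> ennreal (a + r / 2)" using S_le r \<open>0 \<le> a\<close> by simp
  then have "r \<le> 2 * a" using r \<open>0 \<le> a\<close> by (subst (asm) ennreal_le_iff) auto
  then have "v t \<le> ennreal (2 * a)" using vS[OF t] r by (meson ennreal_leI order_trans)
  then have "u t \<le> ennreal (2 * a) * ennreal (exp (2 * b * t))"
    unfolding uv by (intro mult_right_mono) auto
  then show ?thesis using \<open>0 \<le> a\<close> by (simp flip: ennreal_mult)
qed

lemma borel_measurable_vec_nth [measurable (raw)]:
  fixes f :: "'a \<Rightarrow> real^'d"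
  shows "f \<in> borel_measurable M \<Longrightarrow> (\<lambda>x. f x $ i) \<in> borel_measurable M"
  by (rule measurable_compose[OF _ borel_measurable_continuous_onI]) (auto intro: continuous_intros)

text \<open>Marginal of a product density: the event constrains one coordinate only, so Tonelli's
  theorem factors its probability, and all other factors are total masses of normal
  densities.\<close>

lemma distributed_component_normal:
  fixes N :: "'w \<Rightarrow> real^'d"
  assumes D: "distributed M lborel N (\<lambda>x. ennreal (\<Prod>i\<in>UNIV. normal_density 0 s (x $ i)))" and "0 < s"
  shows "distributed M lborel (\<lambda>\<omega>. N \<omega> $ k) (\<lambda>x. ennreal (normal_density 0 s x))"
proof -
  have [measurable]: "N \<in> borel_measurable M" using distributed_measurable[OF D] by simp
  have "distr M lborel (\<lambda>\<omega>. N \<omega> $ k) = density lborel (\<lambda>x. ennreal (normal_density 0 s x))"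
  proof (rule measure_eqI)
    fix A :: "real set" assume "A \<in> sets (distr M lborel (\<lambda>\<omega>. N \<omega> $ k))"
    then have [measurable]: "A \<in> sets borel" by simp
    \<comment> \<open>The product formula for \<open>lborel\<close> runs over \<open>Basis\<close>,
      whose elements are the vectors \<open>axis i 1\<close>; the indicator of \<open>A\<close> is
      attached to the factor in direction \<open>k\<close>.\<close>
    define f where "f b = (\<lambda>x. ennreal (normal_density 0 s x) * (if b = axis k 1 then indicator A x else 1))"
      for b :: "real^'d"
    have Basis_vec: "(Basis :: (real^'d) set) = (\<lambda>i. axis i 1) ` UNIV" by (auto simp: Basis_vec_def)
    have inj: "inj (\<lambda>i. axis i (1::real) :: real^'d)" by (auto simp: inj_on_def axis_eq_axis)
    have prod_Basis: "(\<Prod>b\<in>Basis. g b) = (\<Prod>i\<in>UNIV. g (axis i 1))" for g :: "real^'d \<Rightarrow> ennreal"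
      unfolding Basis_vec by (subst prod.reindex[OF inj]) simp
    have "emeasure (distr M lborel (\<lambda>\<omega>. N \<omega> $ k)) A = emeasure (distr M lborel N) {x. x $ k \<in> A}"
      by (subst (1 2) emeasure_distr) (auto intro!: arg_cong2[where f=emeasure])
    also have "\<dots> = (\<integral>\<^sup>+x. ennreal (\<Prod>i\<in>UNIV. normal_density 0 s (x $ i)) * indicator {x. x $ k \<in> A} x \<partial>lborel)"
      unfolding distributed_distr_eq_density[OF D] by (subst emeasure_density) auto
    also have "\<dots> = (\<integral>\<^sup>+x. (\<Prod>b\<in>Basis. f b (x \<bullet> b)) \<partial>lborel)"
    proof (rule nn_integral_cong)
      fix x :: "real^'d"
      have "(\<Prod>b\<in>Basis. f b (x \<bullet> b)) = (\<Prod>i\<in>UNIV. ennreal (normal_density 0 s (x $ i)) * (if i = k then indicator A (x $ i) else 1))"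
        unfolding prod_Basis f_def by (simp add: inner_axis axis_eq_axis cong: if_cong)
      also have "\<dots> = (\<Prod>i\<in>UNIV. ennreal (normal_density 0 s (x $ i))) * indicator A (x $ k)"
        unfolding prod.distrib by simp
      also have "\<dots> = ennreal (\<Prod>i\<in>UNIV. normal_density 0 s (x $ i)) * indicator {x. x $ k \<in> A} x"
        by (simp add: prod_ennreal indicator_def)
      finally show "ennreal (\<Prod>i\<in>UNIV. normal_density 0 s (x $ i)) * indicator {x. x $ k \<in> A} x = (\<Prod>b\<in>Basis. f b (x \<bullet> b))" ..
    qed
    also have "\<dots> = (\<Prod>b\<in>Basis. \<integral>\<^sup>+x. f b x \<partial>lborel)"
      by (rule nn_integral_lborel_prod) (auto simp: f_def)
    also have "\<dots> = (\<Prod>i\<in>UNIV. if i = k then (\<integral>\<^sup>+x. ennreal (normal_density 0 s x) * indicator A x \<partial>lborel) else 1)"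
      unfolding prod_Basis
      by (intro prod.cong refl)
         (auto simp: f_def axis_eq_axis nn_integral_eq_integral \<open>0 < s\<close>)
    also have "\<dots> = emeasure (density lborel (\<lambda>x. ennreal (normal_density 0 s x))) A"
      by (simp add: emeasure_density)
    finally show "emeasure (distr M lborel (\<lambda>\<omega>. N \<omega> $ k)) A = emeasure (density lborel (\<lambda>x. ennreal (normal_density 0 s x))) A" .
  qed simp
  then show ?thesis by (simp add: distributed_def)
qed

section \<open>Square-integrable functions\<close>

text \<open>Measurability is a separate conjunct because the square determines the function only up
  to a sign that may vary from point to point.\<close>

definition square_integrable :: "'a measure \<Rightarrow> ('a \<Rightarrow> real) \<Rightarrow> bool" where
  "square_integrable M f \<longleftrightarrow> f \<in> borel_measurable M \<and> integrable M (\<lambda>x. (f x)\<^sup>2)"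

lemma square_integrable_mult:
  assumes "square_integrable M f" "square_integrable M g"
  shows "integrable M (\<lambda>x. f x * g x)"
proof (rule Bochner_Integration.integrable_bound)
  show "integrable M (\<lambda>x. (f x)\<^sup>2 + (g x)\<^sup>2)" "(\<lambda>x. f x * g x) \<in> borel_measurable M"
    using assms by (auto simp: square_integrable_def)
  have "\<bar>f x * g x\<bar> \<le> (f x)\<^sup>2 + (g x)\<^sup>2" for x
    using sum_squares_bound[of "\<bar>f x\<bar>" "\<bar>g x\<bar>"] mult_nonneg_nonneg[of "\<bar>f x\<bar>" "\<bar>g x\<bar>"]
    unfolding abs_mult mult.assoc power2_abs by linarith
  then show "AE x in M. norm (f x * g x) \<le> norm ((f x)\<^sup>2 + (g x)\<^sup>2)" by simp
qed

lemma square_integrable_add: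
  assumes "square_integrable M f" "square_integrable M g"
  shows "square_integrable M (\<lambda>x. f x + g x)"
  using assms square_integrable_mult[OF assms]
  by (auto simp: square_integrable_def power2_sum mult.assoc)

lemma square_integrable_bounded_mult:
  assumes "square_integrable M f" "h \<in> borel_measurable M" "\<And>x. x \<in> space M \<Longrightarrow> \<bar>h x\<bar> \<le> K"
  shows "square_integrable M (\<lambda>x. h x * f x)"
proof -
  have "integrable M (\<lambda>x. (h x * f x)\<^sup>2)"
  proof (rule Bochner_Integration.integrable_bound)
    show "integrable M (\<lambda>x. K\<^sup>2 * (f x)\<^sup>2)" "(\<lambda>x. (h x * f x)\<^sup>2) \<in> borel_measurable M"
      using assms by (auto simp: square_integrable_def)
    show "AE x in M. norm ((h x * f x)\<^sup>2) \<le> norm (K\<^sup>2 * (f x)\<^sup>2)"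
    proof (rule AE_I2)
      fix x assume "x \<in> space M"
      then have "(h x)\<^sup>2 \<le> K\<^sup>2" using assms(3)[of x] by (metis abs_ge_zero power2_abs power_mono)
      then show "norm ((h x * f x)\<^sup>2) \<le> norm (K\<^sup>2 * (f x)\<^sup>2)"
        by (simp add: power_mult_distrib mult_right_mono)
    qed
  qed
  then show ?thesis using assms by (auto simp: square_integrable_def)
qed

lemma square_integrable_cmult:
  "square_integrable M f \<Longrightarrow> square_integrable M (\<lambda>x. c * f x)"
  by (rule square_integrable_bounded_mult[where K="\<bar>c\<bar>"]) auto

lemma square_integrable_diff:
  assumes "square_integrable M f" "square_integrable M g"
  shows "square_integrable M (\<lambda>x. f x - g x)"
  using square_integrable_add[OF assms(1) square_integrable_cmult[OF assms(2), of "-1"]] by simp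

lemma square_integrable_sum:
  assumes "\<And>i. i \<in> I \<Longrightarrow> square_integrable M (f i)"
  shows "square_integrable M (\<lambda>x. \<Sum>i\<in>I. f i x)"
  using assms
proof (induction I rule: infinite_finite_induct)
  case (insert i I)
  then show ?case by (simp add: square_integrable_add)
qed (auto simp: square_integrable_def)

lemma square_integrable_const: "finite_measure M \<Longrightarrow> square_integrable M (\<lambda>x. c)"
  by (simp add: square_integrable_def finite_measure.integrable_const)

lemma (in finite_measure) square_integrable_integrable:
  "square_integrable M f \<Longrightarrow> integrable M f"
  using square_integrable_mult[OF _ square_integrable_const[of M 1]] by (auto intro: finite_measure_axioms)

section \<open>Elementary stochastic integrals\<close>

text \<open>Independence passes to smaller \<sigma>-algebras: those generated by \<open>Y\<close>
  and by \<open>g (N \<omega>)\<close> lie in the two given ones. It is applied with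
  \<open>g\<close> a coordinate or its square, to factor expectations of increments against weights
  from the past.\<close>

lemma (in prob_space) indep_var_compose_vimage:
  assumes indep: "indep_set (sets G) (sets (vimage_algebra (space M) N borel))"
    and sub: "subalgebra M G" and Y: "Y \<in> borel_measurable G"
    and N: "N \<in> borel_measurable M" and g: "g \<in> borel_measurable borel"
  shows "indep_var borel Y borel (\<lambda>\<omega>. g (N \<omega>))"
proof -
  have sp: "space G = space M" using sub by (simp add: subalgebra_def)
  have "sigma_sets (space M) {Y -` A \<inter> space M |A. A \<in> sets borel} \<subseteq> sets G"
    unfolding sp[symmetric] by (rule sets.sigma_sets_subset) (use Y in \<open>auto intro: measurable_sets\<close>)
  moreover have "sigma_sets (space M) {(\<lambda>\<omega>. g (N \<omega>)) -` A \<inter> space M |A. A \<in> sets borel}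
      \<subseteq> sets (vimage_algebra (space M) N borel)"
  proof -
    have "(\<lambda>\<omega>. g (N \<omega>)) \<in> borel_measurable (vimage_algebra (space M) N borel)"
      using g by (auto intro!: measurable_compose[OF _ g] measurable_vimage_algebra1)
    note gm = this
    have "sigma_sets (space (vimage_algebra (space M) N borel)) {(\<lambda>\<omega>. g (N \<omega>)) -` A \<inter> space M |A. A \<in> sets borel}
        \<subseteq> sets (vimage_algebra (space M) N borel)"
      by (rule sets.sigma_sets_subset) (use measurable_sets[OF gm] in auto)
    then show ?thesis by simp
  qed
  ultimately have "indep_set (sigma_sets (space M) {Y -` A \<inter> space M |A. A \<in> sets borel})
      (sigma_sets (space M) {(\<lambda>\<omega>. g (N \<omega>)) -` A \<inter> space M |A. A \<in> sets borel})"
    using indep unfolding indep_sets2_eq by (meson subset_eq)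
  then show ?thesis
    unfolding indep_var_eq using measurable_from_subalg[OF sub Y] N g by auto
qed

lemma Cauchy_Schwarz_integral:
  assumes f: "square_integrable M f" and g: "square_integrable M g"
  shows "\<bar>\<integral>x. f x * g x \<partial>M\<bar> \<le> sqrt (\<integral>x. (f x)\<^sup>2 \<partial>M) * sqrt (\<integral>x. (g x)\<^sup>2 \<partial>M)"
proof -
  let ?A = "\<integral>x. (f x)\<^sup>2 \<partial>M" and ?B = "\<integral>x. (g x)\<^sup>2 \<partial>M" and ?C = "\<integral>x. f x * g x \<partial>M"
  have int: "integrable M (\<lambda>x. (f x)\<^sup>2)" "integrable M (\<lambda>x. (g x)\<^sup>2)" "integrable M (\<lambda>x. f x * g x)"
    using f g square_integrable_mult[OF f g] by (auto simp: square_integrable_def)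
  have quad: "0 \<le> r\<^sup>2 * ?A + 2 * r * ?C + ?B" for r
  proof -
    have "0 \<le> (\<integral>x. (r * f x + g x)\<^sup>2 \<partial>M)" by (rule integral_nonneg_AE) simp
    also have "(\<integral>x. (r * f x + g x)\<^sup>2 \<partial>M) = (\<integral>x. r\<^sup>2 * (f x)\<^sup>2 + 2 * r * (f x * g x) + (g x)\<^sup>2 \<partial>M)"
      by (intro Bochner_Integration.integral_cong refl) (simp add: power2_sum power_mult_distrib ac_simps)
    also have "\<dots> = r\<^sup>2 * ?A + 2 * r * ?C + ?B" using int by simp
    finally show ?thesis .
  qed
  have A: "0 \<le> ?A" and B: "0 \<le> ?B" by (auto intro!: integral_nonneg_AE)
  have "?C\<^sup>2 \<le> ?A * ?B"
  proof (cases "?A = 0")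
    case True
    have "?C = 0"
    proof (rule ccontr)
      assume "?C \<noteq> 0"
      \<comment> \<open>If \<open>?A = 0\<close> the quadratic in \<open>r\<close> is affine with
        slope \<open>2 * ?C\<close>; this choice of \<open>r\<close> gives it the value -1.\<close>
      then have "2 * (- (?B + 1) / (2 * ?C)) * ?C = - (?B + 1)" by simp
      then show False using quad[of "- (?B + 1) / (2 * ?C)"] True by simp
    qed
    then show ?thesis using True by simp
  next
    case False
    then have pos: "0 < ?A" using A by linarith
    have e1: "(- ?C / ?A)\<^sup>2 * ?A = ?C\<^sup>2 / ?A" using pos by (simp add: power2_eq_square)
    have e2: "2 * (- ?C / ?A) * ?C = - 2 * (?C\<^sup>2 / ?A)" by (simp add: power2_eq_square)
    have "?C\<^sup>2 / ?A \<le> ?B" using quad[of "- ?C / ?A"] unfolding e1 e2 by linarith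
    then show ?thesis using pos by (simp add: pos_divide_le_eq mult.commute)
  qed
  then have "\<bar>?C\<bar> \<le> sqrt (?A * ?B)" by (intro real_le_rsqrt) simp
  then show ?thesis by (simp only: real_sqrt_mult)
qed

text \<open>The difference of the products is
  \<open>(f - f') (g - g') + f' (g - g') + (f - f') g'\<close>, and Cauchy-Schwarz applies to each
  term. With equal factors this is the convergence of squared norms, with distinct ones it carries
  the isometry to limits.\<close>

lemma tendsto_integral_mult:
  assumes f: "\<And>n. square_integrable M (f n)" "square_integrable M f'" "(\<lambda>n. \<integral>x. (f n x - f' x)\<^sup>2 \<partial>M) \<longlonglongrightarrow> 0"
    and g: "\<And>n. square_integrable M (g n)" "square_integrable M g'" "(\<lambda>n. \<integral>x. (g n x - g' x)\<^sup>2 \<partial>M) \<longlonglongrightarrow> 0"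
  shows "(\<lambda>n. \<integral>x. f n x * g n x \<partial>M) \<longlonglongrightarrow> (\<integral>x. f' x * g' x \<partial>M)"
proof -
  let ?a = "\<lambda>n. sqrt (\<integral>x. (f n x - f' x)\<^sup>2 \<partial>M)" and ?b = "\<lambda>n. sqrt (\<integral>x. (g n x - g' x)\<^sup>2 \<partial>M)"
  let ?A = "sqrt (\<integral>x. (f' x)\<^sup>2 \<partial>M)" and ?B = "sqrt (\<integral>x. (g' x)\<^sup>2 \<partial>M)"
  have fd: "square_integrable M (\<lambda>x. f n x - f' x)" and gd: "square_integrable M (\<lambda>x. g n x - g' x)" for n
    using f g by (auto intro: square_integrable_diff)
  have "norm ((\<integral>x. f n x * g n x \<partial>M) - (\<integral>x. f' x * g' x \<partial>M)) \<le> ?a n * ?b n + ?A * ?b n + ?a n * ?B" for n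
  proof -
    have "(\<integral>x. f n x * g n x \<partial>M) - (\<integral>x. f' x * g' x \<partial>M) = (\<integral>x. f n x * g n x - f' x * g' x \<partial>M)"
      by (intro Bochner_Integration.integral_diff[symmetric] square_integrable_mult f g)
    also have "\<dots> = (\<integral>x. (f n x - f' x) * (g n x - g' x) + f' x * (g n x - g' x) + (f n x - f' x) * g' x \<partial>M)"
      by (intro Bochner_Integration.integral_cong refl) (simp add: algebra_simps)
    also have "\<dots> = (\<integral>x. (f n x - f' x) * (g n x - g' x) \<partial>M) + (\<integral>x. f' x * (g n x - g' x) \<partial>M)
        + (\<integral>x. (f n x - f' x) * g' x \<partial>M)"
      using square_integrable_mult[OF fd[of n] gd[of n]] square_integrable_mult[OF f(2) gd[of n]]
        square_integrable_mult[OF fd[of n] g(2)]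
      by simp
    finally have eq: "(\<integral>x. f n x * g n x \<partial>M) - (\<integral>x. f' x * g' x \<partial>M)
      = (\<integral>x. (f n x - f' x) * (g n x - g' x) \<partial>M) + (\<integral>x. f' x * (g n x - g' x) \<partial>M)
        + (\<integral>x. (f n x - f' x) * g' x \<partial>M)" .
    show ?thesis
      unfolding eq real_norm_def
      by (intro order_trans[OF abs_triangle_ineq] add_mono Cauchy_Schwarz_integral fd gd f g)
  qed
  moreover have "(\<lambda>n. ?a n * ?b n + ?A * ?b n + ?a n * ?B) \<longlonglongrightarrow> 0"
  proof -
    have "(\<lambda>n. ?a n * ?b n + ?A * ?b n + ?a n * ?B) \<longlonglongrightarrow> sqrt 0 * sqrt 0 + ?A * sqrt 0 + sqrt 0 * ?B"
      by (intro tendsto_add tendsto_mult tendsto_const tendsto_real_sqrt f(3) g(3))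
    then show ?thesis by simp
  qed
  ultimately have "(\<lambda>n. (\<integral>x. f n x * g n x \<partial>M) - (\<integral>x. f' x * g' x \<partial>M)) \<longlonglongrightarrow> 0"
    by (rule Lim_null_comparison[OF always_eventually[rule_format]])
  then show ?thesis by (rule LIM_zero_cancel)
qed

text \<open>States that increments have conditional mean zero and conditional variance
  \<open>t - s\<close> given \<open>F s\<close>, tested against integrable weights instead of by
  conditional expectations. These are the properties of one Brownian coordinate that enter the
  isometry.\<close>

locale unit_rate_martingale =
  fixes M :: "'w measure" and F :: "real \<Rightarrow> 'w measure" and \<beta> :: "real \<Rightarrow> 'w \<Rightarrow> real"
  assumes filtered: "filtered_prob_space M F"
    and adapted: "\<And>t. 0 \<le> t \<Longrightarrow> \<beta> t \<in> borel_measurable (F t)"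
    and increment_mean: "\<And>s t Y. 0 \<le> s \<Longrightarrow> s \<le> t \<Longrightarrow> Y \<in> borel_measurable (F s) \<Longrightarrow> integrable M Y \<Longrightarrow>
        has_bochner_integral M (\<lambda>\<omega>. Y \<omega> * (\<beta> t \<omega> - \<beta> s \<omega>)) 0"
    and increment_variance: "\<And>s t Y. 0 \<le> s \<Longrightarrow> s \<le> t \<Longrightarrow> Y \<in> borel_measurable (F s) \<Longrightarrow> integrable M Y \<Longrightarrow>
        has_bochner_integral M (\<lambda>\<omega>. Y \<omega> * (\<beta> t \<omega> - \<beta> s \<omega>)\<^sup>2) ((t - s) * integral\<^sup>L M Y)"

text \<open>Independence factors both expectations; the remaining ones are the first two moments of
  the normal law with variance \<open>t - s\<close>.\<close>

lemma brownian_motion_component: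
  fixes B :: "real \<Rightarrow> 'w \<Rightarrow> real^'d"
  assumes filtered: "filtered_prob_space M F" and B: "brownian_motion M F B"
  shows "unit_rate_martingale M F (\<lambda>t \<omega>. B t \<omega> $ k)"
proof -
  interpret prob_space M using filtered by (simp add: filtered_prob_space_def)
  have sub: "0 \<le> t \<Longrightarrow> subalgebra M (F t)" for t using filtered by (simp add: filtered_prob_space_def)
  have Bm: "B t \<in> borel_measurable (F t)" if "0 \<le> t" for t
    using B that by (simp add: brownian_motion_def adapted_def)
  have BM: "B t \<in> borel_measurable M" if "0 \<le> t" for t
    using measurable_from_subalg[OF sub Bm] that by simp
  have key: "has_bochner_integral M (\<lambda>\<omega>. Y \<omega> * (B t \<omega> $ k - B s \<omega> $ k)) 0"
    "has_bochner_integral M (\<lambda>\<omega>. Y \<omega> * (B t \<omega> $ k - B s \<omega> $ k)\<^sup>2) ((t - s) * integral\<^sup>L M Y)"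
    if "0 \<le> s" "s < t" and Y: "Y \<in> borel_measurable (F s)" "integrable M Y" for s t and Y :: "'w \<Rightarrow> real"
  proof -
    let ?N = "\<lambda>\<omega>. B t \<omega> - B s \<omega>"
    have pos: "0 < sqrt (t - s)" using that by simp
    have N: "?N \<in> borel_measurable M" using BM that by (auto intro!: borel_measurable_diff)
    have "distributed M lborel (\<lambda>\<omega>. ?N \<omega> $ k) (\<lambda>x. ennreal (normal_density 0 (sqrt (t - s)) x))"
      using B that by (intro distributed_component_normal) (auto simp: brownian_motion_def)
    note D = this
    have indep: "indep_set (sets (F s)) (sets (vimage_algebra (space M) ?N borel))"
      using B that by (auto simp: brownian_motion_def)
    have moment: "integrable M (\<lambda>\<omega>. (?N \<omega> $ k) ^ j)
        \<and> (\<integral>\<omega>. (?N \<omega> $ k) ^ j \<partial>M) = (\<integral>x. normal_density 0 (sqrt (t - s)) x * x ^ j \<partial>lborel)" for j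
      using distributed_integrable[OF D, of "\<lambda>x. x ^ j"] distributed_integral[OF D, of "\<lambda>x. x ^ j"]
        integrable_normal_moment[OF pos, of 0 j] by simp
    have m1: "integrable M (\<lambda>\<omega>. ?N \<omega> $ k)" "(\<integral>\<omega>. ?N \<omega> $ k \<partial>M) = 0"
      using moment[of 1] integral_normal_moment_odd[OF pos, of 0 0] by simp_all
    have m2: "integrable M (\<lambda>\<omega>. (?N \<omega> $ k)\<^sup>2)" "(\<integral>\<omega>. (?N \<omega> $ k)\<^sup>2 \<partial>M) = t - s"
      using moment[of 2] integral_normal_moment_even[OF pos, of 0 1] that by (simp_all add: fact_numeral)
    note i1 = indep_var_compose_vimage[OF indep sub[OF that(1)] Y(1) N, of "\<lambda>x. x $ k"]
    note i2 = indep_var_compose_vimage[OF indep sub[OF that(1)] Y(1) N, of "\<lambda>x. (x $ k)\<^sup>2"]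
    show "has_bochner_integral M (\<lambda>\<omega>. Y \<omega> * (B t \<omega> $ k - B s \<omega> $ k)) 0"
      using indep_var_integrable[OF i1 Y(2)] indep_var_lebesgue_integral[OF i1 Y(2)] m1
      by (simp add: has_bochner_integral_iff)
    show "has_bochner_integral M (\<lambda>\<omega>. Y \<omega> * (B t \<omega> $ k - B s \<omega> $ k)\<^sup>2) ((t - s) * integral\<^sup>L M Y)"
      using indep_var_integrable[OF i2 Y(2)] indep_var_lebesgue_integral[OF i2 Y(2)] m2
      by (simp add: has_bochner_integral_iff)
  qed
  show ?thesis
  proof
    fix s t :: real and Y :: "'w \<Rightarrow> real"
    assume "0 \<le> s" "s \<le> t" "Y \<in> borel_measurable (F s)" "integrable M Y"
    \<comment> \<open>The case \<open>s = t\<close> is treated apart: the increment is then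
      identically zero and has no density.\<close>
    then show "has_bochner_integral M (\<lambda>\<omega>. Y \<omega> * (B t \<omega> $ k - B s \<omega> $ k)) 0"
      "has_bochner_integral M (\<lambda>\<omega>. Y \<omega> * (B t \<omega> $ k - B s \<omega> $ k)\<^sup>2) ((t - s) * integral\<^sup>L M Y)"
      using key[of s t Y] by (cases "s = t"; simp add: has_bochner_integral_zero)+
  qed (use filtered Bm in auto)
qed

section \<open>Covariances of weighted increments\<close>

context unit_rate_martingale begin

sublocale prob_space M using filtered by (simp add: filtered_prob_space_def)

lemma subalgebra_F: "0 \<le> t \<Longrightarrow> subalgebra M (F t)"
  using filtered by (simp add: filtered_prob_space_def)

lemma measurable_F_mono:
  "f \<in> borel_measurable (F s) \<Longrightarrow> 0 \<le> s \<Longrightarrow> s \<le> t \<Longrightarrow> f \<in> borel_measurable (F t)"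
  using filtered by (auto simp: filtered_prob_space_def intro: measurable_from_subalg)

lemma measurable_F_M: "f \<in> borel_measurable (F s) \<Longrightarrow> 0 \<le> s \<Longrightarrow> f \<in> borel_measurable M"
  using subalgebra_F measurable_from_subalg by blast

lemma measurable_increment:
  "0 \<le> s \<Longrightarrow> s \<le> t \<Longrightarrow> t \<le> u \<Longrightarrow> (\<lambda>\<omega>. \<beta> t \<omega> - \<beta> s \<omega>) \<in> borel_measurable (F u)"
  using measurable_F_mono[OF adapted] by (intro borel_measurable_diff) auto

lemma square_integrable_increment:
  assumes "0 \<le> s" "s \<le> t" shows "square_integrable M (\<lambda>\<omega>. \<beta> t \<omega> - \<beta> s \<omega>)"
proof -
  have "has_bochner_integral M (\<lambda>\<omega>. 1 * (\<beta> t \<omega> - \<beta> s \<omega>)\<^sup>2) ((t - s) * (\<integral>\<omega>. 1 \<partial>M))"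
    using assms by (intro increment_variance) auto
  moreover have "(\<lambda>\<omega>. \<beta> t \<omega> - \<beta> s \<omega>) \<in> borel_measurable M"
    using measurable_F_M[OF measurable_increment[of s t t]] assms by auto
  ultimately show ?thesis by (simp add: square_integrable_def has_bochner_integral_iff)
qed

text \<open>Since \<open>a \<le> c\<close>, the intervals overlap at most in
  \<open>[c, min b e]\<close>. Cutting both of them at the end points of this overlap leaves one
  square, which contributes its length, and products of two increments one of which lies after the
  other and after \<open>c\<close>; those have mean zero.\<close>

lemma increment_covariance:
  assumes "0 \<le> a" "a \<le> b" "0 \<le> c" "c \<le> e" "a \<le> c"
    and h: "h \<in> borel_measurable (F a)" "\<And>\<omega>. \<omega> \<in> space M \<Longrightarrow> \<bar>h \<omega>\<bar> \<le> K"
    and h': "h' \<in> borel_measurable (F c)" "\<And>\<omega>. \<omega> \<in> space M \<Longrightarrow> \<bar>h' \<omega>\<bar> \<le> K'"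
  shows "has_bochner_integral M (\<lambda>\<omega>. h \<omega> * (\<beta> b \<omega> - \<beta> a \<omega>) * (h' \<omega> * (\<beta> e \<omega> - \<beta> c \<omega>)))
    ((\<integral>\<omega>. h \<omega> * h' \<omega> \<partial>M) * max 0 (min b e - c))"
proof -
  have hc: "h \<in> borel_measurable (F c)" using measurable_F_mono[OF h(1)] assms by auto
  have hhc: "(\<lambda>\<omega>. h \<omega> * h' \<omega>) \<in> borel_measurable (F c)" using hc h'(1) by auto
  have hhM: "(\<lambda>\<omega>. h \<omega> * h' \<omega>) \<in> borel_measurable M" using measurable_F_M[OF hhc] assms by auto
  have hhb: "\<bar>h \<omega> * h' \<omega>\<bar> \<le> K * K'" if "\<omega> \<in> space M" for \<omega>
    unfolding abs_mult using h(2)[OF that] h'(2)[OF that] by (intro mult_mono) auto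
  have hhint: "integrable M (\<lambda>\<omega>. h \<omega> * h' \<omega>)"
    using hhM hhb by (intro integrable_const_bound[of _ "K * K'"]) auto
  have bsq: "square_integrable M (\<lambda>\<omega>. h \<omega> * h' \<omega> * (\<beta> y \<omega> - \<beta> x \<omega>))" if "0 \<le> x" "x \<le> y" for x y
    using square_integrable_bounded_mult[OF square_integrable_increment[OF that] hhM hhb] .
  \<comment> \<open>Everything in front of the last increment is known at time \<open>u\<close>,
    because \<open>y \<le> u\<close> and \<open>c \<le> u\<close>.\<close>
  have orth: "has_bochner_integral M (\<lambda>\<omega>. h \<omega> * h' \<omega> * (\<beta> y \<omega> - \<beta> x \<omega>) * (\<beta> v \<omega> - \<beta> u \<omega>)) 0"
    if "0 \<le> x" "x \<le> y" "y \<le> u" "u \<le> v" "c \<le> u" for x y u v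
  proof (rule increment_mean)
    show "(\<lambda>\<omega>. h \<omega> * h' \<omega> * (\<beta> y \<omega> - \<beta> x \<omega>)) \<in> borel_measurable (F u)"
      using measurable_F_mono[OF hhc, of u] measurable_increment[of x y u] that assms by auto
    show "integrable M (\<lambda>\<omega>. h \<omega> * h' \<omega> * (\<beta> y \<omega> - \<beta> x \<omega>))"
      using square_integrable_integrable[OF bsq] that by auto
  qed (use that in auto)
  show ?thesis
  proof (cases "b \<le> c")
    case True
    then show ?thesis using orth[of a b c e] assms by (simp add: ac_simps)
  next
    case False
    define f where "f = min b e"
    have f: "c \<le> f" "f \<le> b" "f \<le> e" "f = b \<or> f = e" using False assms by (auto simp: f_def)
    have sq: "has_bochner_integral M (\<lambda>\<omega>. h \<omega> * h' \<omega> * (\<beta> f \<omega> - \<beta> c \<omega>)\<^sup>2) ((f - c) * (\<integral>\<omega>. h \<omega> * h' \<omega> \<partial>M))"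
      using increment_variance[OF _ _ hhc hhint, of f] f assms by auto
    have main: "has_bochner_integral M (\<lambda>\<omega>. h \<omega> * h' \<omega> * (\<beta> c \<omega> - \<beta> a \<omega>) * (\<beta> e \<omega> - \<beta> c \<omega>)
        + (h \<omega> * h' \<omega> * (\<beta> f \<omega> - \<beta> c \<omega>)\<^sup>2 + (h \<omega> * h' \<omega> * (\<beta> f \<omega> - \<beta> c \<omega>) * (\<beta> e \<omega> - \<beta> f \<omega>)
          + h \<omega> * h' \<omega> * (\<beta> f \<omega> - \<beta> c \<omega>) * (\<beta> b \<omega> - \<beta> f \<omega>))))
       (0 + ((f - c) * (\<integral>\<omega>. h \<omega> * h' \<omega> \<partial>M) + (0 + 0)))"
      using f assms by (intro has_bochner_integral_add orth sq) auto
    \<comment> \<open>As \<open>f\<close> is one of \<open>b\<close> and \<open>e\<close>, one of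
      the last two products is zero, so a single formula covers both orders.\<close>
    have eq: "h \<omega> * (\<beta> b \<omega> - \<beta> a \<omega>) * (h' \<omega> * (\<beta> e \<omega> - \<beta> c \<omega>)) =
        h \<omega> * h' \<omega> * (\<beta> c \<omega> - \<beta> a \<omega>) * (\<beta> e \<omega> - \<beta> c \<omega>)
        + (h \<omega> * h' \<omega> * (\<beta> f \<omega> - \<beta> c \<omega>)\<^sup>2 + (h \<omega> * h' \<omega> * (\<beta> f \<omega> - \<beta> c \<omega>) * (\<beta> e \<omega> - \<beta> f \<omega>)
          + h \<omega> * h' \<omega> * (\<beta> f \<omega> - \<beta> c \<omega>) * (\<beta> b \<omega> - \<beta> f \<omega>)))" for \<omega>
      using f(4) by (elim disjE) (simp_all add: power2_eq_square algebra_simps)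
    have val: "0 + ((f - c) * (\<integral>\<omega>. h \<omega> * h' \<omega> \<partial>M) + (0 + 0)) = (\<integral>\<omega>. h \<omega> * h' \<omega> \<partial>M) * max 0 (min b e - c)"
      using f by (simp add: f_def)
    show ?thesis using main unfolding eq val .
  qed
qed

lemma increment_covariance_overlap:
  assumes "0 \<le> a" "a \<le> b" "0 \<le> c" "c \<le> e"
    and h: "h \<in> borel_measurable (F a)" "\<And>\<omega>. \<omega> \<in> space M \<Longrightarrow> \<bar>h \<omega>\<bar> \<le> K"
    and h': "h' \<in> borel_measurable (F c)" "\<And>\<omega>. \<omega> \<in> space M \<Longrightarrow> \<bar>h' \<omega>\<bar> \<le> K'"
  shows "has_bochner_integral M (\<lambda>\<omega>. h \<omega> * (\<beta> b \<omega> - \<beta> a \<omega>) * (h' \<omega> * (\<beta> e \<omega> - \<beta> c \<omega>)))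
    ((\<integral>\<omega>. h \<omega> * h' \<omega> \<partial>M) * max 0 (min b e - max a c))"
proof (cases "a \<le> c")
  case True
  then show ?thesis using increment_covariance[OF assms(1-4) True h h'] by (simp add: max_absorb2)
next
  case False
  then have "c \<le> a" "max a c = a" by auto
  then have "has_bochner_integral M (\<lambda>\<omega>. h' \<omega> * (\<beta> e \<omega> - \<beta> c \<omega>) * (h \<omega> * (\<beta> b \<omega> - \<beta> a \<omega>)))
      ((\<integral>\<omega>. h' \<omega> * h \<omega> \<partial>M) * max 0 (min e b - max a c))"
    using increment_covariance[OF assms(3,4,1,2) _ h' h] by simp
  moreover have "h' \<omega> * (\<beta> e \<omega> - \<beta> c \<omega>) * (h \<omega> * (\<beta> b \<omega> - \<beta> a \<omega>)) = h \<omega> * (\<beta> b \<omega> - \<beta> a \<omega>) * (h' \<omega> * (\<beta> e \<omega> - \<beta> c \<omega>))"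
    "h' \<omega> * h \<omega> = h \<omega> * h' \<omega>" "min e b = min b e" for \<omega>
    by (auto simp: mult.commute min.commute)
  ultimately show ?thesis by (simp only:)
qed

end

section \<open>Simple integrands: products, squares and truncation by energy\<close>

lemma simple_data_partition:
  assumes "simple_data M F n \<tau> h" "i \<le> j" "j \<le> n"
  shows "0 \<le> \<tau> i" "\<tau> i \<le> \<tau> j"
proof -
  have mono: "\<tau> a \<le> \<tau> b" if "a \<le> b" "b \<le> n" for a b
    using that
  proof (induction b)
    case (Suc b)
    have "\<tau> b < \<tau> (Suc b)" using assms(1) Suc.prems by (simp add: simple_data_def)
    then show ?case using Suc by (cases "a = Suc b") auto
  qed simp
  show "\<tau> i \<le> \<tau> j" using mono assms by auto
  show "0 \<le> \<tau> i" using mono[of 0 i] assms by (auto simp: simple_data_def)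
qed

lemma simple_data_bounded:
  assumes "simple_data M F n \<tau> h" "i < n"
  obtains K where "\<And>\<omega>. \<omega> \<in> space M \<Longrightarrow> \<bar>h i \<omega>\<bar> \<le> K"
  using assms by (force simp: simple_data_def bounded_iff)

text \<open>Cells of the two partitions meet in half-open intervals, whose possibly zero length is
  written with \<open>max 0\<close>; this avoids a common refinement. The double sum has the shape
  produced by \<open>increment_covariance_overlap\<close>, which is what makes the isometry a
  comparison of coefficients.\<close>

lemma has_bochner_integral_simple_proc_mult:
  assumes g: "simple_data M F n \<tau> h" and g': "simple_data M F n' \<tau>' h'"
  shows "has_bochner_integral lborel
    (\<lambda>u. indicator {0..r} u *\<^sub>R (simple_proc n \<tau> h u \<omega> * simple_proc n' \<tau>' h' u \<omega>))
    (\<Sum>i<n. \<Sum>j<n'. h i \<omega> * h' j \<omega> * max 0 (min (min (\<tau> (Suc i)) (\<tau>' (Suc j))) r - max (\<tau> i) (\<tau>' j)))"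
proof -
  have Ioc: "has_bochner_integral lborel (indicator {x<..y} :: real \<Rightarrow> real) (max 0 (y - x))" for x y :: real
  proof (cases "x \<le> y")
    case True
    have "has_bochner_integral lborel (indicator {x<..y} :: real \<Rightarrow> real) (measure lborel {x<..y})"
      using True by (intro has_bochner_integral_real_indicator) auto
    then show ?thesis using True by simp
    next
    case False
    then have "indicator {x<..y} = (\<lambda>_::real. 0::real)" by (auto simp: indicator_def)
    then show ?thesis using False by (simp add: has_bochner_integral_zero)
  qed
  have main: "has_bochner_integral lborel (\<lambda>u. \<Sum>i<n. \<Sum>j<n'. h i \<omega> * h' j \<omega> *
      indicator {max (\<tau> i) (\<tau>' j)<..min (min (\<tau> (Suc i)) (\<tau>' (Suc j))) r} u)
    (\<Sum>i<n. \<Sum>j<n'. h i \<omega> * h' j \<omega> * max 0 (min (min (\<tau> (Suc i)) (\<tau>' (Suc j))) r - max (\<tau> i) (\<tau>' j)))"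
    by (intro has_bochner_integral_sum has_bochner_integral_mult_right Ioc)
  have cell: "indicator {0..r} u * (h i \<omega> * indicator {\<tau> i<..\<tau> (Suc i)} u * (h' j \<omega> * indicator {\<tau>' j<..\<tau>' (Suc j)} u)) =
      h i \<omega> * h' j \<omega> * indicator {max (\<tau> i) (\<tau>' j)<..min (min (\<tau> (Suc i)) (\<tau>' (Suc j))) r} u"
    if "i < n" for i j u
  proof -
    \<comment> \<open>Cells are open on the left and start at nonnegative times, so
      \<open>{0..r}\<close> truncates them on the right only.\<close>
    have "0 \<le> \<tau> i" using simple_data_partition(1)[OF g, of i n] that by auto
    then have cap: "{0..r} \<inter> ({\<tau> i<..\<tau> (Suc i)} \<inter> {\<tau>' j<..\<tau>' (Suc j)})
        = {max (\<tau> i) (\<tau>' j)<..min (min (\<tau> (Suc i)) (\<tau>' (Suc j))) r}"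
      by auto
    have "indicator {max (\<tau> i) (\<tau>' j)<..min (min (\<tau> (Suc i)) (\<tau>' (Suc j))) r} u
        = (indicator {0..r} u * (indicator {\<tau> i<..\<tau> (Suc i)} u * indicator {\<tau>' j<..\<tau>' (Suc j)} u) :: real)"
      unfolding cap[symmetric] indicator_inter_arith ..
    then show ?thesis by simp
  qed
  have eq: "indicator {0..r} u *\<^sub>R (simple_proc n \<tau> h u \<omega> * simple_proc n' \<tau>' h' u \<omega>) =
    (\<Sum>i<n. \<Sum>j<n'. h i \<omega> * h' j \<omega> * indicator {max (\<tau> i) (\<tau>' j)<..min (min (\<tau> (Suc i)) (\<tau>' (Suc j))) r} u)" for u
    unfolding simple_proc_def real_scaleR_def sum_product
    unfolding sum_distrib_left
    by (intro sum.cong refl cell) auto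
  show ?thesis using main unfolding eq .
qed

lemma sum_Ioc_cells:
  assumes "simple_data M F n \<tau> h" "i < n" "\<tau> i < u" "u \<le> \<tau> (Suc i)"
  shows "(\<Sum>j<n. f j * indicator {\<tau> j<..\<tau> (Suc j)} u :: real) = f i"
proof -
  have "indicator {\<tau> j<..\<tau> (Suc j)} u = (if j = i then 1 else 0 :: real)" if "j < n" for j
  proof (cases j i rule: linorder_cases)
    case less
    then have "\<tau> (Suc j) \<le> \<tau> i" using simple_data_partition(2)[OF assms(1), of "Suc j" i] assms by auto
    then show ?thesis using less assms by auto
  next
    case greater
    then have "\<tau> (Suc i) \<le> \<tau> j" using simple_data_partition(2)[OF assms(1), of "Suc i" j] that by auto
    then show ?thesis using greater assms by auto
  qed (use assms in auto)
  then have "(\<Sum>j<n. f j * indicator {\<tau> j<..\<tau> (Suc j)} u) = (\<Sum>j<n. if j = i then f j else 0)"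
    by (intro sum.cong) auto
  then show ?thesis using assms by simp
qed

lemma simple_proc_square:
  assumes g: "simple_data M F n \<tau> h"
  shows "(simple_proc n \<tau> h u \<omega>)\<^sup>2 = (\<Sum>j<n. (h j \<omega>)\<^sup>2 * indicator {\<tau> j<..\<tau> (Suc j)} u)"
proof (cases "\<exists>i<n. \<tau> i < u \<and> u \<le> \<tau> (Suc i)")
  case True
  then obtain i where i: "i < n" "\<tau> i < u" "u \<le> \<tau> (Suc i)" by auto
  show ?thesis
    unfolding simple_proc_def sum_Ioc_cells[OF g i, of "\<lambda>j. h j \<omega>"] sum_Ioc_cells[OF g i, of "\<lambda>j. (h j \<omega>)\<^sup>2"] ..
next
  case False
  then have "indicator {\<tau> j<..\<tau> (Suc j)} u = (0::real)" if "j < n" for j using that by auto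
  then show ?thesis unfolding simple_proc_def by simp
qed

lemma has_bochner_integral_simple_proc_square:
  assumes g: "simple_data M F n \<tau> h"
  shows "has_bochner_integral lborel (\<lambda>u. indicator {0..t} u *\<^sub>R (simple_proc n \<tau> h u \<omega>)\<^sup>2)
    (\<Sum>j<n. (h j \<omega>)\<^sup>2 * (min t (\<tau> (Suc j)) - min t (\<tau> j)))"
proof -
  have "has_bochner_integral lborel (\<lambda>u. \<Sum>j<n. (h j \<omega>)\<^sup>2 * indicator {min t (\<tau> j)<..min t (\<tau> (Suc j))} u)
    (\<Sum>j<n. (h j \<omega>)\<^sup>2 * (min t (\<tau> (Suc j)) - min t (\<tau> j)))"
  proof (intro has_bochner_integral_sum has_bochner_integral_mult_right)
    fix j assume "j \<in> {..<n}"
    then have "min t (\<tau> j) \<le> min t (\<tau> (Suc j))" using simple_data_partition(2)[OF g, of j "Suc j"] by auto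
    then show "has_bochner_integral lborel (indicator {min t (\<tau> j)<..min t (\<tau> (Suc j))} :: real \<Rightarrow> real)
        (min t (\<tau> (Suc j)) - min t (\<tau> j))"
      using has_bochner_integral_real_indicator[of "{min t (\<tau> j)<..min t (\<tau> (Suc j))}" lborel] by simp
  qed
  moreover have "indicator {0..t} u *\<^sub>R (simple_proc n \<tau> h u \<omega>)\<^sup>2 =
    (\<Sum>j<n. (h j \<omega>)\<^sup>2 * indicator {min t (\<tau> j)<..min t (\<tau> (Suc j))} u)" for u
    unfolding simple_proc_square[OF g] real_scaleR_def sum_distrib_left
  proof (intro sum.cong refl)
    fix j assume "j \<in> {..<n}"
    then have "0 \<le> \<tau> j" using simple_data_partition(1)[OF g, of j n] by auto
    then show "indicator {0..t} u * ((h j \<omega>)\<^sup>2 * indicator {\<tau> j<..\<tau> (Suc j)} u) =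
        (h j \<omega>)\<^sup>2 * indicator {min t (\<tau> j)<..min t (\<tau> (Suc j))} u"
      by (auto simp: indicator_def)
  qed
  ultimately show ?thesis by simp
qed

text \<open>Since \<open>h i\<close> is already known at the left end point of the \<open>i\<close>-th cell, so is the integral of
  the square up to the right end point; the truncated process therefore never overshoots \<open>K\<close>.\<close>

definition cutoff :: "real \<Rightarrow> real \<Rightarrow> (nat \<Rightarrow> real) \<Rightarrow> (nat \<Rightarrow> 'w \<Rightarrow> real) \<Rightarrow> nat \<Rightarrow> 'w \<Rightarrow> real" where
  "cutoff K t \<tau> h i \<omega> =
    (if (\<Sum>j\<le>i. (h j \<omega>)\<^sup>2 * (min t (\<tau> (Suc j)) - min t (\<tau> j))) \<le> K then h i \<omega> else 0)"

lemma simple_data_cutoff: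
  assumes filtered: "filtered_prob_space M F" and g: "simple_data M F n \<tau> h"
  shows "simple_data M F n \<tau> (cutoff K t \<tau> h)"
  unfolding simple_data_def
proof (intro conjI allI impI)
  fix i assume i: "i < n"
  have ti: "0 \<le> \<tau> j" "\<tau> j \<le> \<tau> i" if "j \<le> i" for j
    using simple_data_partition[OF g that] i by auto
  have hm: "h j \<in> borel_measurable (F (\<tau> i))" if "j \<le> i" for j
  proof -
    have "subalgebra (F (\<tau> i)) (F (\<tau> j))" using filtered ti[OF that] by (auto simp: filtered_prob_space_def)
    then show ?thesis using g that i by (auto simp: simple_data_def intro: measurable_from_subalg)
  qed
  then have [measurable]: "(\<lambda>\<omega>. \<Sum>j\<le>i. (h j \<omega>)\<^sup>2 * (min t (\<tau> (Suc j)) - min t (\<tau> j))) \<in> borel_measurable (F (\<tau> i))"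
    by (intro borel_measurable_sum) auto
  note hm[OF order_refl, measurable]
  show "cutoff K t \<tau> h i \<in> borel_measurable (F (\<tau> i))"
    unfolding cutoff_def[abs_def] by measurable
  obtain C where C: "\<And>\<omega>. \<omega> \<in> space M \<Longrightarrow> \<bar>h i \<omega>\<bar> \<le> C" using simple_data_bounded[OF g i] by blast
  then show "bounded (cutoff K t \<tau> h i ` space M)"
    by (intro boundedI[of _ "\<bar>C\<bar>"]) (force simp: cutoff_def)
qed (use g in \<open>auto simp: simple_data_def\<close>)

text \<open>Induction on the number of cells. If the energy of \<open>h\<close> through cell
  \<open>m\<close> is at most \<open>K\<close>, the truncated energy is dominated by it; otherwise
  cell \<open>m\<close> is switched off and the bound is inherited. Testing the energy of
  \<open>h\<close> rather than that of the truncated process keeps the criterion explicit.\<close>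

lemma cutoff_sum_le:
  assumes g: "simple_data M F n \<tau> h" and "0 \<le> K"
  shows "(\<Sum>j<n. (cutoff K t \<tau> h j \<omega>)\<^sup>2 * (min t (\<tau> (Suc j)) - min t (\<tau> j)))
    \<le> min K (\<Sum>j<n. (h j \<omega>)\<^sup>2 * (min t (\<tau> (Suc j)) - min t (\<tau> j)))"
proof -
  have d: "0 \<le> min t (\<tau> (Suc j)) - min t (\<tau> j)" if "j < n" for j
    using simple_data_partition(2)[OF g, of j "Suc j"] that by auto
  have le: "(\<Sum>j<m. (cutoff K t \<tau> h j \<omega>)\<^sup>2 * (min t (\<tau> (Suc j)) - min t (\<tau> j)))
      \<le> (\<Sum>j<m. (h j \<omega>)\<^sup>2 * (min t (\<tau> (Suc j)) - min t (\<tau> j)))" if "m \<le> n" for m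
    using d that by (intro sum_mono mult_right_mono) (auto simp: cutoff_def)
  have "(\<Sum>j<m. (cutoff K t \<tau> h j \<omega>)\<^sup>2 * (min t (\<tau> (Suc j)) - min t (\<tau> j))) \<le> K" if "m \<le> n" for m
    using that
  proof (induction m)
    case (Suc m)
    show ?case
    proof (cases "(\<Sum>j<Suc m. (h j \<omega>)\<^sup>2 * (min t (\<tau> (Suc j)) - min t (\<tau> j))) \<le> K")
      case True
      then show ?thesis using le[OF Suc.prems] by linarith
    next
      case False
      then have "cutoff K t \<tau> h m \<omega> = 0" by (simp add: cutoff_def lessThan_Suc_atMost)
      then show ?thesis using Suc by simp
    qed
  qed (use \<open>0 \<le> K\<close> in simp)
  then show ?thesis using le[of n] by simp
qed

lemma cutoff_eq:
  assumes g: "simple_data M F n \<tau> h" and "i < n"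
    and le: "(\<Sum>j<n. (h j \<omega>)\<^sup>2 * (min t (\<tau> (Suc j)) - min t (\<tau> j))) \<le> K"
  shows "cutoff K t \<tau> h i \<omega> = h i \<omega>"
proof -
  have d: "0 \<le> min t (\<tau> (Suc j)) - min t (\<tau> j)" if "j < n" for j
    using simple_data_partition(2)[OF g, of j "Suc j"] that by auto
  have "(\<Sum>j\<le>i. (h j \<omega>)\<^sup>2 * (min t (\<tau> (Suc j)) - min t (\<tau> j)))
      \<le> (\<Sum>j<n. (h j \<omega>)\<^sup>2 * (min t (\<tau> (Suc j)) - min t (\<tau> j)))"
    using d \<open>i < n\<close> by (intro sum_mono2) auto
  then show ?thesis using le by (simp add: cutoff_def)
qed

section \<open>Isometry and martingale property of elementary integrals\<close>

context unit_rate_martingale begin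

definition simple_int :: "nat \<Rightarrow> (nat \<Rightarrow> real) \<Rightarrow> (nat \<Rightarrow> 'w \<Rightarrow> real) \<Rightarrow> real \<Rightarrow> 'w \<Rightarrow> real" where
  "simple_int n \<tau> h t \<omega> = (\<Sum>i<n. h i \<omega> * (\<beta> (min t (\<tau> (Suc i))) \<omega> - \<beta> (min t (\<tau> i)) \<omega>))"

lemma simple_int_term_square_integrable:
  assumes g: "simple_data M F n \<tau> h" and "i < n" "0 \<le> t"
  shows "square_integrable M (\<lambda>\<omega>. h i \<omega> * (\<beta> (min t (\<tau> (Suc i))) \<omega> - \<beta> (min t (\<tau> i)) \<omega>))"
proof -
  have ti: "0 \<le> \<tau> i" "\<tau> i \<le> \<tau> (Suc i)" using simple_data_partition[OF g, of i "Suc i"] assms by auto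
  obtain K where "\<And>\<omega>. \<omega> \<in> space M \<Longrightarrow> \<bar>h i \<omega>\<bar> \<le> K" using simple_data_bounded[OF g \<open>i < n\<close>] by blast
  moreover have "h i \<in> borel_measurable M" using g assms ti measurable_F_M by (auto simp: simple_data_def)
  ultimately show ?thesis using ti assms
    by (intro square_integrable_bounded_mult square_integrable_increment) auto
qed

lemma square_integrable_simple_int:
  assumes "simple_data M F n \<tau> h" "0 \<le> t"
  shows "square_integrable M (simple_int n \<tau> h t)"
  unfolding simple_int_def[abs_def]
  by (intro square_integrable_sum simple_int_term_square_integrable[OF assms(1)]) (use assms in auto)

text \<open>Both expectations are evaluated to the same explicit sum \<open>V\<close> over pairs of
  cells. The form with two processes and two times is chosen because differences of integrals over
  unrelated partitions, and covariances at different times, follow from it by bilinearity.\<close>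

lemma simple_isometry:
  assumes g: "simple_data M F n \<tau> h" and g': "simple_data M F n' \<tau>' h'" and st: "0 \<le> s" "0 \<le> t"
  defines "V \<equiv> (\<Sum>i<n. \<Sum>j<n'. (\<integral>\<omega>. h i \<omega> * h' j \<omega> \<partial>M) *
      max 0 (min (min (\<tau> (Suc i)) (\<tau>' (Suc j))) (min s t) - max (\<tau> i) (\<tau>' j)))"
  shows "has_bochner_integral M (\<lambda>\<omega>. simple_int n \<tau> h s \<omega> * simple_int n' \<tau>' h' t \<omega>) V"
    and "has_bochner_integral M
      (\<lambda>\<omega>. LINT u:{0..min s t}|lborel. simple_proc n \<tau> h u \<omega> * simple_proc n' \<tau>' h' u \<omega>) V"
proof -
  have tau: "0 \<le> \<tau> i" "\<tau> i \<le> \<tau> (Suc i)" "h i \<in> borel_measurable (F (\<tau> i))" "h i \<in> borel_measurable M" if "i < n" for i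
    using simple_data_partition[OF g, of i "Suc i"] g that measurable_F_M by (auto simp: simple_data_def)
  have tau': "0 \<le> \<tau>' j" "\<tau>' j \<le> \<tau>' (Suc j)" "h' j \<in> borel_measurable (F (\<tau>' j))" "h' j \<in> borel_measurable M" if "j < n'" for j
    using simple_data_partition[OF g', of j "Suc j"] g' that measurable_F_M by (auto simp: simple_data_def)
  have hh: "integrable M (\<lambda>\<omega>. h i \<omega> * h' j \<omega>)" if ij: "i < n" "j < n'" for i j
  proof -
    obtain K where K: "\<And>\<omega>. \<omega> \<in> space M \<Longrightarrow> \<bar>h i \<omega>\<bar> \<le> K" using simple_data_bounded[OF g ij(1)] by blast
    obtain K' where K': "\<And>\<omega>. \<omega> \<in> space M \<Longrightarrow> \<bar>h' j \<omega>\<bar> \<le> K'" using simple_data_bounded[OF g' ij(2)] by blast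
    have "\<bar>h i \<omega> * h' j \<omega>\<bar> \<le> K * K'" if "\<omega> \<in> space M" for \<omega>
      unfolding abs_mult using K[OF that] K'[OF that] by (intro mult_mono) auto
    then show ?thesis using tau ij tau' by (intro integrable_const_bound[of _ "K * K'"]) auto
  qed
  have "has_bochner_integral M (\<lambda>\<omega>. h i \<omega> * (\<beta> (min s (\<tau> (Suc i))) \<omega> - \<beta> (min s (\<tau> i)) \<omega>) *
       (h' j \<omega> * (\<beta> (min t (\<tau>' (Suc j))) \<omega> - \<beta> (min t (\<tau>' j)) \<omega>)))
     ((\<integral>\<omega>. h i \<omega> * h' j \<omega> \<partial>M) * max 0 (min (min (\<tau> (Suc i)) (\<tau>' (Suc j))) (min s t) - max (\<tau> i) (\<tau>' j)))"
    if ij: "i < n" "j < n'" for i j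
  \<comment> \<open>A cell starting at or after its time horizon has a zero increment. It is split
    off because \<open>h i\<close> is measurable at \<open>\<tau> i\<close>, not at the earlier time
    \<open>min s (\<tau> i)\<close>.\<close>
  proof (cases "s \<le> \<tau> i \<or> t \<le> \<tau>' j")
    case True
    then have "max 0 (min (min (\<tau> (Suc i)) (\<tau>' (Suc j))) (min s t) - max (\<tau> i) (\<tau>' j)) = 0" by auto
    moreover have "h i \<omega> * (\<beta> (min s (\<tau> (Suc i))) \<omega> - \<beta> (min s (\<tau> i)) \<omega>) *
       (h' j \<omega> * (\<beta> (min t (\<tau>' (Suc j))) \<omega> - \<beta> (min t (\<tau>' j)) \<omega>)) = 0" for \<omega>
    proof -
      have "min s (\<tau> (Suc i)) = min s (\<tau> i) \<or> min t (\<tau>' (Suc j)) = min t (\<tau>' j)"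
        using True tau(2)[OF ij(1)] tau'(2)[OF ij(2)] by linarith
      then show ?thesis by auto
    qed
    ultimately show ?thesis by (simp only: has_bochner_integral_zero mult_zero_right)
  next
    case False
    obtain K where K: "\<And>\<omega>. \<omega> \<in> space M \<Longrightarrow> \<bar>h i \<omega>\<bar> \<le> K" using simple_data_bounded[OF g ij(1)] by blast
    obtain K' where K': "\<And>\<omega>. \<omega> \<in> space M \<Longrightarrow> \<bar>h' j \<omega>\<bar> \<le> K'" using simple_data_bounded[OF g' ij(2)] by blast
    have "has_bochner_integral M (\<lambda>\<omega>. h i \<omega> * (\<beta> (min s (\<tau> (Suc i))) \<omega> - \<beta> (\<tau> i) \<omega>) *
         (h' j \<omega> * (\<beta> (min t (\<tau>' (Suc j))) \<omega> - \<beta> (\<tau>' j) \<omega>)))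
       ((\<integral>\<omega>. h i \<omega> * h' j \<omega> \<partial>M) * max 0 (min (min s (\<tau> (Suc i))) (min t (\<tau>' (Suc j))) - max (\<tau> i) (\<tau>' j)))"
      using False tau[OF ij(1)] tau'[OF ij(2)] by (intro increment_covariance_overlap[OF _ _ _ _ _ K _ K']) auto
    moreover have "min s (\<tau> i) = \<tau> i" "min t (\<tau>' j) = \<tau>' j" using False by linarith+
    moreover have "min (min s (\<tau> (Suc i))) (min t (\<tau>' (Suc j))) = min (min (\<tau> (Suc i)) (\<tau>' (Suc j))) (min s t)"
      by linarith
    ultimately show ?thesis by (simp only:)
  qed
  then show "has_bochner_integral M (\<lambda>\<omega>. simple_int n \<tau> h s \<omega> * simple_int n' \<tau>' h' t \<omega>) V"
    unfolding simple_int_def sum_product V_def by (intro has_bochner_integral_sum) auto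
  have "has_bochner_integral M (\<lambda>\<omega>. \<Sum>i<n. \<Sum>j<n'. h i \<omega> * h' j \<omega> *
      max 0 (min (min (\<tau> (Suc i)) (\<tau>' (Suc j))) (min s t) - max (\<tau> i) (\<tau>' j))) V"
    unfolding V_def
    by (intro has_bochner_integral_sum has_bochner_integral_mult_left has_bochner_integral_integrable hh) auto
  then show "has_bochner_integral M
      (\<lambda>\<omega>. LINT u:{0..min s t}|lborel. simple_proc n \<tau> h u \<omega> * simple_proc n' \<tau>' h' u \<omega>) V"
    unfolding set_lebesgue_integral_def
      has_bochner_integral_integral_eq[OF has_bochner_integral_simple_proc_mult[OF g g', of "min s t"]] .
qed

text \<open>Cell by cell, the integral gains between \<open>s\<close> and \<open>t\<close> the value
  \<open>h i\<close> times the increment over the part of the cell inside \<open>[s, t]\<close>. At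
  the left end of that part both \<open>Z\<close> and \<open>h i\<close> are known.\<close>

lemma simple_int_martingale:
  assumes g: "simple_data M F n \<tau> h" and st: "0 \<le> s" "s \<le> t"
    and Z: "Z \<in> borel_measurable (F s)" "square_integrable M Z"
  shows "has_bochner_integral M (\<lambda>\<omega>. Z \<omega> * (simple_int n \<tau> h t \<omega> - simple_int n \<tau> h s \<omega>)) 0"
proof -
  have "has_bochner_integral M (\<lambda>\<omega>. \<Sum>i<n. Z \<omega> * (h i \<omega> * (\<beta> (min t (\<tau> (Suc i))) \<omega> - \<beta> (min t (\<tau> i)) \<omega>)
      - h i \<omega> * (\<beta> (min s (\<tau> (Suc i))) \<omega> - \<beta> (min s (\<tau> i)) \<omega>))) (\<Sum>i<n. 0)"
  proof (rule has_bochner_integral_sum)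
    fix i assume "i \<in> {..<n}"
    then have i: "i < n" by simp
    \<comment> \<open>The end points of the cell are clamped to \<open>[s, t]\<close>; they coincide
      when the cell misses the interior of this interval.\<close>
    define a where "a = max s (min t (\<tau> i))"
    define b where "b = max s (min t (\<tau> (Suc i)))"
    have tau: "0 \<le> \<tau> i" "\<tau> i \<le> \<tau> (Suc i)" "h i \<in> borel_measurable (F (\<tau> i))"
      using simple_data_partition[OF g, of i "Suc i"] g i by (auto simp: simple_data_def)
    obtain K where K: "\<And>\<omega>. \<omega> \<in> space M \<Longrightarrow> \<bar>h i \<omega>\<bar> \<le> K" using simple_data_bounded[OF g i] by blast
    have eq: "Z \<omega> * (h i \<omega> * (\<beta> (min t (\<tau> (Suc i))) \<omega> - \<beta> (min t (\<tau> i)) \<omega>)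
        - h i \<omega> * (\<beta> (min s (\<tau> (Suc i))) \<omega> - \<beta> (min s (\<tau> i)) \<omega>)) = Z \<omega> * h i \<omega> * (\<beta> b \<omega> - \<beta> a \<omega>)" for \<omega>
    proof -
      consider "\<tau> (Suc i) \<le> s" | "\<tau> i \<le> s" "s < \<tau> (Suc i)" | "s < \<tau> i" using tau(2) by linarith
      then show ?thesis
      proof cases
        case 1
        then have "min t (\<tau> (Suc i)) = \<tau> (Suc i)" "min t (\<tau> i) = \<tau> i" "min s (\<tau> (Suc i)) = \<tau> (Suc i)"
          "min s (\<tau> i) = \<tau> i" "a = b" using st tau(2) unfolding a_def b_def by linarith+
        then show ?thesis by simp
      next
        case 2
        then have "min t (\<tau> i) = \<tau> i" "min s (\<tau> (Suc i)) = s"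
          "min s (\<tau> i) = \<tau> i" "a = s" "b = min t (\<tau> (Suc i))" using st tau(2) unfolding a_def b_def by linarith+
        then show ?thesis by (simp add: algebra_simps)
      next
        case 3
        then have "min s (\<tau> (Suc i)) = s" "min s (\<tau> i) = s"
          "a = min t (\<tau> i)" "b = min t (\<tau> (Suc i))" using st tau(2) unfolding a_def b_def by linarith+
        then show ?thesis by (simp add: algebra_simps)
      qed
    qed
    have "has_bochner_integral M (\<lambda>\<omega>. Z \<omega> * h i \<omega> * (\<beta> b \<omega> - \<beta> a \<omega>)) 0"
    \<comment> \<open>If \<open>t \<le> \<tau> i\<close>, the coefficient \<open>h i\<close> need
      not be known at time \<open>a\<close>, but the increment is then zero.\<close>
    proof (cases "t \<le> \<tau> i")
      case True
      then have "a = b" using tau by (auto simp: a_def b_def)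
      then show ?thesis by (simp add: has_bochner_integral_zero)
    next
      case False
      have ab: "0 \<le> a" "a \<le> b" "s \<le> a" "\<tau> i \<le> a" using False tau st by (auto simp: a_def b_def)
      have "h i \<in> borel_measurable (F a)" "Z \<in> borel_measurable (F a)"
        using measurable_F_mono[OF tau(3)] measurable_F_mono[OF Z(1)] ab tau st by auto
      moreover have "h i \<in> borel_measurable M" using measurable_F_M[OF tau(3)] tau by auto
      then have "integrable M (\<lambda>\<omega>. h i \<omega> * Z \<omega>)"
        by (intro square_integrable_integrable square_integrable_bounded_mult[OF Z(2) _ K]) auto
      ultimately show ?thesis using ab by (intro increment_mean) (auto simp: mult.commute)
    qed
    then show "has_bochner_integral M (\<lambda>\<omega>. Z \<omega> * (h i \<omega> * (\<beta> (min t (\<tau> (Suc i))) \<omega> - \<beta> (min t (\<tau> i)) \<omega>)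
        - h i \<omega> * (\<beta> (min s (\<tau> (Suc i))) \<omega> - \<beta> (min s (\<tau> i)) \<omega>))) 0"
      unfolding eq .
  qed
  moreover have "Z \<omega> * (simple_int n \<tau> h t \<omega> - simple_int n \<tau> h s \<omega>) =
    (\<Sum>i<n. Z \<omega> * (h i \<omega> * (\<beta> (min t (\<tau> (Suc i))) \<omega> - \<beta> (min t (\<tau> i)) \<omega>)
      - h i \<omega> * (\<beta> (min s (\<tau> (Suc i))) \<omega> - \<beta> (min s (\<tau> i)) \<omega>)))" for \<omega>
    unfolding simple_int_def sum_subtractf[symmetric] sum_distrib_left ..
  ultimately show ?thesis by simp
qed

end

section \<open>The Ito isometry\<close>

text \<open>Capping the distance at 1 turns convergence in probability into convergence in L1, from
  which an almost surely convergent subsequence is extracted. Near the limit the cap is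
  inactive.\<close>

lemma conv_in_prob_AE_subseq:
  fixes X :: "nat \<Rightarrow> 'w \<Rightarrow> 'b::{metric_space, second_countable_topology}"
  assumes "prob_space M" and X[measurable]: "\<And>k. X k \<in> borel_measurable M" and Y[measurable]: "Y \<in> borel_measurable M"
    and conv: "conv_in_prob M X Y"
  obtains r :: "nat \<Rightarrow> nat" where "strict_mono r" "AE \<omega> in M. (\<lambda>k. X (r k) \<omega>) \<longlonglongrightarrow> Y \<omega>"
proof -
  interpret prob_space M by fact
  define u where "u k \<omega> = min 1 (dist (X k \<omega>) (Y \<omega>))" for k \<omega>
  have u_meas [measurable]: "u k \<in> borel_measurable M" for k unfolding u_def by measurable
  have u_int: "integrable M (u k)" for k
    by (rule integrable_const_bound[of _ 1]) (auto simp: u_def)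
  have "(\<lambda>k. \<integral>\<omega>. norm (u k \<omega>) \<partial>M) \<longlonglongrightarrow> 0"
  proof (rule LIMSEQ_I)
    fix e :: real assume "0 < e"
    define A where "A k = {\<omega>\<in>space M. dist (X k \<omega>) (Y \<omega>) > e/2}" for k
    have "(\<lambda>k. measure M (A k)) \<longlonglongrightarrow> 0" unfolding A_def by (rule conv[unfolded conv_in_prob_def, rule_format]) (use \<open>0 < e\<close> in simp)
    then have "\<forall>\<^sub>F k in sequentially. measure M (A k) < e / 2"
      using \<open>0 < e\<close> by (intro order_tendstoD(2)) auto
    then obtain N where N: "\<And>k. k \<ge> N \<Longrightarrow> measure M (A k) < e / 2" by (auto simp: eventually_sequentially)
    have "norm ((\<integral>\<omega>. norm (u k \<omega>) \<partial>M) - 0) < e" if "k \<ge> N" for k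
    proof -
      have A [measurable]: "A k \<in> sets M" unfolding A_def by measurable
      have "(\<integral>\<omega>. norm (u k \<omega>) \<partial>M) \<le> (\<integral>\<omega>. e / 2 + indicator (A k) \<omega> \<partial>M)"
      proof (rule integral_mono)
        show "integrable M (\<lambda>\<omega>. norm (u k \<omega>))" using u_int by simp
        show "integrable M (\<lambda>\<omega>. e / 2 + indicator (A k) \<omega>)"
          by (intro Bochner_Integration.integrable_add integrable_const integrable_real_indicator A) (auto simp: emeasure_eq_measure)
        show "norm (u k \<omega>) \<le> e / 2 + indicator (A k) \<omega>" if "\<omega> \<in> space M" for \<omega>
          using that \<open>0 < e\<close> by (auto simp: u_def A_def indicator_def)
      qed
      also have "\<dots> = e / 2 + measure M (A k)" using A by (simp add: prob_space emeasure_eq_measure sets.Int_space_eq2)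
      finally have "(\<integral>\<omega>. norm (u k \<omega>) \<partial>M) < e" using N[OF that] by simp
      moreover have "0 \<le> (\<integral>\<omega>. norm (u k \<omega>) \<partial>M)" by (rule integral_nonneg_AE) auto
      ultimately show ?thesis by simp
    qed
    then show "\<exists>N. \<forall>k\<ge>N. norm ((\<integral>\<omega>. norm (u k \<omega>) \<partial>M) - 0) < e" by blast
  qed
  then obtain r :: "nat \<Rightarrow> nat" where r: "strict_mono r" "AE \<omega> in M. (\<lambda>k. u (r k) \<omega>) \<longlonglongrightarrow> 0"
    using tendsto_L1_AE_subseq[of M u, OF u_int] by auto
  have "AE \<omega> in M. (\<lambda>k. X (r k) \<omega>) \<longlonglongrightarrow> Y \<omega>"
    using r(2)
  proof eventually_elim
    case (elim \<omega>)
    have "\<forall>\<^sub>F k in sequentially. u (r k) \<omega> < 1" using elim by (rule order_tendstoD(2)) simp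
    then have "\<forall>\<^sub>F k in sequentially. u (r k) \<omega> = dist (X (r k) \<omega>) (Y \<omega>)"
      by eventually_elim (auto simp: u_def)
    then have "(\<lambda>k. dist (X (r k) \<omega>) (Y \<omega>)) \<longlonglongrightarrow> 0" by (rule Lim_transform_eventually[OF elim])
    then show ?case by (simp add: tendsto_dist_iff[symmetric])
  qed
  then show ?thesis using r(1) that by blast
qed

lemma conv_in_prob_subseq:
  assumes "conv_in_prob M X Y" "strict_mono r"
  shows "conv_in_prob M (\<lambda>k. X (r k)) Y"
  unfolding conv_in_prob_def
proof (intro allI impI)
  fix e :: real assume "0 < e"
  then have "(\<lambda>k. measure M {\<omega>\<in>space M. dist (X k \<omega>) (Y \<omega>) > e}) \<longlonglongrightarrow> 0"
    using assms(1) by (auto simp: conv_in_prob_def)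
  from LIMSEQ_subseq_LIMSEQ[OF this assms(2)]
  show "(\<lambda>k. measure M {\<omega>\<in>space M. dist (X (r k) \<omega>) (Y \<omega>) > e}) \<longlonglongrightarrow> 0" by (simp add: o_def)
qed

text \<open>Progressive measurability speaks of the strip up to \<open>t\<close> and of
  \<open>F t\<close>, with time as first coordinate. Extending by zero outside the strip and
  swapping coordinates brings it into the form in which Fubini's theorem on
  \<open>M \<Otimes>\<^sub>M lborel\<close> applies.\<close>

lemma progressive_measurable:
  assumes filtered: "filtered_prob_space M F" and H: "progressive F H" and "0 \<le> t"
  shows "(\<lambda>(\<omega>, u). indicator {0..t} u * H u \<omega>) \<in> borel_measurable (M \<Otimes>\<^sub>M lborel)"
proof -
  let ?P = "M \<Otimes>\<^sub>M (lborel :: real measure)" and ?A = "{z. snd z \<in> {0..t}}"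
  have A: "{z \<in> space ?P. z \<in> ?A} \<in> sets ?P" unfolding mem_Collect_eq by measurable
  have swap: "(\<lambda>z. (snd z, fst z)) \<in> measurable (restrict_space ?P ?A) (restrict_space borel {0..t} \<Otimes>\<^sub>M F t)"
  proof (rule measurable_Pair)
    have "snd \<in> measurable ?P borel" by simp
    then show "snd \<in> measurable (restrict_space ?P ?A) (restrict_space borel {0..t})"
      by (intro measurable_restrict_space3) auto
    have "(\<lambda>\<omega>. \<omega>) \<in> measurable M (F t)"
      using filtered \<open>0 \<le> t\<close> sets.sets_into_space[of _ M]
      by (auto simp: filtered_prob_space_def subalgebra_def measurable_def Int_absorb2 subset_eq)
    from measurable_compose[OF measurable_fst[of M "lborel :: real measure"] this]
    have "fst \<in> measurable ?P (F t)" by simp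
    then show "fst \<in> measurable (restrict_space ?P ?A) (F t)" by (rule measurable_restrict_space1)
  qed
  have "(\<lambda>(s, \<omega>). H s \<omega>) \<in> borel_measurable (restrict_space borel {0..t} \<Otimes>\<^sub>M F t)"
    using H \<open>0 \<le> t\<close> by (auto simp: progressive_def)
  from measurable_compose[OF swap this]
  have "(\<lambda>z. H (snd z) (fst z)) \<in> borel_measurable (restrict_space ?P ?A)" by simp
  then have "(\<lambda>z. if z \<in> ?A then H (snd z) (fst z) else 0) \<in> borel_measurable ?P"
    by (subst measurable_If_restrict_space_iff[OF A]) simp
  then show ?thesis
    by (rule measurable_cong[THEN iffD1, rotated]) (auto simp: indicator_def)
qed

lemma simple_data_cell_nonneg:
  assumes "simple_data M F n \<tau> h" "j < n"
  shows "0 \<le> min t (\<tau> (Suc j)) - min t (\<tau> j)"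
  using simple_data_partition(2)[OF assms(1), of j "Suc j"] assms(2) by auto

text \<open>The pathwise integrability is an explicit premise because the Bochner integral of a
  nonintegrable function is 0: the integrability of the outer integral alone would not detect paths
  of infinite energy.\<close>

lemma integrable_square_product:
  assumes "prob_space M" and f: "f \<in> borel_measurable (M \<Otimes>\<^sub>M (lborel :: real measure))"
    and ae: "AE \<omega> in M. integrable lborel (\<lambda>u. (f (\<omega>, u))\<^sup>2)"
    and int: "integrable M (\<lambda>\<omega>. \<integral>u. (f (\<omega>, u))\<^sup>2 \<partial>lborel)"
  shows "square_integrable (M \<Otimes>\<^sub>M lborel) f"
proof -
  interpret prob_space M by fact
  interpret pair_sigma_finite M "lborel :: real measure" ..
  have "integrable (M \<Otimes>\<^sub>M lborel) (\<lambda>z. (f z)\<^sup>2)"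
    by (rule Fubini_integrable) (use assms in auto)
  then show ?thesis using f by (simp add: square_integrable_def)
qed

text \<open>A subsequence for the integrands is thinned once more for the integrals, so that both
  limits hold almost surely along the same simple processes. Almost sure limits are what Fatou's
  lemma and the pathwise truncation work with.\<close>

lemma has_ito_integral_AE_approximation:
  fixes B :: "real \<Rightarrow> 'w \<Rightarrow> real^'d"
  assumes filtered: "filtered_prob_space M F" and adapted: "adapted F B"
    and ito: "has_ito_integral M F B H t J" and "0 \<le> t"
  obtains n \<tau> h where "\<And>k. simple_data M F (n k) (\<tau> k) (h k)"
    "AE \<omega> in M. (\<lambda>k. LINT u:{0..t}|lborel. (simple_proc (n k) (\<tau> k) (h k) u \<omega> - H u \<omega>)\<^sup>2) \<longlonglongrightarrow> 0"
    "AE \<omega> in M. (\<lambda>k. simple_ito B (n k) (\<tau> k) (h k) t \<omega>) \<longlonglongrightarrow> J \<omega>"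
proof -
  interpret prob_space M using filtered by (simp add: filtered_prob_space_def)
  from ito obtain n \<tau> h where s: "\<And>k. simple_data M F (n k) (\<tau> k) (h k)"
    and c1: "conv_in_prob M (\<lambda>k \<omega>. LINT u:{0..t}|lborel. (simple_proc (n k) (\<tau> k) (h k) u \<omega> - H u \<omega>)\<^sup>2) (\<lambda>\<omega>. 0)"
    and c2: "conv_in_prob M (\<lambda>k. simple_ito B (n k) (\<tau> k) (h k) t) J"
    and J[measurable]: "J \<in> borel_measurable M" and prog: "progressive F H"
    unfolding has_ito_integral_def by blast
  have FM: "f \<in> borel_measurable M" if "f \<in> borel_measurable (F s)" "0 \<le> s"
    for f :: "'w \<Rightarrow> 'b::topological_space" and s
    using measurable_from_subalg[of M "F s"] that filtered by (auto simp: filtered_prob_space_def)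
  have tau: "0 \<le> \<tau> k i" if "i \<le> n k" for k i using simple_data_partition(1)[OF s that] by simp
  have hM: "h k i \<in> borel_measurable M" if "i < n k" for k i
    using s[of k] that tau[of i k] by (auto simp: simple_data_def intro: FM)
  note progressive_measurable[OF filtered prog \<open>0 \<le> t\<close>, measurable]
  have m1 [measurable]: "(\<lambda>\<omega>. LINT u:{0..t}|lborel. (simple_proc (n k) (\<tau> k) (h k) u \<omega> - H u \<omega>)\<^sup>2) \<in> borel_measurable M" for k
  proof -
    have "(\<lambda>(\<omega>, u). simple_proc (n k) (\<tau> k) (h k) u \<omega>) \<in> borel_measurable (M \<Otimes>\<^sub>M lborel)"
      unfolding simple_proc_def case_prod_unfold
      by (intro borel_measurable_sum borel_measurable_times measurable_compose[OF measurable_fst hM]) auto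
    note this[measurable]
    have "(\<lambda>\<omega>. \<integral>u. (indicator {0..t} u * simple_proc (n k) (\<tau> k) (h k) u \<omega> - indicator {0..t} u * H u \<omega>)\<^sup>2 \<partial>lborel) \<in> borel_measurable M"
      by measurable
    moreover have "(indicator {0..t} u * simple_proc (n k) (\<tau> k) (h k) u \<omega> - indicator {0..t} u * H u \<omega>)\<^sup>2 =
        indicator {0..t} u *\<^sub>R (simple_proc (n k) (\<tau> k) (h k) u \<omega> - H u \<omega>)\<^sup>2" for u \<omega>
      by (simp add: indicator_def)
    ultimately show ?thesis by (simp add: set_lebesgue_integral_def)
  qed
  have m2 [measurable]: "simple_ito B (n k) (\<tau> k) (h k) t \<in> borel_measurable M" for k
  proof -
    have "B (min t x) \<in> borel_measurable M" if "0 \<le> x" for x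
      using adapted that \<open>0 \<le> t\<close> by (intro FM[of "B (min t x)" "min t x"]) (auto simp: adapted_def)
    then show ?thesis unfolding simple_ito_def[abs_def]
      using tau hM by (intro borel_measurable_sum borel_measurable_scaleR borel_measurable_diff) auto
  qed
  obtain r1 :: "nat \<Rightarrow> nat" where r1: "strict_mono r1"
    "AE \<omega> in M. (\<lambda>k. LINT u:{0..t}|lborel. (simple_proc (n (r1 k)) (\<tau> (r1 k)) (h (r1 k)) u \<omega> - H u \<omega>)\<^sup>2) \<longlonglongrightarrow> 0"
    by (rule conv_in_prob_AE_subseq[OF prob_space_axioms m1 _ c1]) auto
  obtain r2 :: "nat \<Rightarrow> nat" where r2: "strict_mono r2"
    "AE \<omega> in M. (\<lambda>k. simple_ito B (n (r1 (r2 k))) (\<tau> (r1 (r2 k))) (h (r1 (r2 k))) t \<omega>) \<longlonglongrightarrow> J \<omega>"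
    by (rule conv_in_prob_AE_subseq[OF prob_space_axioms m2 J conv_in_prob_subseq[OF c2 r1(1)]]) auto
  have "AE \<omega> in M. (\<lambda>k. LINT u:{0..t}|lborel. (simple_proc (n (r1 (r2 k))) (\<tau> (r1 (r2 k))) (h (r1 (r2 k))) u \<omega> - H u \<omega>)\<^sup>2) \<longlonglongrightarrow> 0"
    using r1(2)
  proof eventually_elim
    case (elim \<omega>)
    show ?case using LIMSEQ_subseq_LIMSEQ[OF elim r2(1)] by (simp add: o_def)
  qed
  then show ?thesis using r2(2) s by (intro that) auto
qed

text \<open>One scalar Ito integral at one fixed time, together with approximations converging
  almost surely. Paths of \<open>H\<close> have finite energy, but no moment of this energy or of
  \<open>J\<close> is assumed; moments are the outcome.\<close>

locale ito_approximation = unit_rate_martingale +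
  fixes H :: "real \<Rightarrow> 'a \<Rightarrow> real" and t :: real and J :: "'a \<Rightarrow> real"
    and n :: "nat \<Rightarrow> nat" and \<tau> :: "nat \<Rightarrow> nat \<Rightarrow> real" and h :: "nat \<Rightarrow> nat \<Rightarrow> 'a \<Rightarrow> real"
  assumes t: "0 \<le> t"
    and H_measurable: "(\<lambda>(\<omega>, u). indicator {0..t} u * H u \<omega>) \<in> borel_measurable (M \<Otimes>\<^sub>M lborel)"
    and H_square: "AE \<omega> in M. set_integrable lborel {0..t} (\<lambda>u. (H u \<omega>)\<^sup>2)"
    and J_measurable: "J \<in> borel_measurable M"
    and simple: "\<And>k. simple_data M F (n k) (\<tau> k) (h k)"
    and H_limit: "AE \<omega> in M. (\<lambda>k. LINT u:{0..t}|lborel. (simple_proc (n k) (\<tau> k) (h k) u \<omega> - H u \<omega>)\<^sup>2) \<longlonglongrightarrow> 0"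
    and J_limit: "AE \<omega> in M. (\<lambda>k. simple_int (n k) (\<tau> k) (h k) t \<omega>) \<longlonglongrightarrow> J \<omega>"

context unit_rate_martingale begin

text \<open>The simple process as an element of L2 over the product of the sample space and time,
  where the isometry becomes an identity between inner products.\<close>

definition simple_prod :: "real \<Rightarrow> nat \<Rightarrow> (nat \<Rightarrow> real) \<Rightarrow> (nat \<Rightarrow> 'a \<Rightarrow> real) \<Rightarrow> 'a \<times> real \<Rightarrow> real" where
  "simple_prod t n \<tau> h z = indicator {0..t} (snd z) * simple_proc n \<tau> h (snd z) (fst z)"

lemma measurable_simple_data:
  assumes "simple_data M F n \<tau> h" "i < n" shows "h i \<in> borel_measurable M"
  using assms simple_data_partition(1)[OF assms(1), of i n] measurable_F_M by (auto simp: simple_data_def)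

lemma simple_isometry_integrable:
  assumes g: "simple_data M F n \<tau> h" and "0 \<le> t"
  shows "has_bochner_integral M (\<lambda>\<omega>. (simple_int n \<tau> h t \<omega>)\<^sup>2)
    (\<integral>\<omega>. (\<Sum>j<n. (h j \<omega>)\<^sup>2 * (min t (\<tau> (Suc j)) - min t (\<tau> j))) \<partial>M)"
    "integrable M (\<lambda>\<omega>. \<Sum>j<n. (h j \<omega>)\<^sup>2 * (min t (\<tau> (Suc j)) - min t (\<tau> j)))"
proof -
  have "(LINT u:{0..min t t}|lborel. simple_proc n \<tau> h u \<omega> * simple_proc n \<tau> h u \<omega>)
      = (\<Sum>j<n. (h j \<omega>)\<^sup>2 * (min t (\<tau> (Suc j)) - min t (\<tau> j)))" for \<omega>
    using has_bochner_integral_integral_eq[OF has_bochner_integral_simple_proc_square[OF g, of t \<omega>]]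
    by (simp add: set_lebesgue_integral_def power2_eq_square)
  note eq = this
  note iso = simple_isometry[OF g g assms(2) assms(2), unfolded eq]
  show "integrable M (\<lambda>\<omega>. \<Sum>j<n. (h j \<omega>)\<^sup>2 * (min t (\<tau> (Suc j)) - min t (\<tau> j)))"
    using iso(2) by (simp add: has_bochner_integral_iff)
  show "has_bochner_integral M (\<lambda>\<omega>. (simple_int n \<tau> h t \<omega>)\<^sup>2)
    (\<integral>\<omega>. (\<Sum>j<n. (h j \<omega>)\<^sup>2 * (min t (\<tau> (Suc j)) - min t (\<tau> j))) \<partial>M)"
    using iso by (simp add: has_bochner_integral_iff power2_eq_square)
qed

lemma square_integrable_simple_prod:
  assumes g: "simple_data M F n \<tau> h" and "0 \<le> t"
  shows "square_integrable (M \<Otimes>\<^sub>M lborel) (simple_prod t n \<tau> h)"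
proof (rule integrable_square_product[OF prob_space_axioms])
  show "simple_prod t n \<tau> h \<in> borel_measurable (M \<Otimes>\<^sub>M lborel)"
    unfolding simple_prod_def[abs_def] simple_proc_def
    by (intro borel_measurable_sum borel_measurable_times measurable_compose[OF measurable_fst measurable_simple_data[OF g]]) auto
  have sq: "(simple_prod t n \<tau> h (\<omega>, u))\<^sup>2 = indicator {0..t} u *\<^sub>R (simple_proc n \<tau> h u \<omega>)\<^sup>2" for u \<omega>
    by (simp add: simple_prod_def power_mult_distrib indicator_def)
  note b = has_bochner_integral_simple_proc_square[OF g, of t]
  show "AE \<omega> in M. integrable lborel (\<lambda>u. (simple_prod t n \<tau> h (\<omega>, u))\<^sup>2)"
    unfolding sq using b by (auto simp: has_bochner_integral_iff)
  show "integrable M (\<lambda>\<omega>. \<integral>u. (simple_prod t n \<tau> h (\<omega>, u))\<^sup>2 \<partial>lborel)"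
    unfolding sq has_bochner_integral_integral_eq[OF b] by (rule simple_isometry_integrable(2)[OF assms])
qed

lemma simple_isometry_product:
  assumes g: "simple_data M F n \<tau> h" and g': "simple_data M F n' \<tau>' h'" and st: "0 \<le> s" "0 \<le> t"
  shows "(\<integral>\<omega>. simple_int n \<tau> h s \<omega> * simple_int n' \<tau>' h' t \<omega> \<partial>M)
    = (\<integral>z. simple_prod s n \<tau> h z * simple_prod t n' \<tau>' h' z \<partial>(M \<Otimes>\<^sub>M lborel))"
proof -
  interpret pair_sigma_finite M "lborel :: real measure" ..
  have "(\<integral>z. simple_prod s n \<tau> h z * simple_prod t n' \<tau>' h' z \<partial>(M \<Otimes>\<^sub>M lborel))
      = (\<integral>\<omega>. (\<integral>u. simple_prod s n \<tau> h (\<omega>, u) * simple_prod t n' \<tau>' h' (\<omega>, u) \<partial>lborel) \<partial>M)"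
    by (rule integral_fst'[symmetric])
       (intro square_integrable_mult square_integrable_simple_prod assms)
  also have "\<dots> = (\<integral>\<omega>. (LINT u:{0..min s t}|lborel. simple_proc n \<tau> h u \<omega> * simple_proc n' \<tau>' h' u \<omega>) \<partial>M)"
    unfolding set_lebesgue_integral_def simple_prod_def
    by (intro Bochner_Integration.integral_cong refl) (auto simp: indicator_def)
  also have "\<dots> = (\<integral>\<omega>. simple_int n \<tau> h s \<omega> * simple_int n' \<tau>' h' t \<omega> \<partial>M)"
    using simple_isometry[OF assms] by (simp add: has_bochner_integral_iff)
  finally show ?thesis ..
qed

text \<open>Two simple processes over different partitions have no common \<open>simple_data\<close>
  at hand, so the square is expanded and the bilinear isometry is applied to its three
  terms.\<close>

lemma simple_isometry_diff:
  assumes g: "simple_data M F n \<tau> h" and g': "simple_data M F n' \<tau>' h'" and st: "0 \<le> t"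
  shows "(\<integral>\<omega>. (simple_int n \<tau> h t \<omega> - simple_int n' \<tau>' h' t \<omega>)\<^sup>2 \<partial>M)
    = (\<integral>z. (simple_prod t n \<tau> h z - simple_prod t n' \<tau>' h' z)\<^sup>2 \<partial>(M \<Otimes>\<^sub>M lborel))"
proof -
  have expand: "(\<integral>x. (a x - b x)\<^sup>2 \<partial>N) = (\<integral>x. a x * a x \<partial>N) - 2 * (\<integral>x. a x * b x \<partial>N) + (\<integral>x. b x * b x \<partial>N)"
    if "square_integrable N a" "square_integrable N b" for a b :: "'c \<Rightarrow> real" and N
  proof -
    have "(\<integral>x. (a x - b x)\<^sup>2 \<partial>N) = (\<integral>x. a x * a x - 2 * (a x * b x) + b x * b x \<partial>N)"
      by (intro Bochner_Integration.integral_cong refl) (simp add: power2_eq_square algebra_simps)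
    then show ?thesis
      using square_integrable_mult[OF that(1) that(1)] square_integrable_mult[OF that(2) that(2)]
        square_integrable_mult[OF that] by simp
  qed
  show ?thesis
    using st
    by (simp add: expand square_integrable_simple_int square_integrable_simple_prod g g' simple_isometry_product)
qed

end

section \<open>Truncated approximations of a scalar Ito integral\<close>

context ito_approximation begin

abbreviation P :: "('a \<times> real) measure" where "P \<equiv> M \<Otimes>\<^sub>M lborel"

definition integrand :: "'a \<times> real \<Rightarrow> real" where
  "integrand z = indicator {0..t} (snd z) * H (snd z) (fst z)"

definition Q :: "'a \<Rightarrow> real" where "Q \<omega> = (LINT u:{0..t}|lborel. (H u \<omega>)\<^sup>2)"

definition q :: "nat \<Rightarrow> 'a \<Rightarrow> real" where
  "q k \<omega> = (\<Sum>j<n k. (h k j \<omega>)\<^sup>2 * (min t (\<tau> k (Suc j)) - min t (\<tau> k j)))"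

abbreviation cut :: "real \<Rightarrow> nat \<Rightarrow> nat \<Rightarrow> 'a \<Rightarrow> real" where "cut K k \<equiv> cutoff K t (\<tau> k) (h k)"

text \<open>The squared L2 error in time of the truncated process, path by path; its expectation is
  the squared error on the product space.\<close>

definition defect :: "real \<Rightarrow> nat \<Rightarrow> 'a \<Rightarrow> real" where
  "defect K k \<omega> = (\<integral>u. (simple_prod t (n k) (\<tau> k) (cut K k) (\<omega>, u) - integrand (\<omega>, u))\<^sup>2 \<partial>lborel)"

lemma simple_cut: "simple_data M F (n k) (\<tau> k) (cut K k)"
  by (rule simple_data_cutoff[OF filtered simple])

lemma integrand_measurable [measurable]: "integrand \<in> borel_measurable P"
  using H_measurable by (simp add: integrand_def[abs_def] case_prod_unfold)

lemma integrand_square: "(integrand (\<omega>, u))\<^sup>2 = indicator {0..t} u *\<^sub>R (H u \<omega>)\<^sup>2"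
  by (simp add: integrand_def indicator_def)

lemma Q_eq: "Q \<omega> = (\<integral>u. (integrand (\<omega>, u))\<^sup>2 \<partial>lborel)"
  by (simp add: Q_def integrand_square set_lebesgue_integral_def)

lemma Q_measurable [measurable]: "Q \<in> borel_measurable M"
  unfolding Q_eq[abs_def] by measurable

lemma Q_nonneg: "0 \<le> Q \<omega>"
  unfolding Q_eq by (rule integral_nonneg_AE) simp

lemma simple_prod_section:
  assumes g: "simple_data M F m \<sigma> g"
  shows "square_integrable lborel (\<lambda>u. simple_prod t m \<sigma> g (\<omega>, u))"
    "(\<integral>u. (simple_prod t m \<sigma> g (\<omega>, u))\<^sup>2 \<partial>lborel) = (\<Sum>j<m. (g j \<omega>)\<^sup>2 * (min t (\<sigma> (Suc j)) - min t (\<sigma> j)))"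
proof -
  have sq: "(simple_prod t m \<sigma> g (\<omega>, u))\<^sup>2 = indicator {0..t} u *\<^sub>R (simple_proc m \<sigma> g u \<omega>)\<^sup>2" for u
    by (simp add: simple_prod_def power_mult_distrib indicator_def)
  note b = has_bochner_integral_simple_proc_square[OF g, of t \<omega>]
  have "(\<lambda>u. simple_prod t m \<sigma> g (\<omega>, u)) \<in> borel_measurable lborel"
    unfolding simple_prod_def simple_proc_def fst_conv snd_conv by measurable
  then show "square_integrable lborel (\<lambda>u. simple_prod t m \<sigma> g (\<omega>, u))"
    unfolding square_integrable_def sq using b by (auto simp: has_bochner_integral_iff)
  show "(\<integral>u. (simple_prod t m \<sigma> g (\<omega>, u))\<^sup>2 \<partial>lborel) = (\<Sum>j<m. (g j \<omega>)\<^sup>2 * (min t (\<sigma> (Suc j)) - min t (\<sigma> j)))"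
    unfolding sq using b by (auto simp: has_bochner_integral_iff)
qed

lemma integrand_section: "AE \<omega> in M. square_integrable lborel (\<lambda>u. integrand (\<omega>, u))"
  using H_square AE_space
proof eventually_elim
  case (elim \<omega>)
  have "(\<lambda>u. integrand (\<omega>, u)) \<in> borel_measurable lborel"
    using measurable_compose[OF measurable_Pair1'[OF elim(2)] integrand_measurable] by simp
  then show ?case using elim(1) by (simp add: square_integrable_def integrand_square set_integrable_def)
qed

text \<open>For almost every path the approximants converge in L2 of time, hence so do their squared
  norms.\<close>

lemma q_limit: "AE \<omega> in M. (\<lambda>k. q k \<omega>) \<longlonglongrightarrow> Q \<omega>"
  using integrand_section H_limit
proof eventually_elim
  case (elim \<omega>)
  have "(simple_prod t (n k) (\<tau> k) (h k) (\<omega>, u) - integrand (\<omega>, u))\<^sup>2 =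
      indicator {0..t} u *\<^sub>R (simple_proc (n k) (\<tau> k) (h k) u \<omega> - H u \<omega>)\<^sup>2" for k u
    by (simp add: simple_prod_def integrand_def indicator_def)
  then have lim: "(\<lambda>k. \<integral>u. (simple_prod t (n k) (\<tau> k) (h k) (\<omega>, u) - integrand (\<omega>, u))\<^sup>2 \<partial>lborel) \<longlonglongrightarrow> 0"
    using elim(2) by (simp add: set_lebesgue_integral_def)
  note sec = simple_prod_section[OF simple]
  have "(\<lambda>k. \<integral>u. simple_prod t (n k) (\<tau> k) (h k) (\<omega>, u) * simple_prod t (n k) (\<tau> k) (h k) (\<omega>, u) \<partial>lborel)
      \<longlonglongrightarrow> (\<integral>u. integrand (\<omega>, u) * integrand (\<omega>, u) \<partial>lborel)"
    by (rule tendsto_integral_mult[OF sec(1) elim(1) lim sec(1) elim(1) lim])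
  then show ?case
    unfolding q_def sec(2)[symmetric] Q_eq by (simp only: power2_eq_square)
qed

lemma below_cutoff:
  assumes "q k \<omega> \<le> K"
  shows "simple_int (n k) (\<tau> k) (cut K k) t \<omega> = simple_int (n k) (\<tau> k) (h k) t \<omega>"
    "simple_prod t (n k) (\<tau> k) (cut K k) (\<omega>, u) = simple_prod t (n k) (\<tau> k) (h k) (\<omega>, u)"
proof -
  have "cut K k i \<omega> = h k i \<omega>" if "i < n k" for i
    using cutoff_eq[OF simple that] assms by (simp add: q_def)
  then show "simple_int (n k) (\<tau> k) (cut K k) t \<omega> = simple_int (n k) (\<tau> k) (h k) t \<omega>"
    "simple_prod t (n k) (\<tau> k) (cut K k) (\<omega>, u) = simple_prod t (n k) (\<tau> k) (h k) (\<omega>, u)"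
    by (auto simp: simple_int_def simple_prod_def simple_proc_def)
qed

text \<open>Where \<open>Q \<omega> < K\<close>, strictness gives \<open>q k \<omega> < K\<close>
  for large \<open>k\<close>, so the truncated integrals eventually agree with the original ones and
  tend to \<open>J\<close>. Fatou's lemma reduces the claim to their second moments, which the
  isometry and \<open>cutoff_sum_le\<close> bound by the mean of
  \<open>min K (q k \<omega>)\<close>; bounded convergence does the rest. The estimate holds whether
  or not \<open>Q\<close> is integrable, and this is what gives access to the first moment
  bounds.\<close>

lemma second_moment_localized:
  assumes "0 \<le> K"
  shows "(\<integral>\<^sup>+\<omega>. ennreal ((J \<omega>)\<^sup>2) * indicator {\<omega>. Q \<omega> < K} \<omega> \<partial>M) \<le> (\<integral>\<^sup>+\<omega>. ennreal (min K (Q \<omega>)) \<partial>M)"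
proof -
  let ?I = "\<lambda>k \<omega>. simple_int (n k) (\<tau> k) (cut K k) t \<omega>"
  have Im [measurable]: "?I k \<in> borel_measurable M" for k
    using square_integrable_simple_int[OF simple_cut t] by (simp add: square_integrable_def)
  have qm [measurable]: "q k \<in> borel_measurable M" for k
    using simple_isometry_integrable(2)[OF simple t] by (auto simp: q_def[abs_def])
  have le: "AE \<omega> in M. ennreal ((J \<omega>)\<^sup>2) * indicator {\<omega>. Q \<omega> < K} \<omega> \<le> liminf (\<lambda>k. ennreal ((?I k \<omega>)\<^sup>2))"
    using q_limit J_limit
  proof eventually_elim
    case (elim \<omega>)
    show ?case
    proof (cases "Q \<omega> < K")
      case True
      then have "\<forall>\<^sub>F k in sequentially. q k \<omega> < K" using elim(1) by (intro order_tendstoD(2))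
      then have "\<forall>\<^sub>F k in sequentially. simple_int (n k) (\<tau> k) (h k) t \<omega> = ?I k \<omega>"
        by eventually_elim (simp add: below_cutoff)
      then have "(\<lambda>k. ?I k \<omega>) \<longlonglongrightarrow> J \<omega>" by (rule Lim_transform_eventually[OF elim(2)])
      then have "(\<lambda>k. ennreal ((?I k \<omega>)\<^sup>2)) \<longlonglongrightarrow> ennreal ((J \<omega>)\<^sup>2)" by (intro tendsto_intros)
      from lim_imp_Liminf[OF trivial_limit_sequentially this] show ?thesis using True by simp
    qed simp
  qed
  have bound: "(\<integral>\<^sup>+\<omega>. ennreal ((?I k \<omega>)\<^sup>2) \<partial>M) \<le> (\<integral>\<^sup>+\<omega>. ennreal (min K (q k \<omega>)) \<partial>M)" for k
  proof -
    let ?S = "\<lambda>\<omega>. \<Sum>j<n k. (cut K k j \<omega>)\<^sup>2 * (min t (\<tau> k (Suc j)) - min t (\<tau> k j))"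
    note iso = simple_isometry_integrable[OF simple_cut[of k K] t]
    have S0: "0 \<le> ?S \<omega>" for \<omega>
      by (intro sum_nonneg mult_nonneg_nonneg simple_data_cell_nonneg[OF simple]) auto
    have "(\<integral>\<^sup>+\<omega>. ennreal ((?I k \<omega>)\<^sup>2) \<partial>M) = ennreal (\<integral>\<omega>. ?S \<omega> \<partial>M)"
      using iso(1) by (subst nn_integral_eq_integral) (auto simp: has_bochner_integral_iff)
    also have "\<dots> = (\<integral>\<^sup>+\<omega>. ennreal (?S \<omega>) \<partial>M)"
      using iso(2) S0 by (subst nn_integral_eq_integral) auto
    also have "\<dots> \<le> (\<integral>\<^sup>+\<omega>. ennreal (min K (q k \<omega>)) \<partial>M)"
      using cutoff_sum_le[OF simple assms] by (intro nn_integral_mono ennreal_leI) (simp add: q_def)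
    finally show ?thesis .
  qed
  have lim: "(\<lambda>k. \<integral>\<^sup>+\<omega>. ennreal (min K (q k \<omega>)) \<partial>M) \<longlonglongrightarrow> (\<integral>\<^sup>+\<omega>. ennreal (min K (Q \<omega>)) \<partial>M)"
  proof (rule nn_integral_dominated_convergence[where w="\<lambda>_. ennreal K"])
    show "AE \<omega> in M. (\<lambda>k. ennreal (min K (q k \<omega>))) \<longlonglongrightarrow> ennreal (min K (Q \<omega>))"
      using q_limit by eventually_elim (intro tendsto_intros)
    show "(\<integral>\<^sup>+\<omega>. ennreal K \<partial>M) < \<infinity>" by (simp add: emeasure_space_1 ennreal_mult_less_top)
  qed (auto intro!: ennreal_leI)
  have "(\<integral>\<^sup>+\<omega>. ennreal ((J \<omega>)\<^sup>2) * indicator {\<omega>. Q \<omega> < K} \<omega> \<partial>M)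
      \<le> (\<integral>\<^sup>+\<omega>. liminf (\<lambda>k. ennreal ((?I k \<omega>)\<^sup>2)) \<partial>M)"
    using le by (rule nn_integral_mono_AE)
  also have "\<dots> \<le> liminf (\<lambda>k. \<integral>\<^sup>+\<omega>. ennreal ((?I k \<omega>)\<^sup>2) \<partial>M)" by (rule nn_integral_liminf) simp
  also have "\<dots> \<le> liminf (\<lambda>k. \<integral>\<^sup>+\<omega>. ennreal (min K (q k \<omega>)) \<partial>M)"
    by (intro Liminf_mono always_eventually) (use bound in auto)
  also have "\<dots> = (\<integral>\<^sup>+\<omega>. ennreal (min K (Q \<omega>)) \<partial>M)" by (rule lim_imp_Liminf[OF trivial_limit_sequentially lim])
  finally show ?thesis .
qed

end

lemma tendsto_zero_squeeze:
  fixes f g :: "'a \<Rightarrow> real"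
  assumes "(g \<longlongrightarrow> 0) F" "\<And>x. 0 \<le> f x" "\<And>x. f x \<le> g x"
  shows "(f \<longlongrightarrow> 0) F"
  by (rule tendsto_sandwich[OF always_eventually always_eventually tendsto_const assms(1)]) (use assms in auto)

lemma integral_square_diff_le:
  assumes "square_integrable N a" "square_integrable N b"
  shows "(\<integral>x. (a x - b x)\<^sup>2 \<partial>N) \<le> 2 * (\<integral>x. (a x)\<^sup>2 \<partial>N) + 2 * (\<integral>x. (b x)\<^sup>2 \<partial>N)"
proof -
  have "(a x - b x)\<^sup>2 \<le> 2 * (a x)\<^sup>2 + 2 * (b x)\<^sup>2" for x
    using zero_le_power2[of "a x + b x"] by (simp add: power2_sum power2_diff)
  then have "(\<integral>x. (a x - b x)\<^sup>2 \<partial>N) \<le> (\<integral>x. 2 * (a x)\<^sup>2 + 2 * (b x)\<^sup>2 \<partial>N)"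
    using assms square_integrable_diff[OF assms]
    by (intro integral_mono) (auto simp: square_integrable_def)
  also have "\<dots> = 2 * (\<integral>x. (a x)\<^sup>2 \<partial>N) + 2 * (\<integral>x. (b x)\<^sup>2 \<partial>N)"
    using assms by (simp add: square_integrable_def)
  finally show ?thesis .
qed

context ito_approximation begin

lemma square_integrable_integrand: "integrable M Q \<Longrightarrow> square_integrable P integrand"
  using integrand_section
  by (intro integrable_square_product[OF prob_space_axioms integrand_measurable])
     (auto simp: square_integrable_def Q_eq[abs_def])

lemma defect_measurable [measurable]: "defect K k \<in> borel_measurable M"
proof -
  note square_integrable_simple_prod[OF simple_cut t, THEN square_integrable_def[THEN iffD1], THEN conjunct1, measurable]
  show ?thesis unfolding defect_def[abs_def] by measurable
qed

lemma defect_nonneg: "0 \<le> defect K k \<omega>"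
  unfolding defect_def by (rule integral_nonneg_AE) simp

lemma defect_le:
  assumes "0 \<le> K"
  shows "AE \<omega> in M. \<forall>k. defect K k \<omega> \<le> 2 * K + 2 * Q \<omega>"
  using integrand_section
proof eventually_elim
  case (elim \<omega>)
  show ?case
  proof
    fix k
    note sec = simple_prod_section[OF simple_cut[of k K], of \<omega>]
    have "(\<integral>u. (simple_prod t (n k) (\<tau> k) (cut K k) (\<omega>, u))\<^sup>2 \<partial>lborel) \<le> K"
      using cutoff_sum_le[OF simple[of k] assms] sec(2) by simp
    then show "defect K k \<omega> \<le> 2 * K + 2 * Q \<omega>"
      using integral_square_diff_le[OF sec(1) elim] unfolding defect_def Q_eq by simp
  qed
qed

lemma defect_tendsto:
  "AE \<omega> in M. Q \<omega> < K \<longrightarrow> (\<lambda>k. defect K k \<omega>) \<longlonglongrightarrow> 0 \<and>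
     (\<lambda>k. simple_int (n k) (\<tau> k) (cut K k) t \<omega>) \<longlonglongrightarrow> J \<omega>"
  using q_limit H_limit J_limit
proof eventually_elim
  case (elim \<omega>)
  show ?case
  proof
    assume "Q \<omega> < K"
    then have ev: "\<forall>\<^sub>F k in sequentially. q k \<omega> < K" using elim(1) by (intro order_tendstoD(2))
    have sq: "(simple_prod t (n k) (\<tau> k) (h k) (\<omega>, u) - integrand (\<omega>, u))\<^sup>2 =
        indicator {0..t} u *\<^sub>R (simple_proc (n k) (\<tau> k) (h k) u \<omega> - H u \<omega>)\<^sup>2" for k u
      by (simp add: simple_prod_def integrand_def indicator_def)
    have "\<forall>\<^sub>F k in sequentially. (LINT u:{0..t}|lborel. (simple_proc (n k) (\<tau> k) (h k) u \<omega> - H u \<omega>)\<^sup>2) = defect K k \<omega>"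
      using ev by eventually_elim (simp add: defect_def below_cutoff sq set_lebesgue_integral_def)
    moreover have "\<forall>\<^sub>F k in sequentially. simple_int (n k) (\<tau> k) (h k) t \<omega> = simple_int (n k) (\<tau> k) (cut K k) t \<omega>"
      using ev by eventually_elim (simp add: below_cutoff)
    ultimately show "(\<lambda>k. defect K k \<omega>) \<longlonglongrightarrow> 0 \<and> (\<lambda>k. simple_int (n k) (\<tau> k) (cut K k) t \<omega>) \<longlonglongrightarrow> J \<omega>"
      by (intro conjI) (rule Lim_transform_eventually[OF elim(2)], assumption, rule Lim_transform_eventually[OF elim(3)], assumption)
  qed
qed

text \<open>For each level \<open>K\<close> an index is chosen so late that the errors on the event
  \<open>Q \<omega> < K\<close> are below \<open>1 / Suc K\<close>. On the complement the error is
  dominated by a multiple of \<open>Q\<close>, whose integral there vanishes as \<open>K\<close>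
  grows. The isometry makes the integrals a Cauchy sequence in L2, and Fatou's lemma along an almost
  surely convergent subsequence identifies the limit with \<open>J\<close>.\<close>

lemma L2_approximation:
  assumes Q: "integrable M Q"
  obtains m \<sigma> g where "\<And>K. simple_data M F (m K) (\<sigma> K) (g K)"
    "(\<lambda>K. \<integral>z. (simple_prod t (m K) (\<sigma> K) (g K) z - integrand z)\<^sup>2 \<partial>P) \<longlonglongrightarrow> 0"
    "(\<lambda>K. \<integral>\<omega>. (simple_int (m K) (\<sigma> K) (g K) t \<omega> - J \<omega>)\<^sup>2 \<partial>M) \<longlonglongrightarrow> 0"
    "square_integrable M J"
proof -
  interpret pair_sigma_finite M "lborel :: real measure" ..
  let ?I = "\<lambda>K k \<omega>. simple_int (n k) (\<tau> k) (cut K k) t \<omega>"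
  \<comment> \<open>The distance to \<open>J\<close> is capped at 1 to be integrable at a stage
    where \<open>J\<close> is only known to be measurable.\<close>
  define dist1 where "dist1 K k \<omega> = min 1 \<bar>?I K k \<omega> - J \<omega>\<bar>" for K k \<omega>
  \<comment> \<open>Both errors are summed on the event where the truncation is eventually inactive,
    so that one index serves both.\<close>
  define e where "e K k \<omega> = (defect K k \<omega> + dist1 K k \<omega>) * indicator {\<omega>. Q \<omega> < K} \<omega>" for K k \<omega>
  have Isq: "square_integrable M (?I K k)" for K k by (rule square_integrable_simple_int[OF simple_cut t])
  then have [measurable]: "?I K k \<in> borel_measurable M" for K k by (simp add: square_integrable_def)
  note J_measurable [measurable]
  have dist1_meas [measurable]: "dist1 K k \<in> borel_measurable M" for K k
    unfolding dist1_def[abs_def] by measurable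
  have dist1_bounds: "0 \<le> dist1 K k \<omega>" "dist1 K k \<omega> \<le> 1" for K k \<omega> by (auto simp: dist1_def)
  have e_meas [measurable]: "e K k \<in> borel_measurable M" for K k
    unfolding e_def[abs_def] by measurable
  have dist1_int: "integrable M (dist1 K k)" for K k
    by (rule integrable_const_bound[of _ 1]) (use dist1_bounds in auto)
  have bound_int: "integrable M (\<lambda>\<omega>. 2 * K + 2 * Q \<omega> + 1)" for K using Q by simp
  have e_le: "AE \<omega> in M. norm (e K k \<omega>) \<le> 2 * K + 2 * Q \<omega> + 1" if "0 \<le> K" for K k
    using defect_le[OF that]
  proof eventually_elim
    case (elim \<omega>)
    then have "defect K k \<omega> \<le> 2 * K + 2 * Q \<omega>" by blast
    then show ?case
      using dist1_bounds[of K k \<omega>] defect_nonneg[of K k \<omega>] that Q_nonneg[of \<omega>]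
      by (auto simp: e_def indicator_def)
  qed
  have e_int: "integrable M (e K k)" if "0 \<le> K" for K k
  proof (rule Bochner_Integration.integrable_bound[OF bound_int[of K] e_meas])
    show "AE \<omega> in M. norm (e K k \<omega>) \<le> norm (2 * K + 2 * Q \<omega> + 1)"
      using e_le[OF that, of k] by eventually_elim (auto intro: order_trans[OF _ abs_ge_self])
  qed
  have "(\<lambda>k. \<integral>\<omega>. e K k \<omega> \<partial>M) \<longlonglongrightarrow> (\<integral>\<omega>. 0 \<partial>M)" if "0 \<le> K" for K
  proof (rule integral_dominated_convergence[where w="\<lambda>\<omega>. 2 * K + 2 * Q \<omega> + 1"])
    show "AE \<omega> in M. (\<lambda>k. e K k \<omega>) \<longlonglongrightarrow> 0"
      using defect_tendsto[of K]
    proof eventually_elim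
      case (elim \<omega>)
      show ?case
      proof (cases "Q \<omega> < K")
        case True
        then have 1: "(\<lambda>k. defect K k \<omega>) \<longlonglongrightarrow> 0" and 2: "(\<lambda>k. ?I K k \<omega>) \<longlonglongrightarrow> J \<omega>" using elim by auto
        have "(\<lambda>k. dist1 K k \<omega>) \<longlonglongrightarrow> min 1 \<bar>J \<omega> - J \<omega>\<bar>" unfolding dist1_def by (intro tendsto_intros 2)
        then have "(\<lambda>k. defect K k \<omega> + dist1 K k \<omega>) \<longlonglongrightarrow> 0 + 0" by (intro tendsto_add 1) simp
        then show ?thesis using True by (simp add: e_def)
      qed (simp add: e_def)
    qed
  qed (use e_le[OF that] bound_int[of K] in auto)
  then have "\<exists>k. (\<integral>\<omega>. e (real K) k \<omega> \<partial>M) < 1 / Suc K" for K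
    using order_tendstoD(2)[of "\<lambda>k. \<integral>\<omega>. e (real K) k \<omega> \<partial>M" 0 sequentially "1 / Suc K"]
    by (force dest: eventually_happens)
  then obtain \<kappa> where \<kappa>: "\<And>K. (\<integral>\<omega>. e (real K) (\<kappa> K) \<omega> \<partial>M) < 1 / Suc K" by metis
  define \<epsilon> where "\<epsilon> K = (\<integral>\<omega>. defect (real K) (\<kappa> K) \<omega> \<partial>M)" for K
  have tail: "(\<lambda>K. \<integral>\<omega>. f \<omega> * indicator {\<omega>. real K \<le> Q \<omega>} \<omega> \<partial>M) \<longlonglongrightarrow> 0"
    if f: "integrable M f" for f :: "'a \<Rightarrow> real"
  proof -
    have "(\<lambda>K. \<integral>\<omega>. f \<omega> * indicator {\<omega>. real K \<le> Q \<omega>} \<omega> \<partial>M) \<longlonglongrightarrow> (\<integral>\<omega>. 0 \<partial>M)"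
    proof (rule integral_dominated_convergence[where w="\<lambda>\<omega>. norm (f \<omega>)"])
      show "AE \<omega> in M. (\<lambda>K. f \<omega> * indicator {\<omega>. real K \<le> Q \<omega>} \<omega>) \<longlonglongrightarrow> 0"
      proof (rule AE_I2)
        fix \<omega>
        obtain N where "Q \<omega> < real N" using reals_Archimedean2 by blast
        then have "\<forall>\<^sub>F K in sequentially. f \<omega> * indicator {\<omega>. real K \<le> Q \<omega>} \<omega> = 0"
          by (intro eventually_sequentiallyI[of N]) (auto simp: indicator_def)
        then show "(\<lambda>K. f \<omega> * indicator {\<omega>. real K \<le> Q \<omega>} \<omega>) \<longlonglongrightarrow> 0" by (rule tendsto_eventually)
      qed
      have [measurable]: "f \<in> borel_measurable M" using f by simp
      show "(\<lambda>\<omega>. f \<omega> * indicator {\<omega>. real K \<le> Q \<omega>} \<omega>) \<in> borel_measurable M" for K by measurable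
    qed (use f in \<open>auto simp: indicator_def\<close>)
    then show ?thesis by simp
  qed
  have inv: "(\<lambda>K. 1 / real (Suc K)) \<longlonglongrightarrow> 0" using LIMSEQ_inverse_real_of_nat by (simp add: inverse_eq_divide)
  have defect_int: "integrable M (defect K k)" if "0 \<le> K" for K k
  proof (rule Bochner_Integration.integrable_bound[of _ "\<lambda>\<omega>. 2 * K + 2 * Q \<omega>"])
    show "AE \<omega> in M. norm (defect K k \<omega>) \<le> norm (2 * K + 2 * Q \<omega>)"
      using defect_le[OF that]
      by eventually_elim (auto simp: defect_nonneg intro: order_trans[OF _ abs_ge_self])
  qed (use Q in auto)
  have tail_int: "integrable M (\<lambda>\<omega>. f \<omega> * indicator {\<omega>. real K \<le> Q \<omega>} \<omega>)" if "integrable M f" for f :: "'a \<Rightarrow> real" and K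
  proof (rule Bochner_Integration.integrable_bound[OF that])
    have [measurable]: "f \<in> borel_measurable M" using that by simp
    show "(\<lambda>\<omega>. f \<omega> * indicator {\<omega>. real K \<le> Q \<omega>} \<omega>) \<in> borel_measurable M" by measurable
  qed (auto simp: indicator_def)
  have \<epsilon>_le: "\<epsilon> K \<le> 1 / real (Suc K) + (\<integral>\<omega>. 4 * Q \<omega> * indicator {\<omega>. real K \<le> Q \<omega>} \<omega> \<partial>M)" for K
  proof -
    \<comment> \<open>Off the event one has \<open>K \<le> Q \<omega>\<close>, which turns the bound
      \<open>2 * K + 2 * Q \<omega>\<close> of \<open>defect_le\<close> into
      \<open>4 * Q \<omega>\<close>.\<close>
    have "\<epsilon> K \<le> (\<integral>\<omega>. e (real K) (\<kappa> K) \<omega> + 4 * Q \<omega> * indicator {\<omega>. real K \<le> Q \<omega>} \<omega> \<partial>M)"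
      unfolding \<epsilon>_def
    proof (rule integral_mono_AE)
      show "AE \<omega> in M. defect (real K) (\<kappa> K) \<omega> \<le> e (real K) (\<kappa> K) \<omega> + 4 * Q \<omega> * indicator {\<omega>. real K \<le> Q \<omega>} \<omega>"
        using defect_le[of "real K", OF of_nat_0_le_iff]
      proof eventually_elim
        case (elim \<omega>)
        then have "defect (real K) (\<kappa> K) \<omega> \<le> 2 * real K + 2 * Q \<omega>" by blast
        then show ?case using dist1_bounds[of "real K" "\<kappa> K" \<omega>]
          by (auto simp: e_def indicator_def)
      qed
    qed (use e_int defect_int tail_int[of "\<lambda>\<omega>. 4 * Q \<omega>" K] Q in auto)
    also have "\<dots> = (\<integral>\<omega>. e (real K) (\<kappa> K) \<omega> \<partial>M) + (\<integral>\<omega>. 4 * Q \<omega> * indicator {\<omega>. real K \<le> Q \<omega>} \<omega> \<partial>M)"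
      using e_int tail_int[of "\<lambda>\<omega>. 4 * Q \<omega>" K] Q by simp
    finally show ?thesis using \<kappa>[of K] by simp
  qed
  have \<epsilon>_nonneg: "0 \<le> \<epsilon> K" for K unfolding \<epsilon>_def by (rule integral_nonneg_AE) (simp add: defect_nonneg)
  have "(\<lambda>K. 1 / real (Suc K) + (\<integral>\<omega>. 4 * Q \<omega> * indicator {\<omega>. real K \<le> Q \<omega>} \<omega> \<partial>M)) \<longlonglongrightarrow> 0 + 0"
    by (intro tendsto_add inv tail) (use Q in auto)
  then have \<epsilon>_lim: "\<epsilon> \<longlonglongrightarrow> 0"
    by (intro tendsto_zero_squeeze[OF _ \<epsilon>_nonneg \<epsilon>_le]) simp
  have dist1_le: "(\<integral>\<omega>. norm (dist1 (real K) (\<kappa> K) \<omega>) \<partial>M) \<le> 1 / real (Suc K) + (\<integral>\<omega>. 1 * indicator {\<omega>. real K \<le> Q \<omega>} \<omega> \<partial>M)" for K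
  proof -
    have "(\<integral>\<omega>. norm (dist1 (real K) (\<kappa> K) \<omega>) \<partial>M) \<le> (\<integral>\<omega>. e (real K) (\<kappa> K) \<omega> + 1 * indicator {\<omega>. real K \<le> Q \<omega>} \<omega> \<partial>M)"
    proof (rule integral_mono)
      show "norm (dist1 (real K) (\<kappa> K) \<omega>) \<le> e (real K) (\<kappa> K) \<omega> + 1 * indicator {\<omega>. real K \<le> Q \<omega>} \<omega>" for \<omega>
        using dist1_bounds[of "real K" "\<kappa> K" \<omega>] defect_nonneg[of "real K" "\<kappa> K" \<omega>]
        by (auto simp: e_def indicator_def)
    qed (use e_int dist1_int tail_int[of "\<lambda>\<omega>. 1" K] in auto)
    also have "\<dots> = (\<integral>\<omega>. e (real K) (\<kappa> K) \<omega> \<partial>M) + (\<integral>\<omega>. 1 * indicator {\<omega>. real K \<le> Q \<omega>} \<omega> \<partial>M)"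
      using e_int tail_int[of "\<lambda>\<omega>. 1" K] by simp
    finally show ?thesis using \<kappa>[of K] by simp
  qed
  have "(\<lambda>K. 1 / real (Suc K) + (\<integral>\<omega>. 1 * indicator {\<omega>. real K \<le> Q \<omega>} \<omega> \<partial>M)) \<longlonglongrightarrow> 0 + 0"
    by (intro tendsto_add inv tail) auto
  then have "(\<lambda>K. \<integral>\<omega>. norm (dist1 (real K) (\<kappa> K) \<omega>) \<partial>M) \<longlonglongrightarrow> 0"
    by (intro tendsto_zero_squeeze[OF _ _ dist1_le]) (auto intro: integral_nonneg_AE)
  then obtain r :: "nat \<Rightarrow> nat" where r: "strict_mono r" "AE \<omega> in M. (\<lambda>j. dist1 (real (r j)) (\<kappa> (r j)) \<omega>) \<longlonglongrightarrow> 0"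
    using tendsto_L1_AE_subseq[of M "\<lambda>K. dist1 (real K) (\<kappa> K)", OF dist1_int] by auto
  define G where "G K = simple_int (n (\<kappa> K)) (\<tau> (\<kappa> K)) (cut (real K) (\<kappa> K)) t" for K
  define S where "S K = simple_prod t (n (\<kappa> K)) (\<tau> (\<kappa> K)) (cut (real K) (\<kappa> K))" for K
  have Gsq: "square_integrable M (G K)" for K unfolding G_def by (rule Isq)
  then have [measurable]: "G K \<in> borel_measurable M" for K by (simp add: square_integrable_def)
  have Ssq: "square_integrable P (S K)" for K unfolding S_def by (rule square_integrable_simple_prod[OF simple_cut t])
  note Hsq = square_integrable_integrand[OF Q]
  have \<epsilon>_eq: "(\<integral>z. (S K z - integrand z)\<^sup>2 \<partial>P) = \<epsilon> K" for K
  proof -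
    have "integrable P (\<lambda>z. (S K z - integrand z)\<^sup>2)"
      using square_integrable_diff[OF Ssq Hsq] by (simp add: square_integrable_def)
    then have "(\<integral>z. (S K z - integrand z)\<^sup>2 \<partial>P) = (\<integral>\<omega>. (\<integral>u. (S K (\<omega>, u) - integrand (\<omega>, u))\<^sup>2 \<partial>lborel) \<partial>M)"
      by (rule integral_fst'[symmetric])
    then show ?thesis by (simp add: \<epsilon>_def defect_def S_def)
  qed
  have G_lim: "AE \<omega> in M. (\<lambda>j. G (r j) \<omega>) \<longlonglongrightarrow> J \<omega>"
    using r(2)
  proof eventually_elim
    case (elim \<omega>)
    have "\<forall>\<^sub>F j in sequentially. dist1 (real (r j)) (\<kappa> (r j)) \<omega> < 1" using elim by (rule order_tendstoD(2)) simp
    then have "\<forall>\<^sub>F j in sequentially. dist1 (real (r j)) (\<kappa> (r j)) \<omega> = \<bar>G (r j) \<omega> - J \<omega>\<bar>"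
      by eventually_elim (auto simp: dist1_def G_def)
    from Lim_transform_eventually[OF elim this] show ?case
      by (subst LIM_zero_iff[symmetric]) (simp add: tendsto_rabs_zero_iff)
  qed
  \<comment> \<open>Isometry for the difference, then the triangle inequality through the
    integrand.\<close>
  have cauchy: "(\<integral>\<omega>. (G K \<omega> - G K' \<omega>)\<^sup>2 \<partial>M) \<le> 2 * \<epsilon> K + 2 * \<epsilon> K'" for K K'
  proof -
    have "(\<integral>\<omega>. (G K \<omega> - G K' \<omega>)\<^sup>2 \<partial>M) = (\<integral>z. (S K z - S K' z)\<^sup>2 \<partial>P)"
      unfolding G_def S_def by (rule simple_isometry_diff[OF simple_cut simple_cut t])
    also have "\<dots> = (\<integral>z. ((S K z - integrand z) - (S K' z - integrand z))\<^sup>2 \<partial>P)" by simp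
    also have "\<dots> \<le> 2 * \<epsilon> K + 2 * \<epsilon> K'"
      unfolding \<epsilon>_eq[symmetric] by (intro integral_square_diff_le square_integrable_diff Ssq Hsq)
    finally show ?thesis .
  qed
  \<comment> \<open>\<open>J\<close> is replaced by the almost sure limit of \<open>G (r j)\<close>;
    the bound from \<open>cauchy\<close> keeps only \<open>2 * \<epsilon> K\<close> in the limit.
    This yields both the square integrability of \<open>G K - J\<close> and the convergence.\<close>
  have fatou: "(\<integral>\<^sup>+\<omega>. ennreal ((G K \<omega> - J \<omega>)\<^sup>2) \<partial>M) \<le> ennreal (2 * \<epsilon> K)" for K
  proof -
    have "(\<integral>\<^sup>+\<omega>. ennreal ((G K \<omega> - J \<omega>)\<^sup>2) \<partial>M) = (\<integral>\<^sup>+\<omega>. liminf (\<lambda>j. ennreal ((G K \<omega> - G (r j) \<omega>)\<^sup>2)) \<partial>M)"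
    proof (rule nn_integral_cong_AE)
      show "AE \<omega> in M. ennreal ((G K \<omega> - J \<omega>)\<^sup>2) = liminf (\<lambda>j. ennreal ((G K \<omega> - G (r j) \<omega>)\<^sup>2))"
        using G_lim
      proof eventually_elim
        case (elim \<omega>)
        then have "(\<lambda>j. ennreal ((G K \<omega> - G (r j) \<omega>)\<^sup>2)) \<longlonglongrightarrow> ennreal ((G K \<omega> - J \<omega>)\<^sup>2)"
          by (intro tendsto_intros)
        from lim_imp_Liminf[OF trivial_limit_sequentially this] show ?case by simp
      qed
    qed
    also have "\<dots> \<le> liminf (\<lambda>j. \<integral>\<^sup>+\<omega>. ennreal ((G K \<omega> - G (r j) \<omega>)\<^sup>2) \<partial>M)"
      by (rule nn_integral_liminf) simp
    also have "\<dots> \<le> liminf (\<lambda>j. ennreal (2 * \<epsilon> K + 2 * \<epsilon> (r j)))"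
    proof (intro Liminf_mono always_eventually allI)
      fix j
      have "(\<integral>\<^sup>+\<omega>. ennreal ((G K \<omega> - G (r j) \<omega>)\<^sup>2) \<partial>M) = ennreal (\<integral>\<omega>. (G K \<omega> - G (r j) \<omega>)\<^sup>2 \<partial>M)"
        using square_integrable_diff[OF Gsq Gsq] by (intro nn_integral_eq_integral) (auto simp: square_integrable_def)
      then show "(\<integral>\<^sup>+\<omega>. ennreal ((G K \<omega> - G (r j) \<omega>)\<^sup>2) \<partial>M) \<le> ennreal (2 * \<epsilon> K + 2 * \<epsilon> (r j))"
        using cauchy by (simp add: ennreal_leI)
    qed
    also have "\<dots> = ennreal (2 * \<epsilon> K)"
    proof -
      have "(\<lambda>j. ennreal (2 * \<epsilon> K + 2 * \<epsilon> (r j))) \<longlonglongrightarrow> ennreal (2 * \<epsilon> K + 2 * 0)"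
        by (intro tendsto_intros LIMSEQ_subseq_LIMSEQ[OF \<epsilon>_lim r(1), unfolded o_def])
      from lim_imp_Liminf[OF trivial_limit_sequentially this] show ?thesis by simp
    qed
    finally show ?thesis .
  qed
  have GJsq: "square_integrable M (\<lambda>\<omega>. G K \<omega> - J \<omega>)" for K
  proof -
    have "integrable M (\<lambda>\<omega>. (G K \<omega> - J \<omega>)\<^sup>2)"
      using le_less_trans[OF fatou[of K] ennreal_less_top]
      by (intro integrableI_nonneg) auto
    then show ?thesis by (simp add: square_integrable_def)
  qed
  have GJ_le: "(\<integral>\<omega>. (G K \<omega> - J \<omega>)\<^sup>2 \<partial>M) \<le> 2 * \<epsilon> K" for K
  proof -
    have "ennreal (\<integral>\<omega>. (G K \<omega> - J \<omega>)\<^sup>2 \<partial>M) \<le> ennreal (2 * \<epsilon> K)"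
      using fatou[of K] GJsq[of K] by (subst nn_integral_eq_integral[symmetric]) (auto simp: square_integrable_def)
    then show ?thesis using \<epsilon>_nonneg[of K] by (subst (asm) ennreal_le_iff) auto
  qed
  show ?thesis
  proof (rule that)
    show "simple_data M F (n (\<kappa> K)) (\<tau> (\<kappa> K)) (cut (real K) (\<kappa> K))" for K by (rule simple_cut)
    show "(\<lambda>K. \<integral>z. (simple_prod t (n (\<kappa> K)) (\<tau> (\<kappa> K)) (cut (real K) (\<kappa> K)) z - integrand z)\<^sup>2 \<partial>P) \<longlonglongrightarrow> 0"
      using \<epsilon>_lim \<epsilon>_eq by (simp add: S_def)
    have "(\<lambda>K. 2 * \<epsilon> K) \<longlonglongrightarrow> 2 * 0" by (intro tendsto_intros \<epsilon>_lim)
    then show "(\<lambda>K. \<integral>\<omega>. (simple_int (n (\<kappa> K)) (\<tau> (\<kappa> K)) (cut (real K) (\<kappa> K)) t \<omega> - J \<omega>)\<^sup>2 \<partial>M) \<longlonglongrightarrow> 0"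
      unfolding G_def[symmetric]
      by (intro tendsto_zero_squeeze[OF _ _ GJ_le]) (auto intro: integral_nonneg_AE)
    show "square_integrable M J"
      using square_integrable_diff[OF Gsq[of 0] GJsq[of 0]] by simp
  qed
qed

end

lemma integral_square_triangle:
  assumes "square_integrable N a" "square_integrable N b" "square_integrable N c"
  shows "(\<integral>x. (a x - c x)\<^sup>2 \<partial>N) \<le> 2 * (\<integral>x. (a x - b x)\<^sup>2 \<partial>N) + 2 * (\<integral>x. (c x - b x)\<^sup>2 \<partial>N)"
proof -
  have "(\<integral>x. (a x - c x)\<^sup>2 \<partial>N) = (\<integral>x. ((a x - b x) - (c x - b x))\<^sup>2 \<partial>N)" by simp
  also have "\<dots> \<le> 2 * (\<integral>x. (a x - b x)\<^sup>2 \<partial>N) + 2 * (\<integral>x. (c x - b x)\<^sup>2 \<partial>N)"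
    by (intro integral_square_diff_le square_integrable_diff assms)
  finally show ?thesis .
qed

section \<open>Covariance and martingale property of the Ito integral\<close>

context unit_rate_martingale begin

context
  fixes H s t Js Jt n \<tau> h n' \<tau>' h'
  assumes A: "ito_approximation M F \<beta> H s Js n \<tau> h" and B: "ito_approximation M F \<beta> H t Jt n' \<tau>' h'"
    and st: "s \<le> t" and Qt: "integrable M (\<lambda>\<omega>. LINT u:{0..t}|lborel. (H u \<omega>)\<^sup>2)"
begin

interpretation A: ito_approximation M F \<beta> H s Js n \<tau> h by (fact A)
interpretation B: ito_approximation M F \<beta> H t Jt n' \<tau>' h' by (fact B)
interpretation pair_sigma_finite M "lborel :: real measure" ..

lemma restrict_integrand: "A.integrand z = indicator {0..s} (snd z) * B.integrand z"
  using st by (auto simp: A.integrand_def B.integrand_def indicator_def)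

lemma integrable_QB: "integrable M B.Q"
  using Qt by (simp add: B.Q_def[abs_def])

lemma integrable_QA: "integrable M A.Q"
proof (rule Bochner_Integration.integrable_bound[OF integrable_QB A.Q_measurable])
  show "AE \<omega> in M. norm (A.Q \<omega>) \<le> norm (B.Q \<omega>)"
    using A.integrand_section B.integrand_section
  proof eventually_elim
    case (elim \<omega>)
    have "A.Q \<omega> \<le> B.Q \<omega>" unfolding A.Q_eq B.Q_eq
      using elim by (intro integral_mono) (auto simp: square_integrable_def restrict_integrand indicator_def)
    then show ?case using A.Q_nonneg B.Q_nonneg by simp
  qed
qed

lemma ito_square_integrable: "square_integrable M Js" "square_integrable M Jt"
  using A.L2_approximation[OF integrable_QA] B.L2_approximation[OF integrable_QB] by blast+

text \<open>Both sides of \<open>simple_isometry_product\<close> are L2 pairings, hence continuous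
  along the approximations. The integrand up to \<open>s\<close> is the one up to \<open>t\<close>
  cut off at \<open>s\<close>, so their product is the square up to \<open>s\<close>; the noise
  after \<open>s\<close> does not contribute.\<close>

lemma ito_covariance: "(\<integral>\<omega>. Js \<omega> * Jt \<omega> \<partial>M) = (\<integral>\<omega>. (LINT u:{0..s}|lborel. (H u \<omega>)\<^sup>2) \<partial>M)"
proof -
  obtain m \<sigma> g where a: "\<And>K. simple_data M F (m K) (\<sigma> K) (g K)"
    "(\<lambda>K. \<integral>z. (simple_prod s (m K) (\<sigma> K) (g K) z - A.integrand z)\<^sup>2 \<partial>A.P) \<longlonglongrightarrow> 0"
    "(\<lambda>K. \<integral>\<omega>. (simple_int (m K) (\<sigma> K) (g K) s \<omega> - Js \<omega>)\<^sup>2 \<partial>M) \<longlonglongrightarrow> 0" "square_integrable M Js"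
    using A.L2_approximation[OF integrable_QA] by blast
  obtain m' \<sigma>' g' where b: "\<And>K. simple_data M F (m' K) (\<sigma>' K) (g' K)"
    "(\<lambda>K. \<integral>z. (simple_prod t (m' K) (\<sigma>' K) (g' K) z - B.integrand z)\<^sup>2 \<partial>A.P) \<longlonglongrightarrow> 0"
    "(\<lambda>K. \<integral>\<omega>. (simple_int (m' K) (\<sigma>' K) (g' K) t \<omega> - Jt \<omega>)\<^sup>2 \<partial>M) \<longlonglongrightarrow> 0" "square_integrable M Jt"
    using B.L2_approximation[OF integrable_QB] by blast
  note sA = A.square_integrable_integrand[OF integrable_QA] and sB = B.square_integrable_integrand[OF integrable_QB]
  have "(\<lambda>K. \<integral>\<omega>. simple_int (m K) (\<sigma> K) (g K) s \<omega> * simple_int (m' K) (\<sigma>' K) (g' K) t \<omega> \<partial>M) \<longlonglongrightarrow> (\<integral>\<omega>. Js \<omega> * Jt \<omega> \<partial>M)"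
    using a b by (intro tendsto_integral_mult square_integrable_simple_int A.t B.t)
  moreover have "(\<lambda>K. \<integral>z. simple_prod s (m K) (\<sigma> K) (g K) z * simple_prod t (m' K) (\<sigma>' K) (g' K) z \<partial>A.P)
      \<longlonglongrightarrow> (\<integral>z. A.integrand z * B.integrand z \<partial>A.P)"
    using a b sA sB by (intro tendsto_integral_mult square_integrable_simple_prod A.t B.t)
  ultimately have "(\<integral>\<omega>. Js \<omega> * Jt \<omega> \<partial>M) = (\<integral>z. A.integrand z * B.integrand z \<partial>A.P)"
    unfolding simple_isometry_product[OF a(1) b(1) A.t B.t] by (rule LIMSEQ_unique)
  also have "\<dots> = (\<integral>\<omega>. (\<integral>u. A.integrand (\<omega>, u) * B.integrand (\<omega>, u) \<partial>lborel) \<partial>M)"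
    by (rule integral_fst'[symmetric]) (rule square_integrable_mult[OF sA sB])
  also have "\<dots> = (\<integral>\<omega>. A.Q \<omega> \<partial>M)"
    unfolding A.Q_eq
    by (intro Bochner_Integration.integral_cong refl) (auto simp: restrict_integrand indicator_def power2_eq_square)
  finally show ?thesis by (simp add: A.Q_def)
qed

text \<open>The martingale property is clear for the integrals of one simple process at the times
  \<open>s\<close> and \<open>t\<close>, but the definition provides unrelated approximating
  sequences at the two times. The point is that the sequence for \<open>t\<close>, integrated up to
  \<open>s\<close>, also converges to \<open>Js\<close>.\<close>

lemma ito_martingale:
  assumes Z: "Z \<in> borel_measurable (F s)" "square_integrable M Z"
  shows "(\<integral>\<omega>. Z \<omega> * (Jt \<omega> - Js \<omega>) \<partial>M) = 0"
proof -
  obtain m \<sigma> g where a: "\<And>K. simple_data M F (m K) (\<sigma> K) (g K)"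
    "(\<lambda>K. \<integral>z. (simple_prod s (m K) (\<sigma> K) (g K) z - A.integrand z)\<^sup>2 \<partial>A.P) \<longlonglongrightarrow> 0"
    "(\<lambda>K. \<integral>\<omega>. (simple_int (m K) (\<sigma> K) (g K) s \<omega> - Js \<omega>)\<^sup>2 \<partial>M) \<longlonglongrightarrow> 0" "square_integrable M Js"
    using A.L2_approximation[OF integrable_QA] by blast
  obtain m' \<sigma>' g' where b: "\<And>K. simple_data M F (m' K) (\<sigma>' K) (g' K)"
    "(\<lambda>K. \<integral>z. (simple_prod t (m' K) (\<sigma>' K) (g' K) z - B.integrand z)\<^sup>2 \<partial>A.P) \<longlonglongrightarrow> 0"
    "(\<lambda>K. \<integral>\<omega>. (simple_int (m' K) (\<sigma>' K) (g' K) t \<omega> - Jt \<omega>)\<^sup>2 \<partial>M) \<longlonglongrightarrow> 0" "square_integrable M Jt"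
    using B.L2_approximation[OF integrable_QB] by blast
  note sA = A.square_integrable_integrand[OF integrable_QA] and sB = B.square_integrable_integrand[OF integrable_QB]
  note int_s = square_integrable_simple_int[OF _ A.t] and int_t = square_integrable_simple_int[OF _ B.t]
  note prod_s = square_integrable_simple_prod[OF _ A.t] and prod_t = square_integrable_simple_prod[OF _ B.t]
  \<comment> \<open>Restriction to \<open>[0, s]\<close> can only decrease the squared
    error.\<close>
  have "(\<integral>z. (simple_prod s (m' K) (\<sigma>' K) (g' K) z - A.integrand z)\<^sup>2 \<partial>A.P)
      \<le> (\<integral>z. (simple_prod t (m' K) (\<sigma>' K) (g' K) z - B.integrand z)\<^sup>2 \<partial>A.P)" for K
  proof (rule integral_mono)
    have "simple_prod s (m' K) (\<sigma>' K) (g' K) z = indicator {0..s} (snd z) * simple_prod t (m' K) (\<sigma>' K) (g' K) z" for z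
      using st by (auto simp: simple_prod_def indicator_def)
    then show "(simple_prod s (m' K) (\<sigma>' K) (g' K) z - A.integrand z)\<^sup>2
        \<le> (simple_prod t (m' K) (\<sigma>' K) (g' K) z - B.integrand z)\<^sup>2" for z
      by (auto simp: restrict_integrand indicator_def)
  qed (use square_integrable_diff[OF prod_s[OF b(1)[of K]] sA] square_integrable_diff[OF prod_t[OF b(1)[of K]] sB]
    in \<open>auto simp: square_integrable_def\<close>)
  then have bs: "(\<lambda>K. \<integral>z. (simple_prod s (m' K) (\<sigma>' K) (g' K) z - A.integrand z)\<^sup>2 \<partial>A.P) \<longlonglongrightarrow> 0"
    by (intro tendsto_zero_squeeze[OF b(2)]) (auto intro: integral_nonneg_AE)
  \<comment> \<open>Both sequences approximate the same integrand on \<open>[0, s]\<close>, so by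
    the isometry their integrals up to \<open>s\<close> approach each other, and one of them tends
    to \<open>Js\<close>.\<close>
  have le: "(\<integral>\<omega>. (simple_int (m' K) (\<sigma>' K) (g' K) s \<omega> - Js \<omega>)\<^sup>2 \<partial>M)
      \<le> 2 * (2 * (\<integral>z. (simple_prod s (m' K) (\<sigma>' K) (g' K) z - A.integrand z)\<^sup>2 \<partial>A.P)
          + 2 * (\<integral>z. (simple_prod s (m K) (\<sigma> K) (g K) z - A.integrand z)\<^sup>2 \<partial>A.P))
        + 2 * (\<integral>\<omega>. (simple_int (m K) (\<sigma> K) (g K) s \<omega> - Js \<omega>)\<^sup>2 \<partial>M)" for K
  proof -
    have "(\<integral>\<omega>. (simple_int (m' K) (\<sigma>' K) (g' K) s \<omega> - Js \<omega>)\<^sup>2 \<partial>M)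
        \<le> 2 * (\<integral>\<omega>. (simple_int (m' K) (\<sigma>' K) (g' K) s \<omega> - simple_int (m K) (\<sigma> K) (g K) s \<omega>)\<^sup>2 \<partial>M)
         + 2 * (\<integral>\<omega>. (Js \<omega> - simple_int (m K) (\<sigma> K) (g K) s \<omega>)\<^sup>2 \<partial>M)"
      by (intro integral_square_triangle int_s a b)
    also have "(\<integral>\<omega>. (simple_int (m' K) (\<sigma>' K) (g' K) s \<omega> - simple_int (m K) (\<sigma> K) (g K) s \<omega>)\<^sup>2 \<partial>M)
        = (\<integral>z. (simple_prod s (m' K) (\<sigma>' K) (g' K) z - simple_prod s (m K) (\<sigma> K) (g K) z)\<^sup>2 \<partial>A.P)"
      by (rule simple_isometry_diff[OF b(1) a(1) A.t])
    also have "\<dots> \<le> 2 * (\<integral>z. (simple_prod s (m' K) (\<sigma>' K) (g' K) z - A.integrand z)\<^sup>2 \<partial>A.P)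
          + 2 * (\<integral>z. (simple_prod s (m K) (\<sigma> K) (g K) z - A.integrand z)\<^sup>2 \<partial>A.P)"
      by (intro integral_square_triangle prod_s a b sA)
    finally show ?thesis by (simp add: power2_commute[of "Js _"])
  qed
  have lim: "(\<lambda>K. 2 * (2 * (\<integral>z. (simple_prod s (m' K) (\<sigma>' K) (g' K) z - A.integrand z)\<^sup>2 \<partial>A.P)
          + 2 * (\<integral>z. (simple_prod s (m K) (\<sigma> K) (g K) z - A.integrand z)\<^sup>2 \<partial>A.P))
        + 2 * (\<integral>\<omega>. (simple_int (m K) (\<sigma> K) (g K) s \<omega> - Js \<omega>)\<^sup>2 \<partial>M)) \<longlonglongrightarrow> 2 * (2 * 0 + 2 * 0) + 2 * 0"
    by (intro tendsto_intros bs a)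
  have sconv: "(\<lambda>K. \<integral>\<omega>. (simple_int (m' K) (\<sigma>' K) (g' K) s \<omega> - Js \<omega>)\<^sup>2 \<partial>M) \<longlonglongrightarrow> 0"
    by (rule tendsto_zero_squeeze[OF _ _ le]) (use lim in \<open>auto intro: integral_nonneg_AE\<close>)
  have const: "(\<lambda>K::nat. \<integral>\<omega>. (Z \<omega> - Z \<omega>)\<^sup>2 \<partial>M) \<longlonglongrightarrow> 0" by simp
  have "(\<lambda>K. \<integral>\<omega>. Z \<omega> * simple_int (m' K) (\<sigma>' K) (g' K) s \<omega> \<partial>M) \<longlonglongrightarrow> (\<integral>\<omega>. Z \<omega> * Js \<omega> \<partial>M)"
    by (rule tendsto_integral_mult[OF Z(2) Z(2) const int_s[OF b(1)] a(4) sconv])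
  moreover have "(\<lambda>K. \<integral>\<omega>. Z \<omega> * simple_int (m' K) (\<sigma>' K) (g' K) t \<omega> \<partial>M) \<longlonglongrightarrow> (\<integral>\<omega>. Z \<omega> * Jt \<omega> \<partial>M)"
    by (rule tendsto_integral_mult[OF Z(2) Z(2) const int_t[OF b(1)] b(4) b(3)])
  moreover have "(\<integral>\<omega>. Z \<omega> * simple_int (m' K) (\<sigma>' K) (g' K) t \<omega> \<partial>M) = (\<integral>\<omega>. Z \<omega> * simple_int (m' K) (\<sigma>' K) (g' K) s \<omega> \<partial>M)" for K
    using simple_int_martingale[OF b(1) A.t st Z, of K]
      square_integrable_mult[OF Z(2) int_t[OF b(1)[of K]]] square_integrable_mult[OF Z(2) int_s[OF b(1)[of K]]]
    by (simp add: has_bochner_integral_iff right_diff_distrib)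
  ultimately have "(\<integral>\<omega>. Z \<omega> * Jt \<omega> \<partial>M) = (\<integral>\<omega>. Z \<omega> * Js \<omega> \<partial>M)"
    by (simp only:) (rule LIMSEQ_unique)
  then show ?thesis
    using square_integrable_mult[OF Z(2) a(4)] square_integrable_mult[OF Z(2) b(4)]
    by (simp add: right_diff_distrib)
qed

end

end

section \<open>Scalar integrands against a vector-valued Brownian motion\<close>

locale ito_process =
  fixes M :: "'w measure" and F :: "real \<Rightarrow> 'w measure" and B :: "real \<Rightarrow> 'w \<Rightarrow> real^'d"
    and H :: "real \<Rightarrow> 'w \<Rightarrow> real" and J :: "real \<Rightarrow> 'w \<Rightarrow> real^'d"
  assumes filtered: "filtered_prob_space M F" and brownian: "brownian_motion M F B"
    and ito: "ito_integral_process M F B H J"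
begin

sublocale prob_space M using filtered by (simp add: filtered_prob_space_def)

definition energy :: "real \<Rightarrow> 'w \<Rightarrow> real" where
  "energy t \<omega> = (LINT u:{0..t}|lborel. (H u \<omega>)\<^sup>2)"

lemma J_measurable: "0 \<le> t \<Longrightarrow> J t \<in> borel_measurable M"
  using ito by (auto simp: ito_integral_process_def has_ito_integral_def)

lemma component_approximation:
  assumes "0 \<le> t"
  shows "\<exists>n \<tau> h. ito_approximation M F (\<lambda>t \<omega>. B t \<omega> $ k) H t (\<lambda>\<omega>. J t \<omega> $ k) n \<tau> h"
proof -
  interpret U: unit_rate_martingale M F "\<lambda>t \<omega>. B t \<omega> $ k"
    by (rule brownian_motion_component[OF filtered brownian])
  have it: "has_ito_integral M F B H t (J t)" using ito assms by (simp add: ito_integral_process_def)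
  have ad: "adapted F B" using brownian by (simp add: brownian_motion_def)
  obtain n \<tau> h where a: "\<And>k. simple_data M F (n k) (\<tau> k) (h k)"
    "AE \<omega> in M. (\<lambda>k. LINT u:{0..t}|lborel. (simple_proc (n k) (\<tau> k) (h k) u \<omega> - H u \<omega>)\<^sup>2) \<longlonglongrightarrow> 0"
    "AE \<omega> in M. (\<lambda>k. simple_ito B (n k) (\<tau> k) (h k) t \<omega>) \<longlonglongrightarrow> J t \<omega>"
    using has_ito_integral_AE_approximation[OF filtered ad it assms] by blast
  have comp: "U.simple_int m \<sigma> g t \<omega> = simple_ito B m \<sigma> g t \<omega> $ k" for m \<sigma> g \<omega>
    by (simp add: U.simple_int_def simple_ito_def)
  have "ito_approximation M F (\<lambda>t \<omega>. B t \<omega> $ k) H t (\<lambda>\<omega>. J t \<omega> $ k) n \<tau> h"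
  proof
    show "(\<lambda>(\<omega>, u). indicator {0..t} u * H u \<omega>) \<in> borel_measurable (M \<Otimes>\<^sub>M lborel)"
      by (rule progressive_measurable[OF filtered _ assms]) (use it in \<open>auto simp: has_ito_integral_def\<close>)
    show "AE \<omega> in M. set_integrable lborel {0..t} (\<lambda>u. (H u \<omega>)\<^sup>2)"
      using it by (auto simp: has_ito_integral_def)
    show "(\<lambda>\<omega>. J t \<omega> $ k) \<in> borel_measurable M" using J_measurable[OF assms] by simp
    show "AE \<omega> in M. (\<lambda>k'. U.simple_int (n k') (\<tau> k') (h k') t \<omega>) \<longlonglongrightarrow> J t \<omega> $ k"
      unfolding comp using a(3) by eventually_elim (rule tendsto_vec_nth)
  qed (use assms a in auto)
  then show ?thesis by blast
qed

lemma norm_square_components: "(norm x)\<^sup>2 = (\<Sum>k\<in>UNIV. (x $ k)\<^sup>2)" for x :: "real^'d"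
  by (simp add: norm_vec_def L2_set_def sum_nonneg)

lemma energy_measurable [measurable]: "0 \<le> t \<Longrightarrow> energy t \<in> borel_measurable M"
proof -
  assume "0 \<le> t"
  \<comment> \<open>\<open>undefined\<close> stands for an arbitrary coordinate; the energy is the
    same for all of them.\<close>
  then obtain n \<tau> h where "ito_approximation M F (\<lambda>t \<omega>. B t \<omega> $ undefined) H t (\<lambda>\<omega>. J t \<omega> $ undefined) n \<tau> h"
    using component_approximation by blast
  then interpret ito_approximation M F "\<lambda>t \<omega>. B t \<omega> $ undefined" H t "\<lambda>\<omega>. J t \<omega> $ undefined" n \<tau> h .
  show ?thesis using Q_measurable by (simp add: Q_def[abs_def] energy_def[abs_def])
qed

lemma second_moment_localized:
  assumes "0 \<le> t" "0 \<le> K"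
  shows "(\<integral>\<^sup>+\<omega>. ennreal ((norm (J t \<omega>))\<^sup>2) * indicator {\<omega>. energy t \<omega> < K} \<omega> \<partial>M)
    \<le> of_nat CARD('d) * (\<integral>\<^sup>+\<omega>. ennreal (min K (energy t \<omega>)) \<partial>M)"
proof -
  have [measurable]: "J t \<in> borel_measurable M" "energy t \<in> borel_measurable M"
    using J_measurable energy_measurable assms by auto
  have "(\<integral>\<^sup>+\<omega>. ennreal ((norm (J t \<omega>))\<^sup>2) * indicator {\<omega>. energy t \<omega> < K} \<omega> \<partial>M)
      = (\<integral>\<^sup>+\<omega>. (\<Sum>k\<in>UNIV. ennreal ((J t \<omega> $ k)\<^sup>2) * indicator {\<omega>. energy t \<omega> < K} \<omega>) \<partial>M)"
    by (intro nn_integral_cong) (simp add: norm_square_components sum_distrib_right[symmetric] sum_ennreal)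
  also have "\<dots> = (\<Sum>k\<in>UNIV. \<integral>\<^sup>+\<omega>. ennreal ((J t \<omega> $ k)\<^sup>2) * indicator {\<omega>. energy t \<omega> < K} \<omega> \<partial>M)"
    by (rule nn_integral_sum) measurable
  also have "\<dots> \<le> (\<Sum>k\<in>(UNIV :: 'd set). \<integral>\<^sup>+\<omega>. ennreal (min K (energy t \<omega>)) \<partial>M)"
  proof (rule sum_mono)
    fix k :: 'd
    obtain n \<tau> h where "ito_approximation M F (\<lambda>t \<omega>. B t \<omega> $ k) H t (\<lambda>\<omega>. J t \<omega> $ k) n \<tau> h"
      using component_approximation assms by blast
    then interpret a: ito_approximation M F "\<lambda>t \<omega>. B t \<omega> $ k" H t "\<lambda>\<omega>. J t \<omega> $ k" n \<tau> h .
    show "(\<integral>\<^sup>+\<omega>. ennreal ((J t \<omega> $ k)\<^sup>2) * indicator {\<omega>. energy t \<omega> < K} \<omega> \<partial>M) \<le> (\<integral>\<^sup>+\<omega>. ennreal (min K (energy t \<omega>)) \<partial>M)"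
      using a.second_moment_localized[OF assms(2)] by (simp add: a.Q_def energy_def)
  qed
  finally show ?thesis by simp
qed

context
  fixes s t :: real
  assumes st: "0 \<le> s" "s \<le> t" and energy_integrable: "integrable M (energy t)"
begin

lemma component_ito_identities:
  shows "square_integrable M (\<lambda>\<omega>. J s \<omega> $ k)" "square_integrable M (\<lambda>\<omega>. J t \<omega> $ k)"
    "(\<integral>\<omega>. J s \<omega> $ k * J t \<omega> $ k \<partial>M) = (\<integral>\<omega>. energy s \<omega> \<partial>M)"
    "Z \<in> borel_measurable (F s) \<Longrightarrow> square_integrable M Z \<Longrightarrow> (\<integral>\<omega>. Z \<omega> * (J t \<omega> $ k - J s \<omega> $ k) \<partial>M) = 0"
proof -
  interpret U: unit_rate_martingale M F "\<lambda>t \<omega>. B t \<omega> $ k"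
    by (rule brownian_motion_component[OF filtered brownian])
  obtain n \<tau> h where A: "ito_approximation M F (\<lambda>t \<omega>. B t \<omega> $ k) H s (\<lambda>\<omega>. J s \<omega> $ k) n \<tau> h"
    using component_approximation st(1) by blast
  obtain n' \<tau>' h' where B: "ito_approximation M F (\<lambda>t \<omega>. B t \<omega> $ k) H t (\<lambda>\<omega>. J t \<omega> $ k) n' \<tau>' h'"
    using component_approximation[OF order_trans[OF st]] by blast
  note E = energy_integrable[unfolded energy_def[abs_def]]
  show "square_integrable M (\<lambda>\<omega>. J s \<omega> $ k)" "square_integrable M (\<lambda>\<omega>. J t \<omega> $ k)"
    using U.ito_square_integrable[OF A B st(2) E] by auto
  show "(\<integral>\<omega>. J s \<omega> $ k * J t \<omega> $ k \<partial>M) = (\<integral>\<omega>. energy s \<omega> \<partial>M)"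
    using U.ito_covariance[OF A B st(2) E] by (simp add: energy_def)
  show "Z \<in> borel_measurable (F s) \<Longrightarrow> square_integrable M Z \<Longrightarrow> (\<integral>\<omega>. Z \<omega> * (J t \<omega> $ k - J s \<omega> $ k) \<partial>M) = 0"
    using U.ito_martingale[OF A B st(2) E] by auto
qed

end

text \<open>In each coordinate the square is expanded, and the covariance at the times
  \<open>s\<close> and \<open>t\<close> is the mean energy at the earlier one. All coordinates share
  the scalar integrand, which is the source of the dimension factor in the later constant
  \<open>c\<close>.\<close>

lemma ito_isometry:
  assumes "0 \<le> s" "s \<le> t" "integrable M (energy t)" "integrable M (energy s)"
  shows "has_bochner_integral M (\<lambda>\<omega>. (norm (J t \<omega> - J s \<omega>))\<^sup>2)
    (real CARD('d) * ((\<integral>\<omega>. energy t \<omega> \<partial>M) - (\<integral>\<omega>. energy s \<omega> \<partial>M)))"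
proof -
  have t: "0 \<le> t" using assms by simp
  have "has_bochner_integral M (\<lambda>\<omega>. (J t \<omega> $ k - J s \<omega> $ k)\<^sup>2) ((\<integral>\<omega>. energy t \<omega> \<partial>M) - (\<integral>\<omega>. energy s \<omega> \<partial>M))" for k
  proof -
    note st = component_ito_identities[OF assms(1-3), where k=k]
    note tt = component_ito_identities[OF t order_refl assms(3), where k=k]
    note ss = component_ito_identities[OF assms(1) order_refl assms(4), where k=k]
    have "has_bochner_integral M (\<lambda>\<omega>. J t \<omega> $ k * J t \<omega> $ k - 2 * (J s \<omega> $ k * J t \<omega> $ k) + J s \<omega> $ k * J s \<omega> $ k)
       ((\<integral>\<omega>. energy t \<omega> \<partial>M) - 2 * (\<integral>\<omega>. energy s \<omega> \<partial>M) + (\<integral>\<omega>. energy s \<omega> \<partial>M))"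
      using square_integrable_mult[OF st(1) st(2)] square_integrable_mult[OF st(1) st(1)] square_integrable_mult[OF st(2) st(2)]
        st(3) tt(3) ss(3)
      by (simp add: has_bochner_integral_iff)
    then show ?thesis by (simp add: power2_eq_square algebra_simps)
  qed
  then have "has_bochner_integral M (\<lambda>\<omega>. \<Sum>k\<in>UNIV. (J t \<omega> $ k - J s \<omega> $ k)\<^sup>2)
      (\<Sum>k\<in>(UNIV::'d set). (\<integral>\<omega>. energy t \<omega> \<partial>M) - (\<integral>\<omega>. energy s \<omega> \<partial>M))"
    by (rule has_bochner_integral_sum)
  then show ?thesis by (simp add: norm_square_components)
qed

lemma ito_orthogonal:
  fixes Z :: "'w \<Rightarrow> real^'d"
  assumes "0 \<le> s" "s \<le> t" "integrable M (energy t)"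
    and Z: "Z \<in> borel_measurable (F s)" "integrable M (\<lambda>\<omega>. (norm (Z \<omega>))\<^sup>2)"
  shows "has_bochner_integral M (\<lambda>\<omega>. Z \<omega> \<bullet> (J t \<omega> - J s \<omega>)) 0"
proof -
  have sub: "subalgebra M (F s)" using filtered assms(1) by (simp add: filtered_prob_space_def)
  have "has_bochner_integral M (\<lambda>\<omega>. Z \<omega> $ k * (J t \<omega> $ k - J s \<omega> $ k)) 0" for k
  proof -
    have Zk: "(\<lambda>\<omega>. Z \<omega> $ k) \<in> borel_measurable (F s)" using Z by simp
    have ZM: "Z \<in> borel_measurable M" using measurable_from_subalg[OF sub Z(1)] .
    have "square_integrable M (\<lambda>\<omega>. Z \<omega> $ k)"
      unfolding square_integrable_def
    proof
      show "integrable M (\<lambda>\<omega>. (Z \<omega> $ k)\<^sup>2)"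
      proof (rule Bochner_Integration.integrable_bound[OF Z(2)])
        show "AE \<omega> in M. norm ((Z \<omega> $ k)\<^sup>2) \<le> norm ((norm (Z \<omega>))\<^sup>2)"
          using component_le_norm_cart[of "Z _" k] by (auto simp: abs_le_square_iff[symmetric])
      qed (use ZM in auto)
    qed (use ZM in auto)
    note ZS = this
    show ?thesis
      using component_ito_identities(4)[OF assms(1-3) Zk ZS] component_ito_identities(1,2)[OF assms(1-3), of k]
        square_integrable_mult[OF ZS square_integrable_diff[of M "\<lambda>\<omega>. J t \<omega> $ k" "\<lambda>\<omega>. J s \<omega> $ k"]]
      by (simp add: has_bochner_integral_iff)
  qed
  then have "has_bochner_integral M (\<lambda>\<omega>. \<Sum>k\<in>UNIV. Z \<omega> $ k * (J t \<omega> $ k - J s \<omega> $ k)) (\<Sum>k\<in>(UNIV::'d set). 0)"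
    by (rule has_bochner_integral_sum)
  then show ?thesis by (simp add: inner_vec_def)
qed

end

section \<open>Second moments of the solution\<close>

text \<open>Processes are only meaningful at nonnegative times; composing with \<open>max 0\<close> extends them to the
  whole time axis, so that measurability can be stated on products with \<open>lborel\<close>.\<close>

lemma continuous_paths_jointly_measurable:
  fixes X :: "real \<Rightarrow> 'w \<Rightarrow> 'b::{metric_space, second_countable_topology}"
  assumes X: "\<And>t. 0 \<le> t \<Longrightarrow> X t \<in> borel_measurable M" and cont: "continuous_paths M X"
  shows "(\<lambda>z. X (max 0 (snd z)) (fst z)) \<in> borel_measurable (M \<Otimes>\<^sub>M lborel)"
proof (rule borel_measurable_LIMSEQ_metric)
  \<comment> \<open>\<open>\<kappa> n s / Suc n\<close> rounds the time up to a grid. The rounded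
    process takes countably many times, so it is jointly measurable, and continuity of the paths
    gives the limit.\<close>
  define \<kappa> where "\<kappa> n s = nat \<lceil>real (Suc n) * max 0 s\<rceil>" for n s
  show "(\<lambda>z. X (real (\<kappa> n (snd z)) / real (Suc n)) (fst z)) \<in> borel_measurable (M \<Otimes>\<^sub>M lborel)" for n
  proof (rule measurable_compose_countable[where g="\<lambda>z. \<kappa> n (snd z)" and f="\<lambda>i z. X (real i / real (Suc n)) (fst z)"])
    show "(\<lambda>z. X (real i / real (Suc n)) (fst z)) \<in> borel_measurable (M \<Otimes>\<^sub>M lborel)" for i
      by (rule measurable_compose[OF measurable_fst X]) simp
    show "(\<lambda>z. \<kappa> n (snd z)) \<in> measurable (M \<Otimes>\<^sub>M lborel) (count_space UNIV)"
      unfolding \<kappa>_def by measurable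
  qed
  fix z assume "z \<in> space (M \<Otimes>\<^sub>M (lborel :: real measure))"
  then have w: "fst z \<in> space M" by (auto simp: space_pair_measure)
  let ?s = "max 0 (snd z)"
  have bounds: "?s \<le> real (\<kappa> n (snd z)) / real (Suc n)" "real (\<kappa> n (snd z)) / real (Suc n) \<le> ?s + 1 / real (Suc n)" for n
  proof -
    have nn: "0 \<le> \<lceil>real (Suc n) * ?s\<rceil>" by (simp add: order.trans[OF _ le_of_int_ceiling] ceiling_mono[of 0, simplified])
    have "real (\<kappa> n (snd z)) = of_int \<lceil>real (Suc n) * ?s\<rceil>" using nn by (simp add: \<kappa>_def)
    then have le: "real (Suc n) * ?s \<le> real (\<kappa> n (snd z))" "real (\<kappa> n (snd z)) \<le> real (Suc n) * ?s + 1"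
      by linarith+
    have pos: "0 < real (Suc n)" by simp
    show "?s \<le> real (\<kappa> n (snd z)) / real (Suc n)"
      unfolding pos_le_divide_eq[OF pos] using le(1) by (simp only: mult.commute)
    have "(?s + 1 / real (Suc n)) * real (Suc n) = real (Suc n) * ?s + 1"
      by (simp add: distrib_right del: of_nat_Suc)
    then show "real (\<kappa> n (snd z)) / real (Suc n) \<le> ?s + 1 / real (Suc n)"
      unfolding pos_divide_le_eq[OF pos] using le(2) by (simp only:)
  qed
  have "(\<lambda>n. ?s + 1 / real (Suc n)) \<longlonglongrightarrow> ?s + 0"
    using LIMSEQ_inverse_real_of_nat by (intro tendsto_intros) (simp add: inverse_eq_divide)
  then have "(\<lambda>n. ?s + 1 / real (Suc n)) \<longlonglongrightarrow> ?s" by simp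
  then have lim: "(\<lambda>n. real (\<kappa> n (snd z)) / real (Suc n)) \<longlonglongrightarrow> ?s"
    by (rule tendsto_sandwich[OF always_eventually always_eventually tendsto_const, rotated 2]) (use bounds in blast)+
  have "continuous_on {0..} (\<lambda>t. X t (fst z))" using cont w by (simp add: continuous_paths_def)
  then show "(\<lambda>n. X (real (\<kappa> n (snd z)) / real (Suc n)) (fst z)) \<longlonglongrightarrow> X ?s (fst z)"
    by (rule continuous_on_tendsto_compose[OF _ lim]) auto
qed

lemma set_integral_Icc_max:
  fixes f :: "real \<Rightarrow> 'b::{banach, second_countable_topology}"
  shows "(LINT s:{0..t}|lborel. f (max 0 s)) = (LINT s:{0..t}|lborel. f s)"
    "set_integrable lborel {0..t} (\<lambda>s. f (max 0 s)) \<longleftrightarrow> set_integrable lborel {0..t} f"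
proof -
  have "indicator {0..t} s *\<^sub>R f (max 0 s) = indicator {0..t} s *\<^sub>R f s" for s by (simp add: indicator_def)
  then show "(LINT s:{0..t}|lborel. f (max 0 s)) = (LINT s:{0..t}|lborel. f s)"
    "set_integrable lborel {0..t} (\<lambda>s. f (max 0 s)) \<longleftrightarrow> set_integrable lborel {0..t} f"
    by (simp_all only: set_lebesgue_integral_def set_integrable_def)
qed

lemma set_integrable_bounded_Icc:
  fixes f :: "real \<Rightarrow> 'b::{banach, second_countable_topology}"
  assumes "f \<in> borel_measurable borel" "\<And>s. s \<in> {a..b} \<Longrightarrow> norm (f s) \<le> C"
  shows "set_integrable lborel {a..b} f"
  unfolding set_integrable_def
proof (rule Bochner_Integration.integrable_bound)
  show "integrable lborel (\<lambda>s. indicator {a..b} s * C)"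
    by (intro integrable_mult_left integrable_real_indicator) (auto simp: emeasure_lborel_Icc_eq)
  show "(\<lambda>s. indicator {a..b} s *\<^sub>R f s) \<in> borel_measurable lborel" using assms(1) by measurable
  show "AE s in lborel. norm (indicator {a..b} s *\<^sub>R f s) \<le> norm (indicator {a..b} s * C)"
    using assms(2) by (intro AE_I2) (auto simp: indicator_def intro: order_trans[OF _ abs_ge_self])
qed

text \<open>Cauchy-Schwarz against the indicator of the interval, whose squared norm is
  \<open>b - a\<close>.\<close>

lemma norm_set_integral_square_le:
  fixes f :: "real \<Rightarrow> 'b::{banach, second_countable_topology}"
  assumes f: "set_integrable lborel {a..b} f" and f2: "set_integrable lborel {a..b} (\<lambda>s. (norm (f s))\<^sup>2)" and "a \<le> b"
  shows "(norm (LINT s:{a..b}|lborel. f s))\<^sup>2 \<le> (b - a) * (LINT s:{a..b}|lborel. (norm (f s))\<^sup>2)"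
proof -
  define g where "g s = indicator {a..b} s * norm (f s)" for s
  have ng: "norm (indicator {a..b} s *\<^sub>R f s) = g s" for s by (simp add: g_def)
  have g2: "(g s)\<^sup>2 = indicator {a..b} s *\<^sub>R (norm (f s))\<^sup>2" for s by (simp add: g_def indicator_def)
  have gi: "integrable lborel g" using integrable_norm[OF f[unfolded set_integrable_def]] unfolding ng .
  have gs: "square_integrable lborel g"
    using f2 borel_measurable_integrable[OF gi] unfolding square_integrable_def g2 set_integrable_def by simp
  have ind: "square_integrable lborel (indicator {a..b} :: real \<Rightarrow> real)"
  proof -
    have "(indicator {a..b} s)\<^sup>2 = (indicator {a..b} s :: real)" for s by (simp add: indicator_def)
    then show ?thesis by (simp add: square_integrable_def integrable_real_indicator emeasure_lborel_Icc_eq)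
  qed
  have "norm (LINT s:{a..b}|lborel. f s) \<le> (\<integral>s. g s \<partial>lborel)"
    unfolding set_lebesgue_integral_def using integral_norm_bound[of lborel "\<lambda>s. indicator {a..b} s *\<^sub>R f s"] unfolding ng .
  also have "\<dots> = \<bar>\<integral>s. indicator {a..b} s * g s \<partial>lborel\<bar>"
  proof -
    have "indicator {a..b} s * g s = g s" for s by (simp add: g_def indicator_def)
    moreover have "0 \<le> (\<integral>s. g s \<partial>lborel)" by (rule integral_nonneg_AE) (simp add: g_def)
    ultimately show ?thesis by (simp only: abs_of_nonneg)
  qed
  also have "\<dots> \<le> sqrt (\<integral>s. (indicator {a..b} s)\<^sup>2 \<partial>lborel) * sqrt (\<integral>s. (g s)\<^sup>2 \<partial>lborel)"
    by (rule Cauchy_Schwarz_integral[OF ind gs])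
  also have "(\<integral>s. (indicator {a..b} s :: real)\<^sup>2 \<partial>lborel) = b - a"
  proof -
    have "(indicator {a..b} s)\<^sup>2 = (indicator {a..b} s :: real)" for s by (simp add: indicator_def)
    then show ?thesis using \<open>a \<le> b\<close> by simp
  qed
  also have "(\<integral>s. (g s)\<^sup>2 \<partial>lborel) = (LINT s:{a..b}|lborel. (norm (f s))\<^sup>2)"
    unfolding g2 set_lebesgue_integral_def ..
  finally have "norm (LINT s:{a..b}|lborel. f s) \<le> sqrt ((b - a) * (LINT s:{a..b}|lborel. (norm (f s))\<^sup>2))"
    by (simp only: real_sqrt_mult)
  then have "(norm (LINT s:{a..b}|lborel. f s))\<^sup>2 \<le> (sqrt ((b - a) * (LINT s:{a..b}|lborel. (norm (f s))\<^sup>2)))\<^sup>2"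
    by (rule power_mono) simp
  moreover have "0 \<le> (LINT s:{a..b}|lborel. (norm (f s))\<^sup>2)"
    unfolding set_lebesgue_integral_def by (rule integral_nonneg_AE) simp
  ultimately show ?thesis using \<open>a \<le> b\<close> by simp
qed

lemma norm_square_sum3: "(norm (x + y + z))\<^sup>2 \<le> 3 * (norm x)\<^sup>2 + 3 * (norm y)\<^sup>2 + 3 * (norm (z::'b::real_inner))\<^sup>2"
proof -
  have "0 \<le> (norm (x - y))\<^sup>2 + (norm (y - z))\<^sup>2 + (norm (x - z))\<^sup>2" by simp
  then show ?thesis by (simp add: power2_norm_eq_inner inner_simps inner_commute)
qed

lemma norm_square_diff_le: "(norm (x - y))\<^sup>2 \<le> 2 * (norm x)\<^sup>2 + 2 * (norm (y::'b::real_inner))\<^sup>2"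
proof -
  have "0 \<le> (norm (x + y))\<^sup>2" by simp
  then show ?thesis by (simp add: power2_norm_eq_inner inner_simps inner_commute)
qed

text \<open>Records the equation for \<open>X\<close> together with adaptedness, continuity and
  range of \<Lambda>. The drift of \<Lambda> enters later, in \<open>no_concentration\<close>, as a
  function with a prescribed lower bound.\<close>

locale mean_field_process =
  fixes M :: "'w measure" and F :: "real \<Rightarrow> 'w measure" and B :: "real \<Rightarrow> 'w \<Rightarrow> real^'d" and \<sigma> :: real
    and X :: "real \<Rightarrow> 'w \<Rightarrow> real^'d" and \<Lambda> :: "real \<Rightarrow> 'w \<Rightarrow> real" and J :: "real \<Rightarrow> 'w \<Rightarrow> real^'d"
  assumes filtered': "filtered_prob_space M F" and brownian': "brownian_motion M F B"
    and adapted: "adapted F X" "adapted F \<Lambda>"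
    and continuous: "continuous_paths M X" "continuous_paths M \<Lambda>"
    and \<Lambda>_range: "\<And>t \<omega>. 0 \<le> t \<Longrightarrow> \<omega> \<in> space M \<Longrightarrow> \<Lambda> t \<omega> \<in> {0..1}"
    and ito': "ito_integral_process M F B (\<lambda>s \<omega>. \<sigma> * norm (deviation M X \<Lambda> s \<omega>)) J"
    and equation: "AE \<omega> in M. \<forall>t\<ge>0. X t \<omega> = X 0 \<omega> + (LINT s:{0..t}|lborel. - deviation M X \<Lambda> s \<omega>) + J t \<omega>"
    and initial: "integrable M (\<lambda>\<omega>. (norm (X 0 \<omega>))\<^sup>2)"
    and first_moment: "\<And>t. 0 \<le> t \<Longrightarrow> \<exists>C::real. \<forall>s\<in>{0..t}. (\<integral>\<^sup>+x. ennreal (norm x) \<partial>law M X s) \<le> ennreal C"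
begin

sublocale ito_process M F B "\<lambda>s \<omega>. \<sigma> * norm (deviation M X \<Lambda> s \<omega>)" J
  by standard (fact filtered' brownian' ito')+

abbreviation D :: "real \<Rightarrow> 'w \<Rightarrow> real^'d" where "D \<equiv> deviation M X \<Lambda>"

definition m :: "real \<Rightarrow> real^'d" where "m t = (\<integral>\<omega>. X t \<omega> \<partial>M)"

lemma subalgebra_F: "0 \<le> t \<Longrightarrow> subalgebra M (F t)"
  using filtered by (simp add: filtered_prob_space_def)

lemma X_measurable_F: "0 \<le> t \<Longrightarrow> X t \<in> borel_measurable (F t)"
  using adapted by (simp add: adapted_def)

lemma X_measurable: "0 \<le> t \<Longrightarrow> X t \<in> borel_measurable M"
  and \<Lambda>_measurable: "0 \<le> t \<Longrightarrow> \<Lambda> t \<in> borel_measurable M"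
  using adapted subalgebra_F by (auto simp: adapted_def intro: measurable_from_subalg)

lemma barycenter_law: "0 \<le> t \<Longrightarrow> barycenter (law M X t) = m t"
  unfolding barycenter_def law_def m_def using X_measurable by (subst integral_distr) auto

lemma D_eq: "0 \<le> t \<Longrightarrow> D t \<omega> = X t \<omega> - (1 - \<Lambda> t \<omega>) *\<^sub>R m t"
  by (simp add: deviation_def barycenter_law)

lemma first_moment_bound:
  assumes "0 \<le> T"
  shows "\<exists>C\<ge>0. \<forall>t. 0 \<le> t \<and> t \<le> T \<longrightarrow> integrable M (X t) \<and> norm (m t) \<le> C"
proof -
  obtain C where C: "\<And>s. s \<in> {0..T} \<Longrightarrow> (\<integral>\<^sup>+x. ennreal (norm x) \<partial>law M X s) \<le> ennreal C"
    using first_moment[OF assms] by blast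
  have le: "(\<integral>\<^sup>+\<omega>. ennreal (norm (X t \<omega>)) \<partial>M) \<le> ennreal C" if "0 \<le> t" "t \<le> T" for t
    using C[of t] that X_measurable[OF that(1)] by (simp add: law_def nn_integral_distr)
  have int: "integrable M (X t)" if "0 \<le> t" "t \<le> T" for t
    using le_less_trans[OF le[OF that] ennreal_less_top] X_measurable[OF that(1)] by (simp add: integrable_iff_bounded)
  have "norm (m t) \<le> \<bar>C\<bar>" if "0 \<le> t" "t \<le> T" for t
  proof -
    have "ennreal (norm (m t)) \<le> (\<integral>\<^sup>+\<omega>. ennreal (norm (X t \<omega>)) \<partial>M)"
      unfolding m_def by (rule integral_norm_bound_ennreal[OF int[OF that]])
    also have "\<dots> \<le> ennreal \<bar>C\<bar>" by (rule order_trans[OF le[OF that] ennreal_leI]) simp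
    finally show ?thesis by simp
  qed
  then show ?thesis using int by (intro exI[of _ "\<bar>C\<bar>"]) simp
qed

lemma X_integrable: "0 \<le> t \<Longrightarrow> integrable M (X t)"
  using first_moment_bound[of t] by blast

lemma X_joint: "(\<lambda>z. X (max 0 (snd z)) (fst z)) \<in> borel_measurable (M \<Otimes>\<^sub>M lborel)"
  by (rule continuous_paths_jointly_measurable[OF X_measurable continuous(1)])

lemma \<Lambda>_joint: "(\<lambda>z. \<Lambda> (max 0 (snd z)) (fst z)) \<in> borel_measurable (M \<Otimes>\<^sub>M lborel)"
  by (rule continuous_paths_jointly_measurable[OF \<Lambda>_measurable continuous(2)])

text \<open>Obtained from joint measurability of \<open>X\<close>; continuity of \<open>m\<close> is
  a later consequence of the equation for the mean.\<close>

lemma m_measurable [measurable]: "(\<lambda>s. m (max 0 s)) \<in> borel_measurable borel"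
proof -
  have "(\<lambda>p. X (max 0 (fst p)) (snd p)) \<in> borel_measurable (borel \<Otimes>\<^sub>M M)"
  proof -
    have "(\<lambda>p::real \<times> 'w. (snd p, fst p)) \<in> measurable (borel \<Otimes>\<^sub>M M) (M \<Otimes>\<^sub>M lborel)"
      by (intro measurable_Pair) simp_all
    from measurable_compose[OF this X_joint] show ?thesis by simp
  qed
  then show ?thesis unfolding m_def
    by (intro borel_measurable_lebesgue_integral) (simp add: case_prod_unfold)
qed

lemma D_joint: "(\<lambda>z. D (max 0 (snd z)) (fst z)) \<in> borel_measurable (M \<Otimes>\<^sub>M lborel)"
proof -
  have "(\<lambda>z. D (max 0 (snd z)) (fst z)) =
      (\<lambda>z. X (max 0 (snd z)) (fst z) - (1 - \<Lambda> (max 0 (snd z)) (fst z)) *\<^sub>R m (max 0 (snd z)))"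
    by (simp add: D_eq)
  moreover have "(\<lambda>z. m (max 0 (snd z))) \<in> borel_measurable (M \<Otimes>\<^sub>M lborel)"
    using measurable_compose[OF measurable_snd[of M lborel], of "\<lambda>s. m (max 0 s)" borel] m_measurable by simp
  ultimately show ?thesis
    by (simp only:) (intro borel_measurable_diff borel_measurable_scaleR borel_measurable_const X_joint \<Lambda>_joint)
qed

lemma D_measurable: "0 \<le> t \<Longrightarrow> D t \<in> borel_measurable M"
proof -
  assume t: "0 \<le> t"
  then have "D t = (\<lambda>\<omega>. X t \<omega> - (1 - \<Lambda> t \<omega>) *\<^sub>R m t)" using D_eq by auto
  then show ?thesis using X_measurable[OF t] \<Lambda>_measurable[OF t] by simp
qed

lemma D_path_measurable:
  assumes "\<omega> \<in> space M" shows "(\<lambda>s. D (max 0 s) \<omega>) \<in> borel_measurable borel"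
  using measurable_compose[OF measurable_Pair1'[OF assms] D_joint] by simp

lemma norm_D_le:
  assumes "0 \<le> t" "\<omega> \<in> space M" "norm (m t) \<le> C"
  shows "norm (D t \<omega>) \<le> norm (X t \<omega>) + C"
proof -
  have "norm ((1 - \<Lambda> t \<omega>) *\<^sub>R m t) \<le> 1 * C"
    unfolding norm_scaleR using \<Lambda>_range[OF assms(1,2)] assms(3) by (intro mult_mono) auto
  then show ?thesis unfolding D_eq[OF assms(1)] by (intro order_trans[OF norm_triangle_ineq4]) simp
qed

text \<open>Compactness bounds the continuous path of \<open>X\<close>, and the hypothesis on first
  moments bounds \<open>m\<close>, at a stage where \<open>m\<close> is not yet known to be
  continuous.\<close>

lemma D_path_bounded:
  assumes "\<omega> \<in> space M"
  shows "\<exists>R. \<forall>s. 0 \<le> s \<and> s \<le> T \<longrightarrow> norm (D s \<omega>) \<le> R"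
proof (cases "0 \<le> T")
  case True
  obtain C where C: "\<And>t. 0 \<le> t \<Longrightarrow> t \<le> T \<Longrightarrow> norm (m t) \<le> C" using first_moment_bound[OF True] by blast
  have "continuous_on {0..T} (\<lambda>t. X t \<omega>)"
    using continuous(1) assms by (auto simp: continuous_paths_def intro: continuous_on_subset)
  then have "bounded ((\<lambda>t. X t \<omega>) ` {0..T})" by (intro compact_imp_bounded compact_continuous_image) auto
  then obtain R where "\<forall>x\<in>(\<lambda>t. X t \<omega>) ` {0..T}. norm x \<le> R" using bounded_iff by blast
  then have R: "\<And>t. t \<in> {0..T} \<Longrightarrow> norm (X t \<omega>) \<le> R" by blast
  have "norm (D s \<omega>) \<le> R + C" if "0 \<le> s" "s \<le> T" for s
    using norm_D_le[OF that(1) assms C[OF that]] R[of s] that by simp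
  then show ?thesis by blast
next
  case False
  then show ?thesis by (intro exI[of _ 0]) linarith
qed

lemma D_path_integrable:
  assumes "\<omega> \<in> space M" "0 \<le> a"
  shows "set_integrable lborel {a..b} (\<lambda>s. D (max 0 s) \<omega>)"
    and "set_integrable lborel {a..b} (\<lambda>s. (norm (D (max 0 s) \<omega>))\<^sup>2)"
proof -
  obtain R where R: "\<And>s. 0 \<le> s \<Longrightarrow> s \<le> b \<Longrightarrow> norm (D s \<omega>) \<le> R" using D_path_bounded[OF assms(1)] by blast
  note D_path_measurable[OF assms(1), measurable]
  show "set_integrable lborel {a..b} (\<lambda>s. D (max 0 s) \<omega>)"
  proof (rule set_integrable_bounded_Icc[where C=R])
    show "norm (D (max 0 s) \<omega>) \<le> R" if "s \<in> {a..b}" for s using that assms(2) by (intro R) auto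
  qed measurable
  show "set_integrable lborel {a..b} (\<lambda>s. (norm (D (max 0 s) \<omega>))\<^sup>2)"
  proof (rule set_integrable_bounded_Icc[where C="R\<^sup>2"])
    fix s assume "s \<in> {a..b}"
    then have "(norm (D (max 0 s) \<omega>))\<^sup>2 \<le> R\<^sup>2" using assms(2) by (intro power_mono R) auto
    then show "norm ((norm (D (max 0 s) \<omega>))\<^sup>2) \<le> R\<^sup>2" by simp
  qed measurable
qed

text \<open>An increasing continuous clock that controls both terms of the equation: by
  Cauchy-Schwarz it bounds the square of the drift integral, and up to the factor
  \<open>\<sigma>\<^sup>2\<close> it is the energy of the noise. Localizing by \<open>A\<close>
  rather than by the energy therefore also works for \<open>\<sigma> = 0\<close>.\<close>

definition A :: "real \<Rightarrow> 'w \<Rightarrow> real" where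
  "A t \<omega> = (LINT s:{0..t}|lborel. (norm (D (max 0 s) \<omega>))\<^sup>2)"

lemma energy_eq: "energy t \<omega> = \<sigma>\<^sup>2 * A t \<omega>"
proof -
  have "indicator {0..t} s *\<^sub>R (\<sigma> * norm (D s \<omega>))\<^sup>2 = \<sigma>\<^sup>2 * (indicator {0..t} s *\<^sub>R (norm (D (max 0 s) \<omega>))\<^sup>2)" for s
    by (simp add: indicator_def power_mult_distrib)
  then show ?thesis
    unfolding energy_def A_def set_lebesgue_integral_def by (simp only: integral_mult_right_zero)
qed

lemma A_measurable [measurable]: "A t \<in> borel_measurable M"
proof -
  have [measurable]: "(\<lambda>z. D (max 0 (snd z)) (fst z)) \<in> borel_measurable (M \<Otimes>\<^sub>M borel)"
    using D_joint by simp
  have "(\<lambda>z. indicator {0..t} (snd z) *\<^sub>R (norm (D (max 0 (snd z)) (fst z)))\<^sup>2) \<in> borel_measurable (M \<Otimes>\<^sub>M lborel)"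
    by measurable
  then have "(\<lambda>\<omega>. \<integral>s. indicator {0..t} s *\<^sub>R (norm (D (max 0 s) \<omega>))\<^sup>2 \<partial>lborel) \<in> borel_measurable M"
    by (intro lborel.borel_measurable_lebesgue_integral) (simp add: case_prod_unfold)
  then show ?thesis unfolding A_def[abs_def] set_lebesgue_integral_def .
qed

lemma A_nonneg: "0 \<le> A t \<omega>"
  unfolding A_def set_lebesgue_integral_def by (rule integral_nonneg_AE) simp

lemma A_zero: "A 0 \<omega> = 0"
proof -
  have "AE s in lborel. indicator {0..0::real} s *\<^sub>R (norm (D (max 0 s) \<omega>))\<^sup>2 = 0"
    using AE_lborel_singleton[of "0::real"] by eventually_elim (auto simp: indicator_def)
  then show ?thesis unfolding A_def set_lebesgue_integral_def by (rule integral_eq_zero_AE)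
qed

lemma A_increment:
  assumes "\<omega> \<in> space M" "0 \<le> s" "s \<le> t"
  shows "A t \<omega> - A s \<omega> = (LINT r:{s..t}|lborel. (norm (D (max 0 r) \<omega>))\<^sup>2)"
proof -
  let ?f = "\<lambda>r. (norm (D (max 0 r) \<omega>))\<^sup>2"
  have int: "set_integrable lborel {0..s} ?f" "set_integrable lborel {s..t} ?f" "set_integrable lborel {0..t} ?f"
    using assms by (auto intro!: D_path_integrable(2))
  show ?thesis unfolding A_def
    using set_borel_integral_eq_integral(2)[OF int(1)] set_borel_integral_eq_integral(2)[OF int(2)]
      set_borel_integral_eq_integral(2)[OF int(3)]
      Henstock_Kurzweil_Integration.integral_combine[OF assms(2,3), of ?f] set_borel_integral_eq_integral(1)[OF int(3)]
    by simp
qed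

lemma A_mono: "\<omega> \<in> space M \<Longrightarrow> 0 \<le> s \<Longrightarrow> s \<le> t \<Longrightarrow> A s \<omega> \<le> A t \<omega>"
proof -
  assume "\<omega> \<in> space M" "0 \<le> s" "s \<le> t"
  moreover have "0 \<le> (LINT r:{s..t}|lborel. (norm (D (max 0 r) \<omega>))\<^sup>2)"
    unfolding set_lebesgue_integral_def by (rule integral_nonneg_AE) simp
  ultimately show ?thesis using A_increment[of \<omega> s t] by simp
qed

lemma A_continuous: "continuous_paths M A"
  unfolding continuous_paths_def
proof
  fix \<omega> assume w: "\<omega> \<in> space M"
  have "continuous_on {0..T} (\<lambda>t. A t \<omega>)" for T
  proof -
    have "A t \<omega> = integral {0..t} (\<lambda>s. (norm (D (max 0 s) \<omega>))\<^sup>2)" for t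
      unfolding A_def using w by (intro set_borel_integral_eq_integral(2) D_path_integrable(2)) auto
    moreover have "continuous_on {0..T} (\<lambda>t. integral {0..t} (\<lambda>s. (norm (D (max 0 s) \<omega>))\<^sup>2))"
      using w by (intro indefinite_integral_continuous_1 set_borel_integral_eq_integral(1) D_path_integrable(2)) auto
    ultimately show ?thesis by simp
  qed
  note c = this
  show "continuous_on {0..} (\<lambda>t. A t \<omega>)"
  proof (rule continuous_on_eq_continuous_within[THEN iffD2], rule ballI)
    fix t :: real assume "t \<in> {0..}"
    then have "continuous (at t within {0..t + 1}) (\<lambda>t. A t \<omega>)"
      using c[of "t + 1"] by (auto simp: continuous_on_eq_continuous_within)
    moreover have "at t within {0..} = at t within {0..t + 1}"
      by (rule at_within_nhd[of _ "{..<t+1}"]) auto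
    ultimately show "continuous (at t within {0..}) (\<lambda>t. A t \<omega>)" by simp
  qed
qed

lemma A_joint: "(\<lambda>z. A (max 0 (snd z)) (fst z)) \<in> borel_measurable (M \<Otimes>\<^sub>M lborel)"
  by (rule continuous_paths_jointly_measurable[OF A_measurable A_continuous])

text \<open>Substitute for stopping at level \<open>K\<close>. The clock starts at 0 and is
  continuous, so every value \<open>y\<close> below both \<open>K\<close> and
  \<open>A t \<omega>\<close> is attained at some time, and by monotonicity the indicator equals 1
  up to that time. Letting \<open>y\<close> increase to \<open>K\<close> settles the case in which
  the level is reached.\<close>

lemma min_A_le:
  assumes w: "\<omega> \<in> space M" and "0 \<le> t" "0 < K"
  shows "min K (A t \<omega>) \<le> (LINT s:{0..t}|lborel. (norm (D (max 0 s) \<omega>))\<^sup>2 * indicator {s. A (max 0 s) \<omega> < K} s)"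
proof -
  let ?f = "\<lambda>s. (norm (D (max 0 s) \<omega>))\<^sup>2" and ?I = "\<lambda>s. indicator {s. A (max 0 s) \<omega> < K} s :: real"
  have [measurable]: "(\<lambda>s. A (max 0 s) \<omega>) \<in> borel_measurable borel"
    using measurable_compose[OF measurable_Pair1'[OF w] A_joint] by simp
  note D_path_measurable[OF w, measurable]
  have int: "set_integrable lborel {0..t} ?f" using w by (intro D_path_integrable(2)) auto
  have int': "set_integrable lborel {0..t} (\<lambda>s. ?f s * ?I s)"
    unfolding set_integrable_def
    by (rule Bochner_Integration.integrable_bound[OF int[unfolded set_integrable_def]]) (measurable, auto simp: indicator_def)
  have sub: "A \<tau> \<omega> \<le> (LINT s:{0..t}|lborel. ?f s * ?I s)" if tau: "0 \<le> \<tau>" "\<tau> \<le> t" "A \<tau> \<omega> < K" for \<tau>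
    unfolding A_def[of \<tau>] set_lebesgue_integral_def
  proof (rule integral_mono)
    show "integrable lborel (\<lambda>s. indicator {0..\<tau>} s *\<^sub>R ?f s)"
      using D_path_integrable(2)[OF w order_refl, of \<tau>] by (simp add: set_integrable_def)
    show "integrable lborel (\<lambda>s. indicator {0..t} s *\<^sub>R (?f s * ?I s))" using int' by (simp add: set_integrable_def)
    show "indicator {0..\<tau>} s *\<^sub>R ?f s \<le> indicator {0..t} s *\<^sub>R (?f s * ?I s)" for s
      using A_mono[OF w, of s \<tau>] tau by (auto simp: indicator_def)
  qed
  show ?thesis
  proof (cases "A t \<omega> < K")
    case True
    then show ?thesis using sub[of t] assms by simp
  next
    case False
    have "K \<le> (LINT s:{0..t}|lborel. ?f s * ?I s)"
    proof (rule dense_le_bounded[OF \<open>0 < K\<close>])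
      fix y assume y: "0 < y" "y < K"
      have "continuous_on {0..t} (\<lambda>t. A t \<omega>)"
        using A_continuous w by (auto simp: continuous_paths_def intro: continuous_on_subset)
      then obtain \<tau> where "0 \<le> \<tau>" "\<tau> \<le> t" "A \<tau> \<omega> = y"
        using IVT'[of "\<lambda>t. A t \<omega>" 0 y t] False y assms by (auto simp: A_zero)
      then show "y \<le> (LINT s:{0..t}|lborel. ?f s * ?I s)" using sub[of \<tau>] y by simp
    qed
    then show ?thesis by simp
  qed
qed

end

text \<open>Without integrability the Bochner integral is 0 by convention, and the inequality is
  trivial.\<close>

lemma ennreal_integral_le_nn_integral:
  fixes f :: "'a \<Rightarrow> real"
  assumes "AE x in M. 0 \<le> f x"
  shows "ennreal (\<integral>x. f x \<partial>M) \<le> (\<integral>\<^sup>+x. ennreal (f x) \<partial>M)"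
proof (cases "integrable M f")
  case True
  then show ?thesis using assms by (simp add: nn_integral_eq_integral)
qed (simp add: not_integrable_integral_eq)

text \<open>A bound on the absolute moments that is uniform over the compact time interval makes
  \<open>f\<close> integrable on the product.\<close>

lemma (in prob_space) Fubini_time:
  fixes f :: "'a \<times> real \<Rightarrow> 'b::{banach, second_countable_topology}"
  assumes f: "f \<in> borel_measurable (M \<Otimes>\<^sub>M lborel)"
    and bound: "\<And>s. s \<in> {a..b} \<Longrightarrow> (\<integral>\<^sup>+\<omega>. ennreal (norm (f (\<omega>, s))) \<partial>M) \<le> ennreal C"
  shows "integrable M (\<lambda>\<omega>. LINT s:{a..b}|lborel. f (\<omega>, s))"
    "(\<integral>\<omega>. (LINT s:{a..b}|lborel. f (\<omega>, s)) \<partial>M) = (LINT s:{a..b}|lborel. (\<integral>\<omega>. f (\<omega>, s) \<partial>M))"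
    "set_integrable lborel {a..b} (\<lambda>s. \<integral>\<omega>. f (\<omega>, s) \<partial>M)"
proof -
  interpret pair_sigma_finite M "lborel :: real measure" ..
  let ?g = "\<lambda>\<omega> s. indicator {a..b} s *\<^sub>R f (\<omega>, s)"
  have ind: "(\<lambda>z. indicator {a..b} (snd z) :: real) \<in> borel_measurable (M \<Otimes>\<^sub>M lborel)" by measurable
  have "(\<lambda>z. indicator {a..b} (snd z) *\<^sub>R f z) \<in> borel_measurable (M \<Otimes>\<^sub>M lborel)"
    by (rule borel_measurable_scaleR[OF ind f])
  then have gm: "case_prod ?g \<in> borel_measurable (M \<Otimes>\<^sub>M lborel)" by (simp add: case_prod_unfold)
  then have nm: "(\<lambda>(\<omega>, s). ennreal (norm (?g \<omega> s))) \<in> borel_measurable (M \<Otimes>\<^sub>M lborel)"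
  proof -
    have "(\<lambda>(\<omega>, s). ennreal (norm (?g \<omega> s))) = (\<lambda>z. ennreal (norm (case_prod ?g z)))" by auto
    then show ?thesis using measurable_compose[OF measurable_compose[OF gm borel_measurable_norm] measurable_ennreal] by (simp only:)
  qed
  have "(\<integral>\<^sup>+z. ennreal (norm (case_prod ?g z)) \<partial>(M \<Otimes>\<^sub>M lborel)) = (\<integral>\<^sup>+s. (\<integral>\<^sup>+\<omega>. ennreal (norm (?g \<omega> s)) \<partial>M) \<partial>lborel)"
    using nn_integral_snd[OF nm] by (simp add: case_prod_unfold)
  also have "\<dots> \<le> (\<integral>\<^sup>+s. ennreal C * indicator {a..b} s \<partial>lborel)"
    by (intro nn_integral_mono) (auto simp: indicator_def intro: bound)
  also have "\<dots> = ennreal C * emeasure lborel {a..b}" by (rule nn_integral_cmult_indicator) simp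
  also have "\<dots> < \<infinity>" by (auto simp: emeasure_lborel_Icc_eq ennreal_mult_less_top)
  finally have int: "integrable (M \<Otimes>\<^sub>M lborel) (case_prod ?g)"
    using gm by (simp add: integrable_iff_bounded)
  show "integrable M (\<lambda>\<omega>. LINT s:{a..b}|lborel. f (\<omega>, s))"
    using integrable_fst[OF int] by (simp add: set_lebesgue_integral_def)
  show "(\<integral>\<omega>. (LINT s:{a..b}|lborel. f (\<omega>, s)) \<partial>M) = (LINT s:{a..b}|lborel. (\<integral>\<omega>. f (\<omega>, s) \<partial>M))"
    using Fubini_integral[OF int] by (simp add: set_lebesgue_integral_def)
  show "set_integrable lborel {a..b} (\<lambda>s. \<integral>\<omega>. f (\<omega>, s) \<partial>M)"
    using integrable_snd[OF int] by (simp add: set_integrable_def)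
qed

section \<open>Finiteness of second moments by localization\<close>

context mean_field_process begin

text \<open>Translates localization by the energy into localization by \<open>A\<close>. For
  \<open>\<sigma> = 0\<close> the event that the energy is below \<open>\<sigma>\<^sup>2 * K\<close>
  is empty, so the level is raised by \<open>\<epsilon> = e / CARD('d)\<close>; the additional cost
  is \<open>e\<close>, which is arbitrary.\<close>

lemma J_second_moment_localized:
  assumes "0 \<le> t" "0 \<le> K"
  shows "(\<integral>\<^sup>+\<omega>. ennreal ((norm (J t \<omega>))\<^sup>2) * indicator {\<omega>. A t \<omega> < K} \<omega> \<partial>M)
    \<le> ennreal (real CARD('d) * \<sigma>\<^sup>2) * (\<integral>\<^sup>+\<omega>. ennreal (min K (A t \<omega>)) \<partial>M)"
proof (rule ennreal_le_epsilon)
  fix e :: real assume "0 < e"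
  define \<epsilon> where "\<epsilon> = e / real CARD('d)"
  have eps: "0 < \<epsilon>" "real CARD('d) * \<epsilon> = e" using \<open>0 < e\<close> by (auto simp: \<epsilon>_def)
  have "(\<integral>\<^sup>+\<omega>. ennreal ((norm (J t \<omega>))\<^sup>2) * indicator {\<omega>. A t \<omega> < K} \<omega> \<partial>M)
      \<le> (\<integral>\<^sup>+\<omega>. ennreal ((norm (J t \<omega>))\<^sup>2) * indicator {\<omega>. energy t \<omega> < \<sigma>\<^sup>2 * K + \<epsilon>} \<omega> \<partial>M)"
  proof (intro nn_integral_mono mult_left_mono)
    fix \<omega>
    have "A t \<omega> < K \<Longrightarrow> \<sigma>\<^sup>2 * A t \<omega> \<le> \<sigma>\<^sup>2 * K" by (intro mult_left_mono) auto
    then show "(indicator {\<omega>. A t \<omega> < K} \<omega> :: ennreal) \<le> indicator {\<omega>. energy t \<omega> < \<sigma>\<^sup>2 * K + \<epsilon>} \<omega>"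
      using eps by (auto simp: energy_eq indicator_def)
  qed simp
  also have "\<dots> \<le> of_nat CARD('d) * (\<integral>\<^sup>+\<omega>. ennreal (min (\<sigma>\<^sup>2 * K + \<epsilon>) (energy t \<omega>)) \<partial>M)"
    using assms eps by (intro second_moment_localized) auto
  also have "\<dots> \<le> of_nat CARD('d) * (\<integral>\<^sup>+\<omega>. ennreal (\<sigma>\<^sup>2) * ennreal (min K (A t \<omega>)) + ennreal \<epsilon> \<partial>M)"
  proof (intro mult_left_mono nn_integral_mono)
    fix \<omega>
    have "min (\<sigma>\<^sup>2 * K + \<epsilon>) (energy t \<omega>) \<le> \<sigma>\<^sup>2 * min K (A t \<omega>) + \<epsilon>"
      using eps by (auto simp: energy_eq min_def)
    moreover have "0 \<le> min K (A t \<omega>)" using assms A_nonneg by simp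
    ultimately show "ennreal (min (\<sigma>\<^sup>2 * K + \<epsilon>) (energy t \<omega>)) \<le> ennreal (\<sigma>\<^sup>2) * ennreal (min K (A t \<omega>)) + ennreal \<epsilon>"
      using eps by (simp add: ennreal_mult[symmetric] ennreal_plus[symmetric] ennreal_leI del: ennreal_plus)
  qed simp
  also have "\<dots> = of_nat CARD('d) * (ennreal (\<sigma>\<^sup>2) * (\<integral>\<^sup>+\<omega>. ennreal (min K (A t \<omega>)) \<partial>M) + ennreal \<epsilon>)"
    by (simp add: nn_integral_add nn_integral_cmult emeasure_space_1)
  also have "\<dots> = ennreal (real CARD('d) * \<sigma>\<^sup>2) * (\<integral>\<^sup>+\<omega>. ennreal (min K (A t \<omega>)) \<partial>M) + ennreal e"
  proof -
    have "ennreal (real CARD('d)) * ennreal \<epsilon> = ennreal e"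
      using eps by (subst ennreal_mult[symmetric]) auto
    then show ?thesis by (simp add: distrib_left ennreal_mult mult.assoc ennreal_of_nat_eq_real_of_nat)
  qed
  finally show "(\<integral>\<^sup>+\<omega>. ennreal ((norm (J t \<omega>))\<^sup>2) * indicator {\<omega>. A t \<omega> < K} \<omega> \<partial>M)
    \<le> ennreal (real CARD('d) * \<sigma>\<^sup>2) * (\<integral>\<^sup>+\<omega>. ennreal (min K (A t \<omega>)) \<partial>M) + ennreal e" .
qed

lemma increment_equation:
  assumes st: "0 \<le> s" "s \<le> t"
  shows "AE \<omega> in M. X t \<omega> - X s \<omega> = (J t \<omega> - J s \<omega>) - (LINT r:{s..t}|lborel. D (max 0 r) \<omega>)"
  using equation AE_space
proof eventually_elim
  case (elim \<omega>)
  have neg: "(LINT r:{0..u}|lborel. - D r \<omega>) = - (LINT r:{0..u}|lborel. D (max 0 r) \<omega>)" for u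
    unfolding set_integral_Icc_max(1)[where f="\<lambda>r. D r \<omega>"] by (simp add: set_lebesgue_integral_def)
  have int: "set_integrable lborel {0..s} (\<lambda>r. D (max 0 r) \<omega>)" "set_integrable lborel {s..t} (\<lambda>r. D (max 0 r) \<omega>)"
    "set_integrable lborel {0..t} (\<lambda>r. D (max 0 r) \<omega>)"
    using elim(2) st by (auto intro!: D_path_integrable(1))
  have split: "(LINT r:{0..t}|lborel. D (max 0 r) \<omega>) = (LINT r:{0..s}|lborel. D (max 0 r) \<omega>) + (LINT r:{s..t}|lborel. D (max 0 r) \<omega>)"
    using set_borel_integral_eq_integral(2)[OF int(1)] set_borel_integral_eq_integral(2)[OF int(2)]
      set_borel_integral_eq_integral(2)[OF int(3)]
      Henstock_Kurzweil_Integration.integral_combine[OF st, of "\<lambda>r. D (max 0 r) \<omega>"] set_borel_integral_eq_integral(1)[OF int(3)]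
    by simp
  have "X t \<omega> = X 0 \<omega> - (LINT r:{0..t}|lborel. D (max 0 r) \<omega>) + J t \<omega>"
    "X s \<omega> = X 0 \<omega> - (LINT r:{0..s}|lborel. D (max 0 r) \<omega>) + J s \<omega>"
    using elim(1)[rule_format, OF order_trans[OF st]] elim(1)[rule_format, OF st(1)] unfolding neg by simp_all
  then show ?case unfolding split by simp
qed

text \<open>The square is split into initial value, drift and noise at the price of a factor 3. The
  drift costs at most \<open>T * A t \<omega>\<close>, and on the event
  \<open>A t \<omega> < K\<close> the clock equals its minimum with \<open>K\<close>.\<close>

lemma X_square_localized:
  assumes t: "0 \<le> t" "t \<le> T" and "0 \<le> K"
  shows "(\<integral>\<^sup>+\<omega>. ennreal ((norm (X t \<omega>))\<^sup>2) * indicator {\<omega>. A t \<omega> < K} \<omega> \<partial>M)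
    \<le> 3 * (\<integral>\<^sup>+\<omega>. ennreal ((norm (X 0 \<omega>))\<^sup>2) \<partial>M)
      + ennreal (3 * T + 3 * (real CARD('d) * \<sigma>\<^sup>2)) * (\<integral>\<^sup>+\<omega>. ennreal (min K (A t \<omega>)) \<partial>M)"
proof -
  let ?I = "\<lambda>\<omega>. indicator {\<omega>. A t \<omega> < K} \<omega> :: ennreal"
  have [measurable]: "J t \<in> borel_measurable M" "X 0 \<in> borel_measurable M"
    using J_measurable X_measurable t by auto
  have "AE \<omega> in M. ennreal ((norm (X t \<omega>))\<^sup>2) * ?I \<omega>
      \<le> 3 * ennreal ((norm (X 0 \<omega>))\<^sup>2) + (ennreal (3 * T) * ennreal (min K (A t \<omega>)) + 3 * (ennreal ((norm (J t \<omega>))\<^sup>2) * ?I \<omega>))"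
    using equation AE_space
  proof eventually_elim
    case (elim \<omega>)
    show ?case
    proof (cases "A t \<omega> < K")
      case True
      have "(LINT r:{0..t}|lborel. - D r \<omega>) = - (LINT r:{0..t}|lborel. D (max 0 r) \<omega>)"
        unfolding set_integral_Icc_max(1)[where f="\<lambda>r. D r \<omega>"] by (simp add: set_lebesgue_integral_def)
      then have "X t \<omega> = X 0 \<omega> + (- (LINT r:{0..t}|lborel. D (max 0 r) \<omega>)) + J t \<omega>"
        using elim(1)[rule_format, OF t(1)] by (simp only:)
      then have "(norm (X t \<omega>))\<^sup>2 \<le> 3 * (norm (X 0 \<omega>))\<^sup>2 + 3 * (norm (- (LINT r:{0..t}|lborel. D (max 0 r) \<omega>)))\<^sup>2 + 3 * (norm (J t \<omega>))\<^sup>2"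
        using norm_square_sum3 by metis
      moreover have "(norm (- (LINT r:{0..t}|lborel. D (max 0 r) \<omega>)))\<^sup>2 \<le> (t - 0) * A t \<omega>"
        unfolding A_def norm_minus_cancel
        by (rule norm_set_integral_square_le[OF D_path_integrable[OF elim(2) order_refl] t(1)])
      moreover have "(t - 0) * A t \<omega> \<le> T * A t \<omega>" using t A_nonneg by (intro mult_right_mono) auto
      ultimately have "(norm (X t \<omega>))\<^sup>2 \<le> 3 * (norm (X 0 \<omega>))\<^sup>2 + (3 * T * A t \<omega> + 3 * (norm (J t \<omega>))\<^sup>2)" by simp
      then have "ennreal ((norm (X t \<omega>))\<^sup>2) \<le> ennreal (3 * (norm (X 0 \<omega>))\<^sup>2 + (3 * T * A t \<omega> + 3 * (norm (J t \<omega>))\<^sup>2))"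
        by (rule ennreal_leI)
      also have "\<dots> = 3 * ennreal ((norm (X 0 \<omega>))\<^sup>2) + (ennreal (3 * T) * ennreal (A t \<omega>) + 3 * ennreal ((norm (J t \<omega>))\<^sup>2))"
        using t A_nonneg[of t \<omega>] by (simp add: ennreal_mult ennreal_numeral[symmetric] del: ennreal_numeral)
      finally show ?thesis using True by (simp add: min_absorb2)
    qed simp
  qed
  then have "(\<integral>\<^sup>+\<omega>. ennreal ((norm (X t \<omega>))\<^sup>2) * ?I \<omega> \<partial>M)
    \<le> (\<integral>\<^sup>+\<omega>. 3 * ennreal ((norm (X 0 \<omega>))\<^sup>2) + (ennreal (3 * T) * ennreal (min K (A t \<omega>)) + 3 * (ennreal ((norm (J t \<omega>))\<^sup>2) * ?I \<omega>)) \<partial>M)"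
    by (rule nn_integral_mono_AE)
  also have "\<dots> = 3 * (\<integral>\<^sup>+\<omega>. ennreal ((norm (X 0 \<omega>))\<^sup>2) \<partial>M) + (ennreal (3 * T) * (\<integral>\<^sup>+\<omega>. ennreal (min K (A t \<omega>)) \<partial>M)
      + 3 * (\<integral>\<^sup>+\<omega>. ennreal ((norm (J t \<omega>))\<^sup>2) * ?I \<omega> \<partial>M))"
    by (simp add: nn_integral_add nn_integral_cmult)
  also have "\<dots> \<le> 3 * (\<integral>\<^sup>+\<omega>. ennreal ((norm (X 0 \<omega>))\<^sup>2) \<partial>M) + (ennreal (3 * T) * (\<integral>\<^sup>+\<omega>. ennreal (min K (A t \<omega>)) \<partial>M)
      + 3 * (ennreal (real CARD('d) * \<sigma>\<^sup>2) * (\<integral>\<^sup>+\<omega>. ennreal (min K (A t \<omega>)) \<partial>M)))"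
    using J_second_moment_localized[OF t(1) assms(3)] by (intro add_left_mono mult_left_mono) auto
  also have "\<dots> = 3 * (\<integral>\<^sup>+\<omega>. ennreal ((norm (X 0 \<omega>))\<^sup>2) \<partial>M)
      + (ennreal (3 * T) + 3 * ennreal (real CARD('d) * \<sigma>\<^sup>2)) * (\<integral>\<^sup>+\<omega>. ennreal (min K (A t \<omega>)) \<partial>M)"
    by (simp add: distrib_right mult.assoc)
  also have "ennreal (3 * T) + 3 * ennreal (real CARD('d) * \<sigma>\<^sup>2) = ennreal (3 * T + 3 * (real CARD('d) * \<sigma>\<^sup>2))"
    using t by (simp add: ennreal_mult ennreal_numeral[symmetric] del: ennreal_numeral)
  finally show ?thesis .
qed

text \<open>For fixed \<open>K\<close> this function is bounded on compact time intervals by a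
  constant depending on \<open>K\<close>. That is enough for Gronwall's inequality, which then
  yields a bound free of \<open>K\<close>.\<close>

definition localized_moment :: "real \<Rightarrow> real \<Rightarrow> ennreal" where
  "localized_moment K t = (\<integral>\<^sup>+\<omega>. ennreal ((norm (X (max 0 t) \<omega>))\<^sup>2) * indicator {\<omega>. A (max 0 t) \<omega> < K} \<omega> \<partial>M)"

lemma localized_moment_measurable [measurable]: "localized_moment K \<in> borel_measurable borel"
proof -
  have swap: "(\<lambda>p::real \<times> 'w. (snd p, fst p)) \<in> measurable (borel \<Otimes>\<^sub>M M) (M \<Otimes>\<^sub>M lborel)"
    by (intro measurable_Pair) simp_all
  have [measurable]: "(\<lambda>p. X (max 0 (fst p)) (snd p)) \<in> borel_measurable (borel \<Otimes>\<^sub>M M)"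
    "(\<lambda>p. A (max 0 (fst p)) (snd p)) \<in> borel_measurable (borel \<Otimes>\<^sub>M M)"
    using measurable_compose[OF swap X_joint] measurable_compose[OF swap A_joint] by simp_all
  have "(\<lambda>p. ennreal ((norm (X (max 0 (fst p)) (snd p)))\<^sup>2) * indicator {p. A (max 0 (fst p)) (snd p) < K} p)
      \<in> borel_measurable (borel \<Otimes>\<^sub>M M)" by measurable
  then show ?thesis unfolding localized_moment_def[abs_def]
    by (intro borel_measurable_nn_integral) (simp add: case_prod_unfold indicator_def)
qed

text \<open>Closes the loop for Gronwall: by \<open>min_A_le\<close> and Tonelli, the mean truncated
  clock is controlled by the localized moments at earlier times with the same level
  \<open>K\<close>. A clock without the indicator would bring back the full second moment.\<close>

lemma min_A_expectation_le:
  assumes "0 \<le> t" "0 < K" and C: "\<And>s. 0 \<le> s \<Longrightarrow> s \<le> t \<Longrightarrow> norm (m s) \<le> C" "0 \<le> C"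
  shows "(\<integral>\<^sup>+\<omega>. ennreal (min K (A t \<omega>)) \<partial>M) \<le> 2 * (\<integral>\<^sup>+s\<in>{0..t}. localized_moment K s \<partial>lborel) + ennreal (2 * C\<^sup>2 * t)"
proof -
  interpret pair_sigma_finite M "lborel :: real measure" ..
  let ?f = "\<lambda>\<omega> s. indicator {0..t} s * ((norm (D (max 0 s) \<omega>))\<^sup>2 * indicator {s. A (max 0 s) \<omega> < K} s)"
  have [measurable]: "(\<lambda>z. D (max 0 (snd z)) (fst z)) \<in> borel_measurable (M \<Otimes>\<^sub>M borel)"
    "(\<lambda>z. A (max 0 (snd z)) (fst z)) \<in> borel_measurable (M \<Otimes>\<^sub>M borel)"
    using D_joint A_joint by simp_all
  have "(\<lambda>z. ennreal (indicator {0..t} (snd z) * ((norm (D (max 0 (snd z)) (fst z)))\<^sup>2 * indicator {z. A (max 0 (snd z)) (fst z) < K} z)))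
      \<in> borel_measurable (M \<Otimes>\<^sub>M lborel)" by measurable
  then have fm: "(\<lambda>(\<omega>, s). ennreal (?f \<omega> s)) \<in> borel_measurable (M \<Otimes>\<^sub>M lborel)"
    by (simp add: case_prod_unfold indicator_def)
  have "(\<integral>\<^sup>+\<omega>. ennreal (min K (A t \<omega>)) \<partial>M) \<le> (\<integral>\<^sup>+\<omega>. (\<integral>\<^sup>+s. ennreal (?f \<omega> s) \<partial>lborel) \<partial>M)"
  proof (rule nn_integral_mono)
    fix \<omega> assume w: "\<omega> \<in> space M"
    have "ennreal (min K (A t \<omega>)) \<le> ennreal (\<integral>s. ?f \<omega> s \<partial>lborel)"
      using min_A_le[OF w assms(1,2)] by (intro ennreal_leI) (simp add: set_lebesgue_integral_def)
    also have "\<dots> \<le> (\<integral>\<^sup>+s. ennreal (?f \<omega> s) \<partial>lborel)"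
      by (rule ennreal_integral_le_nn_integral) simp
    finally show "ennreal (min K (A t \<omega>)) \<le> (\<integral>\<^sup>+s. ennreal (?f \<omega> s) \<partial>lborel)" .
  qed
  also have "\<dots> = (\<integral>\<^sup>+s. (\<integral>\<^sup>+\<omega>. ennreal (?f \<omega> s) \<partial>M) \<partial>lborel)" by (rule Fubini'[OF fm, symmetric])
  also have "\<dots> \<le> (\<integral>\<^sup>+s. (2 * localized_moment K s + ennreal (2 * C\<^sup>2)) * indicator {0..t} s \<partial>lborel)"
  proof (rule nn_integral_mono)
    fix s :: real
    show "(\<integral>\<^sup>+\<omega>. ennreal (?f \<omega> s) \<partial>M) \<le> (2 * localized_moment K s + ennreal (2 * C\<^sup>2)) * indicator {0..t} s"
    proof (cases "s \<in> {0..t}")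
      case True
      then have s: "0 \<le> s" "s \<le> t" "max 0 s = s" by auto
      have [measurable]: "X s \<in> borel_measurable M" using X_measurable s by simp
      have "(\<integral>\<^sup>+\<omega>. ennreal (?f \<omega> s) \<partial>M)
          \<le> (\<integral>\<^sup>+\<omega>. 2 * (ennreal ((norm (X s \<omega>))\<^sup>2) * indicator {\<omega>. A s \<omega> < K} \<omega>) + ennreal (2 * C\<^sup>2) \<partial>M)"
      proof (rule nn_integral_mono)
        fix \<omega> assume w: "\<omega> \<in> space M"
        have "(norm ((1 - \<Lambda> s \<omega>) *\<^sub>R m s))\<^sup>2 \<le> (1 * C)\<^sup>2"
          unfolding norm_scaleR using \<Lambda>_range[OF s(1) w] C(1)[OF s(1,2)] by (intro power_mono mult_mono) auto
        then have "(norm (D s \<omega>))\<^sup>2 \<le> 2 * (norm (X s \<omega>))\<^sup>2 + 2 * C\<^sup>2"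
          unfolding D_eq[OF s(1)] by (intro order_trans[OF norm_square_diff_le]) simp
        then have "ennreal ((norm (D s \<omega>))\<^sup>2) \<le> ennreal (2 * (norm (X s \<omega>))\<^sup>2 + 2 * C\<^sup>2)" by (rule ennreal_leI)
        then have "ennreal ((norm (D s \<omega>))\<^sup>2) \<le> 2 * ennreal ((norm (X s \<omega>))\<^sup>2) + ennreal (2 * C\<^sup>2)"
          by (simp add: ennreal_mult ennreal_numeral[symmetric] del: ennreal_numeral)
        then show "ennreal (?f \<omega> s) \<le> 2 * (ennreal ((norm (X s \<omega>))\<^sup>2) * indicator {\<omega>. A s \<omega> < K} \<omega>) + ennreal (2 * C\<^sup>2)"
          using True s(3) by (simp add: indicator_def)
      qed
      also have "\<dots> = 2 * localized_moment K s + ennreal (2 * C\<^sup>2)"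
        unfolding localized_moment_def s(3) by (simp add: nn_integral_add nn_integral_cmult emeasure_space_1)
      finally show ?thesis using True by simp
    qed simp
  qed
  also have "\<dots> = (\<integral>\<^sup>+s. 2 * (localized_moment K s * indicator {0..t} s) + ennreal (2 * C\<^sup>2) * indicator {0..t} s \<partial>lborel)"
    by (intro nn_integral_cong) (simp add: distrib_right mult.assoc)
  also have "\<dots> = 2 * (\<integral>\<^sup>+s\<in>{0..t}. localized_moment K s \<partial>lborel) + ennreal (2 * C\<^sup>2) * ennreal t"
    using assms(1) by (simp add: nn_integral_add nn_integral_cmult nn_integral_cmult_indicator)
  finally show ?thesis using assms by (simp add: ennreal_mult)
qed

lemma second_moment_bounded:
  assumes "0 \<le> T"
  shows "\<exists>C\<ge>0. \<forall>t. 0 \<le> t \<and> t \<le> T \<longrightarrow> (\<integral>\<^sup>+\<omega>. ennreal ((norm (X t \<omega>))\<^sup>2) \<partial>M) \<le> ennreal C"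
proof -
  obtain C where C: "0 \<le> C" "\<And>t. 0 \<le> t \<Longrightarrow> t \<le> T \<Longrightarrow> norm (m t) \<le> C"
    using first_moment_bound[OF assms] by blast
  define n0 where "n0 = (\<integral>\<omega>. (norm (X 0 \<omega>))\<^sup>2 \<partial>M)"
  have n0: "0 \<le> n0" "(\<integral>\<^sup>+\<omega>. ennreal ((norm (X 0 \<omega>))\<^sup>2) \<partial>M) = ennreal n0"
    unfolding n0_def using initial by (auto intro: integral_nonneg_AE simp: nn_integral_eq_integral)
  define c1 where "c1 = 3 * T + 3 * (real CARD('d) * \<sigma>\<^sup>2)"
  have c1: "0 \<le> c1" using assms by (simp add: c1_def)
  define a where "a = 3 * n0 + c1 * (2 * C\<^sup>2 * T)"
  \<comment> \<open>The summand 1 keeps \<open>b\<close> positive when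
    \<open>c1 = 0\<close>.\<close>
  define b where "b = 2 * c1 + 1"
  have ab: "0 \<le> a" "0 < b" using c1 n0 assms by (auto simp: a_def b_def)
  have main: "localized_moment K t \<le> ennreal (2 * a * exp (2 * b * T))" if K: "0 < K" and t: "0 \<le> t" "t \<le> T" for K t
  proof -
    have base: "localized_moment K s \<le> ennreal (3 * n0) + ennreal c1 * (\<integral>\<^sup>+\<omega>. ennreal (min K (A s \<omega>)) \<partial>M)" if "0 \<le> s" "s \<le> T" for s
    proof -
      have "localized_moment K s \<le> 3 * ennreal n0 + ennreal c1 * (\<integral>\<^sup>+\<omega>. ennreal (min K (A s \<omega>)) \<partial>M)"
        using X_square_localized[OF that, of K] K that by (simp add: localized_moment_def c1_def n0(2) max_absorb2)
      then show ?thesis using n0 by (simp add: ennreal_mult)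
    qed
    have "localized_moment K t \<le> ennreal (2 * a * exp (2 * b * t))"
    proof (rule Gronwall_nn_integral[OF localized_moment_measurable ab(2,1) _ _ t])
      \<comment> \<open>Two bounds follow: a crude one depending on \<open>K\<close>, which supplies
        the finiteness assumed by Gronwall's lemma, and the integral inequality, whose constants do
        not involve \<open>K\<close>.\<close>
      fix s assume s: "0 \<le> s" "s \<le> T"
      have "(\<integral>\<^sup>+\<omega>. ennreal (min K (A s \<omega>)) \<partial>M) \<le> (\<integral>\<^sup>+\<omega>. ennreal K \<partial>M)"
        by (intro nn_integral_mono ennreal_leI) simp
      also have "\<dots> = ennreal K" by (simp add: emeasure_space_1)
      finally have "ennreal c1 * (\<integral>\<^sup>+\<omega>. ennreal (min K (A s \<omega>)) \<partial>M) \<le> ennreal c1 * ennreal K" by (intro mult_left_mono) auto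
      then have "localized_moment K s \<le> ennreal (3 * n0) + ennreal c1 * ennreal K"
        using base[OF s] by (meson add_left_mono order_trans)
      also have "\<dots> = ennreal (3 * n0 + c1 * K)" using n0 c1 K by (simp add: ennreal_mult)
      finally show "localized_moment K s \<le> ennreal (3 * n0 + c1 * K)" .
      have "(\<integral>\<^sup>+\<omega>. ennreal (min K (A s \<omega>)) \<partial>M) \<le> 2 * (\<integral>\<^sup>+r\<in>{0..s}. localized_moment K r \<partial>lborel) + ennreal (2 * C\<^sup>2 * s)"
        using s C by (intro min_A_expectation_le K) auto
      also have "\<dots> \<le> 2 * (\<integral>\<^sup>+r\<in>{0..s}. localized_moment K r \<partial>lborel) + ennreal (2 * C\<^sup>2 * T)"
        using s by (intro add_left_mono ennreal_leI mult_left_mono) auto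
      finally have "ennreal c1 * (\<integral>\<^sup>+\<omega>. ennreal (min K (A s \<omega>)) \<partial>M)
          \<le> ennreal c1 * (2 * (\<integral>\<^sup>+r\<in>{0..s}. localized_moment K r \<partial>lborel) + ennreal (2 * C\<^sup>2 * T))" by (intro mult_left_mono) auto
      then have "localized_moment K s \<le> ennreal (3 * n0) + ennreal c1 * (2 * (\<integral>\<^sup>+r\<in>{0..s}. localized_moment K r \<partial>lborel) + ennreal (2 * C\<^sup>2 * T))"
        using base[OF s] by (meson add_left_mono order_trans)
      also have "\<dots> = ennreal a + ennreal (2 * c1) * (\<integral>\<^sup>+r\<in>{0..s}. localized_moment K r \<partial>lborel)"
        using n0 c1 assms
        by (simp add: a_def ennreal_mult distrib_left ac_simps)
      also have "\<dots> \<le> ennreal a + ennreal b * (\<integral>\<^sup>+r\<in>{0..s}. localized_moment K r \<partial>lborel)"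
        by (intro add_left_mono mult_right_mono ennreal_leI) (auto simp: b_def)
      finally show "localized_moment K s \<le> ennreal a + ennreal b * (\<integral>\<^sup>+r\<in>{0..s}. localized_moment K r \<partial>lborel)" .
    qed
    also have "\<dots> \<le> ennreal (2 * a * exp (2 * b * T))"
      using ab t by (intro ennreal_leI mult_left_mono) auto
    finally show ?thesis .
  qed
  have "(\<integral>\<^sup>+\<omega>. ennreal ((norm (X t \<omega>))\<^sup>2) \<partial>M) \<le> ennreal (2 * a * exp (2 * b * T))" if t: "0 \<le> t" "t \<le> T" for t
  proof -
    have [measurable]: "X t \<in> borel_measurable M" using X_measurable t by simp
    let ?f = "\<lambda>k \<omega>. ennreal ((norm (X t \<omega>))\<^sup>2) * indicator {\<omega>. A t \<omega> < real (Suc k)} \<omega>"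
    have "(\<integral>\<^sup>+\<omega>. ennreal ((norm (X t \<omega>))\<^sup>2) \<partial>M) = (\<integral>\<^sup>+\<omega>. liminf (\<lambda>k. ?f k \<omega>) \<partial>M)"
    proof (rule nn_integral_cong)
      fix \<omega>
      obtain N where "A t \<omega> < real N" using reals_Archimedean2 by blast
      then have "\<forall>\<^sub>F k in sequentially. ?f k \<omega> = ennreal ((norm (X t \<omega>))\<^sup>2)"
        by (intro eventually_sequentiallyI[of N]) (auto simp: indicator_def)
      then have "(\<lambda>k. ?f k \<omega>) \<longlonglongrightarrow> ennreal ((norm (X t \<omega>))\<^sup>2)" by (rule tendsto_eventually)
      from lim_imp_Liminf[OF trivial_limit_sequentially this]
      show "ennreal ((norm (X t \<omega>))\<^sup>2) = liminf (\<lambda>k. ?f k \<omega>)" by simp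
    qed
    also have "\<dots> \<le> liminf (\<lambda>k. \<integral>\<^sup>+\<omega>. ?f k \<omega> \<partial>M)" by (rule nn_integral_liminf) measurable
    also have "\<dots> \<le> liminf (\<lambda>k::nat. ennreal (2 * a * exp (2 * b * T)))"
    proof (intro Liminf_mono always_eventually allI)
      fix k
      show "(\<integral>\<^sup>+\<omega>. ?f k \<omega> \<partial>M) \<le> ennreal (2 * a * exp (2 * b * T))"
        using main[of "real (Suc k)" t] t unfolding localized_moment_def by (simp add: max_absorb2)
    qed
    also have "\<dots> = ennreal (2 * a * exp (2 * b * T))" by (simp add: Liminf_const)
    finally show ?thesis .
  qed
  then show ?thesis using ab by (intro exI[of _ "2 * a * exp (2 * b * T)"]) auto
qed

end

section \<open>The Lyapunov function\<close>

lemma set_integral_Icc_combine: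
  fixes f :: "real \<Rightarrow> 'b::euclidean_space"
  assumes "a \<le> b" "b \<le> c" and f: "set_integrable lborel {a..c} f"
  shows "(LINT s:{a..c}|lborel. f s) = (LINT s:{a..b}|lborel. f s) + (LINT s:{b..c}|lborel. f s)"
proof -
  have int: "set_integrable lborel {a..b} f" "set_integrable lborel {b..c} f"
    by (rule set_integrable_subset[OF f]; use assms in auto)+
  show ?thesis
    using set_borel_integral_eq_integral(2)[OF int(1)] set_borel_integral_eq_integral(2)[OF int(2)]
      set_borel_integral_eq_integral[OF f] Henstock_Kurzweil_Integration.integral_combine[OF assms(1,2), of f]
    by simp
qed

lemma set_integral_mono_Icc:
  fixes f g :: "real \<Rightarrow> real"
  assumes "set_integrable lborel {a..b} f" "set_integrable lborel {a..b} g" "\<And>s. s \<in> {a..b} \<Longrightarrow> f s \<le> g s"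
  shows "(LINT s:{a..b}|lborel. f s) \<le> (LINT s:{a..b}|lborel. g s)"
  unfolding set_lebesgue_integral_def
  by (rule integral_mono) (use assms in \<open>auto simp: set_integrable_def indicator_def\<close>)

lemma set_integral_const_Icc: "a \<le> b \<Longrightarrow> (LINT s:{a..b}|lborel. (c::real)) = (b - a) * c"
  by (simp add: set_lebesgue_integral_def)

text \<open>Young's inequality. The weight will be \<open>sqrt (t - s)\<close> to balance orders of
  magnitude and \<open>(2 - c) / 2\<close> to save half of the dissipation.\<close>

lemma inner_le_weighted:
  fixes x y :: "'b::real_inner"
  assumes "0 < e"
  shows "2 * \<bar>x \<bullet> y\<bar> \<le> (norm x)\<^sup>2 / e + e * (norm y)\<^sup>2"
proof -
  have "2 * (norm x * norm y) \<le> (norm x)\<^sup>2 / e + e * (norm y)\<^sup>2"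
  proof -
    have "0 \<le> (norm x - e * norm y)\<^sup>2 / e" using assms by simp
    also have "(norm x - e * norm y)\<^sup>2 / e = (norm x)\<^sup>2 / e + e * (norm y)\<^sup>2 - 2 * (norm x * norm y)"
      using assms by (simp add: power2_eq_square field_simps)
    finally show ?thesis by simp
  qed
  then show ?thesis using Cauchy_Schwarz_ineq2[of x y] by linarith
qed

lemma norm_le_one_plus_square: "norm x \<le> 1 + (norm x)\<^sup>2"
proof -
  have "0 \<le> (norm x - 1)\<^sup>2" by simp
  then have "2 * norm x \<le> (norm x)\<^sup>2 + 1" by (simp add: power2_diff)
  then show ?thesis using norm_ge_zero[of x] by linarith
qed

context mean_field_process begin

definition V :: "real \<Rightarrow> real" where "V t = (\<integral>\<omega>. (norm (X t \<omega>))\<^sup>2 \<partial>M)"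
definition ell :: "real \<Rightarrow> real" where "ell t = (\<integral>\<omega>. \<Lambda> t \<omega> \<partial>M)"
definition p :: "real \<Rightarrow> real" where "p t = (norm (m t))\<^sup>2"
definition c :: real where "c = real CARD('d) * \<sigma>\<^sup>2"

lemma X_square_integrable:
  assumes "0 \<le> t" shows "integrable M (\<lambda>\<omega>. (norm (X t \<omega>))\<^sup>2)"
proof -
  obtain C where "(\<integral>\<^sup>+\<omega>. ennreal ((norm (X t \<omega>))\<^sup>2) \<partial>M) \<le> ennreal C"
    using second_moment_bounded[OF assms] assms by blast
  then have "(\<integral>\<^sup>+\<omega>. ennreal ((norm (X t \<omega>))\<^sup>2) \<partial>M) < \<infinity>"
    using le_less_trans[OF _ ennreal_less_top] by simp
  then show ?thesis using X_measurable[OF assms] by (intro integrableI_nonneg) auto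
qed

lemma V_bound:
  assumes "0 \<le> T"
  shows "\<exists>C\<ge>0. \<forall>t. 0 \<le> t \<and> t \<le> T \<longrightarrow> V t \<le> C"
proof -
  obtain C where C: "0 \<le> C" "\<And>t. 0 \<le> t \<Longrightarrow> t \<le> T \<Longrightarrow> (\<integral>\<^sup>+\<omega>. ennreal ((norm (X t \<omega>))\<^sup>2) \<partial>M) \<le> ennreal C"
    using second_moment_bounded[OF assms] by blast
  have "V t \<le> C" if "0 \<le> t" "t \<le> T" for t
    using C(2)[OF that] X_square_integrable[OF that(1)] C(1)
    by (simp add: V_def nn_integral_eq_integral)
  then show ?thesis using C(1) by blast
qed

lemma D_norm_square_le:
  assumes "0 \<le> t" "\<omega> \<in> space M"
  shows "(norm (D t \<omega>))\<^sup>2 \<le> 2 * (norm (X t \<omega>))\<^sup>2 + 2 * (norm (m t))\<^sup>2"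
proof -
  have "(norm ((1 - \<Lambda> t \<omega>) *\<^sub>R m t))\<^sup>2 \<le> (1 * norm (m t))\<^sup>2"
    unfolding norm_scaleR using \<Lambda>_range[OF assms] by (intro power_mono mult_right_mono) auto
  then show ?thesis unfolding D_eq[OF assms(1)] by (intro order_trans[OF norm_square_diff_le]) simp
qed

lemma D_square_integrable:
  assumes "0 \<le> t" shows "integrable M (\<lambda>\<omega>. (norm (D t \<omega>))\<^sup>2)"
proof (rule Bochner_Integration.integrable_bound)
  show "integrable M (\<lambda>\<omega>. 2 * (norm (X t \<omega>))\<^sup>2 + 2 * (norm (m t))\<^sup>2)" using X_square_integrable[OF assms] by simp
  show "AE \<omega> in M. norm ((norm (D t \<omega>))\<^sup>2) \<le> norm (2 * (norm (X t \<omega>))\<^sup>2 + 2 * (norm (m t))\<^sup>2)"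
    using D_norm_square_le[OF assms] by (intro AE_I2) simp
qed (use D_measurable[OF assms] in auto)

lemma D_bound:
  assumes "0 \<le> T"
  shows "\<exists>C\<ge>0. \<forall>t. 0 \<le> t \<and> t \<le> T \<longrightarrow> (\<integral>\<omega>. (norm (D t \<omega>))\<^sup>2 \<partial>M) \<le> C \<and> V t \<le> C"
proof -
  obtain C where C: "0 \<le> C" "\<And>t. 0 \<le> t \<Longrightarrow> t \<le> T \<Longrightarrow> V t \<le> C" using V_bound[OF assms] by blast
  obtain C' where C': "0 \<le> C'" "\<And>t. 0 \<le> t \<Longrightarrow> t \<le> T \<Longrightarrow> norm (m t) \<le> C'" using first_moment_bound[OF assms] by blast
  have "(\<integral>\<omega>. (norm (D t \<omega>))\<^sup>2 \<partial>M) \<le> 2 * C + 2 * C'\<^sup>2 \<and> V t \<le> 2 * C + 2 * C'\<^sup>2" if t: "0 \<le> t" "t \<le> T" for t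
  proof -
    have "(\<integral>\<omega>. (norm (D t \<omega>))\<^sup>2 \<partial>M) \<le> (\<integral>\<omega>. 2 * (norm (X t \<omega>))\<^sup>2 + 2 * (norm (m t))\<^sup>2 \<partial>M)"
      using D_norm_square_le[OF t(1)] D_square_integrable[OF t(1)] X_square_integrable[OF t(1)]
      by (intro integral_mono) auto
    also have "\<dots> = 2 * V t + 2 * (norm (m t))\<^sup>2" using X_square_integrable[OF t(1)] by (simp add: V_def prob_space)
    finally have "(\<integral>\<omega>. (norm (D t \<omega>))\<^sup>2 \<partial>M) \<le> 2 * V t + 2 * (norm (m t))\<^sup>2" .
    also have "\<dots> \<le> 2 * C + 2 * C'\<^sup>2" using C(2)[OF t] C'(2)[OF t] by (intro add_mono mult_left_mono power_mono) auto
    finally have "(\<integral>\<omega>. (norm (D t \<omega>))\<^sup>2 \<partial>M) \<le> 2 * C + 2 * C'\<^sup>2" .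
    moreover have "V t \<le> 2 * C + 2 * C'\<^sup>2" using C(2)[OF t] C(1) zero_le_power2[of C'] by linarith
    ultimately show ?thesis by simp
  qed
  then show ?thesis using C(1) by (intro exI[of _ "2 * C + 2 * C'\<^sup>2"]) auto
qed

lemma nn_integral_norm_le:
  fixes f :: "'w \<Rightarrow> 'b::{banach, second_countable_topology}"
  assumes "integrable M f" "(\<integral>\<omega>. norm (f \<omega>) \<partial>M) \<le> C"
  shows "(\<integral>\<^sup>+\<omega>. ennreal (norm (f \<omega>)) \<partial>M) \<le> ennreal C"
  using assms by (simp add: nn_integral_eq_integral ennreal_leI)

lemma D_integrable:
  assumes "0 \<le> t" shows "integrable M (D t)"
proof (rule Bochner_Integration.integrable_bound)
  show "integrable M (\<lambda>\<omega>. 1 + (norm (D t \<omega>))\<^sup>2)" using D_square_integrable[OF assms] by simp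
  show "AE \<omega> in M. norm (D t \<omega>) \<le> norm (1 + (norm (D t \<omega>))\<^sup>2)"
    by (intro AE_I2 order_trans[OF norm_le_one_plus_square]) simp
qed (rule D_measurable[OF assms])

lemma D_Fubini:
  assumes "0 \<le> a"
  shows "integrable M (\<lambda>\<omega>. LINT s:{a..b}|lborel. D (max 0 s) \<omega>)"
    "(\<integral>\<omega>. (LINT s:{a..b}|lborel. D (max 0 s) \<omega>) \<partial>M) = (LINT s:{a..b}|lborel. (\<integral>\<omega>. D (max 0 s) \<omega> \<partial>M))"
    "integrable M (\<lambda>\<omega>. LINT s:{a..b}|lborel. (norm (D (max 0 s) \<omega>))\<^sup>2)"
    "(\<integral>\<omega>. (LINT s:{a..b}|lborel. (norm (D (max 0 s) \<omega>))\<^sup>2) \<partial>M) = (LINT s:{a..b}|lborel. (\<integral>\<omega>. (norm (D (max 0 s) \<omega>))\<^sup>2 \<partial>M))"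
    "set_integrable lborel {a..b} (\<lambda>s. \<integral>\<omega>. (norm (D (max 0 s) \<omega>))\<^sup>2 \<partial>M)"
proof -
  obtain C where C: "0 \<le> C" "\<And>t. 0 \<le> t \<Longrightarrow> t \<le> \<bar>b\<bar> \<Longrightarrow> (\<integral>\<omega>. (norm (D t \<omega>))\<^sup>2 \<partial>M) \<le> C"
    using D_bound[of "\<bar>b\<bar>"] by (meson abs_ge_zero)
  have sq: "(\<lambda>z. (norm (D (max 0 (snd z)) (fst z)))\<^sup>2) \<in> borel_measurable (M \<Otimes>\<^sub>M lborel)"
    by (rule measurable_compose[OF D_joint, of "\<lambda>x. (norm x)\<^sup>2"]) measurable
  have b1: "(\<integral>\<^sup>+\<omega>. ennreal (norm (D (max 0 s) \<omega>)) \<partial>M) \<le> ennreal (1 + C)" if "s \<in> {a..b}" for s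
  proof (rule nn_integral_norm_le[OF D_integrable])
    have "(\<integral>\<omega>. norm (D (max 0 s) \<omega>) \<partial>M) \<le> (\<integral>\<omega>. 1 + (norm (D (max 0 s) \<omega>))\<^sup>2 \<partial>M)"
      by (intro integral_mono integrable_norm D_integrable Bochner_Integration.integrable_add integrable_const
          D_square_integrable norm_le_one_plus_square) simp_all
    also have "\<dots> \<le> 1 + C" using C(2)[of "max 0 s"] that assms by (simp add: D_square_integrable prob_space)
    finally show "(\<integral>\<omega>. norm (D (max 0 s) \<omega>) \<partial>M) \<le> 1 + C" .
  qed simp
  have b2: "(\<integral>\<^sup>+\<omega>. ennreal (norm ((norm (D (max 0 s) \<omega>))\<^sup>2)) \<partial>M) \<le> ennreal C" if "s \<in> {a..b}" for s
    by (rule nn_integral_norm_le) (use C(2)[of "max 0 s"] that assms in \<open>auto simp: D_square_integrable\<close>)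
  note F1 = Fubini_time[OF D_joint, of a b "1 + C", unfolded fst_conv snd_conv, OF b1]
  note F2 = Fubini_time[OF sq, of a b C, unfolded fst_conv snd_conv, OF b2]
  show "integrable M (\<lambda>\<omega>. LINT s:{a..b}|lborel. D (max 0 s) \<omega>)"
    "(\<integral>\<omega>. (LINT s:{a..b}|lborel. D (max 0 s) \<omega>) \<partial>M) = (LINT s:{a..b}|lborel. (\<integral>\<omega>. D (max 0 s) \<omega> \<partial>M))"
    using F1 by auto
  show "integrable M (\<lambda>\<omega>. LINT s:{a..b}|lborel. (norm (D (max 0 s) \<omega>))\<^sup>2)"
    "(\<integral>\<omega>. (LINT s:{a..b}|lborel. (norm (D (max 0 s) \<omega>))\<^sup>2) \<partial>M) = (LINT s:{a..b}|lborel. (\<integral>\<omega>. (norm (D (max 0 s) \<omega>))\<^sup>2 \<partial>M))"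
    "set_integrable lborel {a..b} (\<lambda>s. \<integral>\<omega>. (norm (D (max 0 s) \<omega>))\<^sup>2 \<partial>M)"
    using F2 by auto
qed

lemma energy_integrable: "0 \<le> t \<Longrightarrow> integrable M (energy t)"
  using D_Fubini(3)[of 0 t] by (simp add: energy_eq[abs_def] A_def)

lemma J_increment_square:
  assumes "0 \<le> s" "s \<le> t"
  shows "has_bochner_integral M (\<lambda>\<omega>. (norm (J t \<omega> - J s \<omega>))\<^sup>2)
    (c * (LINT r:{s..t}|lborel. (\<integral>\<omega>. (norm (D (max 0 r) \<omega>))\<^sup>2 \<partial>M)))"
proof -
  have e: "(\<integral>\<omega>. energy r \<omega> \<partial>M) = \<sigma>\<^sup>2 * (LINT r:{0..r}|lborel. (\<integral>\<omega>. (norm (D (max 0 r) \<omega>))\<^sup>2 \<partial>M))" for r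
    using D_Fubini(4)[of 0 r] by (simp add: energy_eq A_def)
  have "(LINT r:{0..t}|lborel. (\<integral>\<omega>. (norm (D (max 0 r) \<omega>))\<^sup>2 \<partial>M)) = (LINT r:{0..s}|lborel. (\<integral>\<omega>. (norm (D (max 0 r) \<omega>))\<^sup>2 \<partial>M))
      + (LINT r:{s..t}|lborel. (\<integral>\<omega>. (norm (D (max 0 r) \<omega>))\<^sup>2 \<partial>M))"
    by (rule set_integral_Icc_combine[OF assms D_Fubini(5)]) simp
  then have "real CARD('d) * ((\<integral>\<omega>. energy t \<omega> \<partial>M) - (\<integral>\<omega>. energy s \<omega> \<partial>M))
      = c * (LINT r:{s..t}|lborel. (\<integral>\<omega>. (norm (D (max 0 r) \<omega>))\<^sup>2 \<partial>M))"
    unfolding e c_def by (simp add: algebra_simps)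
  then show ?thesis using ito_isometry[OF assms energy_integrable energy_integrable] assms by simp
qed

definition I :: "real \<Rightarrow> real \<Rightarrow> 'w \<Rightarrow> real^'d" where "I s t \<omega> = (LINT r:{s..t}|lborel. D (max 0 r) \<omega>)"

lemma I_measurable: "0 \<le> s \<Longrightarrow> I s t \<in> borel_measurable M"
  using D_Fubini(1)[of s t] by (auto simp: I_def[abs_def])

lemma I_square:
  assumes "0 \<le> s" "s \<le> t"
  shows "integrable M (\<lambda>\<omega>. (norm (I s t \<omega>))\<^sup>2)"
    "(\<integral>\<omega>. (norm (I s t \<omega>))\<^sup>2 \<partial>M) \<le> (t - s) * (LINT r:{s..t}|lborel. (\<integral>\<omega>. (norm (D (max 0 r) \<omega>))\<^sup>2 \<partial>M))"
proof -
  have le: "(norm (I s t \<omega>))\<^sup>2 \<le> (t - s) * (LINT r:{s..t}|lborel. (norm (D (max 0 r) \<omega>))\<^sup>2)" if "\<omega> \<in> space M" for \<omega>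
    unfolding I_def by (rule norm_set_integral_square_le[OF D_path_integrable[OF that assms(1)] assms(2)])
  have int: "integrable M (\<lambda>\<omega>. (t - s) * (LINT r:{s..t}|lborel. (norm (D (max 0 r) \<omega>))\<^sup>2))"
    using D_Fubini(3)[OF assms(1)] by simp
  show i: "integrable M (\<lambda>\<omega>. (norm (I s t \<omega>))\<^sup>2)"
  proof (rule Bochner_Integration.integrable_bound[OF int])
    show "AE \<omega> in M. norm ((norm (I s t \<omega>))\<^sup>2) \<le> norm ((t - s) * (LINT r:{s..t}|lborel. (norm (D (max 0 r) \<omega>))\<^sup>2))"
      using le by (intro AE_I2) (simp add: order_trans[OF _ abs_ge_self])
  qed (use I_measurable[OF assms(1), of t] in measurable)
  have "(\<integral>\<omega>. (norm (I s t \<omega>))\<^sup>2 \<partial>M) \<le> (\<integral>\<omega>. (t - s) * (LINT r:{s..t}|lborel. (norm (D (max 0 r) \<omega>))\<^sup>2) \<partial>M)"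
    by (rule integral_mono[OF i int le])
  then show "(\<integral>\<omega>. (norm (I s t \<omega>))\<^sup>2 \<partial>M) \<le> (t - s) * (LINT r:{s..t}|lborel. (\<integral>\<omega>. (norm (D (max 0 r) \<omega>))\<^sup>2 \<partial>M))"
    using D_Fubini(4)[OF assms(1), of t] by simp
qed

lemma inner_integrable:
  fixes f g :: "'w \<Rightarrow> real^'d"
  assumes f: "f \<in> borel_measurable M" "integrable M (\<lambda>\<omega>. (norm (f \<omega>))\<^sup>2)"
    and g: "g \<in> borel_measurable M" "integrable M (\<lambda>\<omega>. (norm (g \<omega>))\<^sup>2)"
  shows "integrable M (\<lambda>\<omega>. f \<omega> \<bullet> g \<omega>)"
    "0 < e \<Longrightarrow> 2 * \<bar>\<integral>\<omega>. f \<omega> \<bullet> g \<omega> \<partial>M\<bar> \<le> (\<integral>\<omega>. (norm (f \<omega>))\<^sup>2 \<partial>M) / e + e * (\<integral>\<omega>. (norm (g \<omega>))\<^sup>2 \<partial>M)"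
proof -
  show i: "integrable M (\<lambda>\<omega>. f \<omega> \<bullet> g \<omega>)"
  proof (rule Bochner_Integration.integrable_bound)
    show "integrable M (\<lambda>\<omega>. (norm (f \<omega>))\<^sup>2 + (norm (g \<omega>))\<^sup>2)" using f g by simp
    have "\<bar>f \<omega> \<bullet> g \<omega>\<bar> \<le> (norm (f \<omega>))\<^sup>2 + (norm (g \<omega>))\<^sup>2" for \<omega>
      using inner_le_weighted[of 1 "f \<omega>" "g \<omega>"] by simp
    then show "AE \<omega> in M. norm (f \<omega> \<bullet> g \<omega>) \<le> norm ((norm (f \<omega>))\<^sup>2 + (norm (g \<omega>))\<^sup>2)" by (intro AE_I2) simp
  qed (use f g in measurable)
  assume e: "0 < e"
  have "2 * \<bar>\<integral>\<omega>. f \<omega> \<bullet> g \<omega> \<partial>M\<bar> \<le> 2 * (\<integral>\<omega>. \<bar>f \<omega> \<bullet> g \<omega>\<bar> \<partial>M)" by (intro mult_left_mono integral_abs_bound) simp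
  also have "\<dots> = (\<integral>\<omega>. 2 * \<bar>f \<omega> \<bullet> g \<omega>\<bar> \<partial>M)" by simp
  also have "\<dots> \<le> (\<integral>\<omega>. (norm (f \<omega>))\<^sup>2 / e + e * (norm (g \<omega>))\<^sup>2 \<partial>M)"
    using inner_le_weighted[OF e] i f g by (intro integral_mono) auto
  also have "\<dots> = (\<integral>\<omega>. (norm (f \<omega>))\<^sup>2 \<partial>M) / e + e * (\<integral>\<omega>. (norm (g \<omega>))\<^sup>2 \<partial>M)" using f g by simp
  finally show "2 * \<bar>\<integral>\<omega>. f \<omega> \<bullet> g \<omega> \<partial>M\<bar> \<le> (\<integral>\<omega>. (norm (f \<omega>))\<^sup>2 \<partial>M) / e + e * (\<integral>\<omega>. (norm (g \<omega>))\<^sup>2 \<partial>M)" .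
qed

lemma J_increment_measurable: "0 \<le> s \<Longrightarrow> s \<le> t \<Longrightarrow> (\<lambda>\<omega>. J t \<omega> - J s \<omega>) \<in> borel_measurable M"
  using J_measurable by (intro borel_measurable_diff) auto

text \<open>In powers of \<open>t - s\<close>, the noise has a second moment of order one and the
  drift of order two. The bound \<open>K\<close> on the second moment of \<open>D\<close> is taken
  over all of \<open>[0, T]\<close> so that the constants are uniform in \<open>s\<close> and
  \<open>t\<close>.\<close>

lemma increment_square_le:
  assumes st: "0 \<le> s" "s \<le> t" "t \<le> T" and K: "\<forall>r. 0 \<le> r \<and> r \<le> T \<longrightarrow> (\<integral>\<omega>. (norm (D r \<omega>))\<^sup>2 \<partial>M) \<le> K" "0 \<le> K"
  shows "(\<integral>\<omega>. (norm (J t \<omega> - J s \<omega>))\<^sup>2 \<partial>M) \<le> c * K * (t - s)"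
    "(\<integral>\<omega>. (norm (I s t \<omega>))\<^sup>2 \<partial>M) \<le> K * (t - s)\<^sup>2"
    "integrable M (\<lambda>\<omega>. (norm (X t \<omega> - X s \<omega>))\<^sup>2)"
    "(\<integral>\<omega>. (norm (X t \<omega> - X s \<omega>))\<^sup>2 \<partial>M) \<le> 2 * (c + T) * K * (t - s)"
proof -
  let ?k = "LINT r:{s..t}|lborel. (\<integral>\<omega>. (norm (D (max 0 r) \<omega>))\<^sup>2 \<partial>M)"
  have "?k \<le> (LINT r:{s..t}|lborel. K)"
    using st by (intro set_integral_mono_Icc D_Fubini(5) set_integrable_bounded_Icc[where C="K"]) (auto simp: K)
  then have k: "?k \<le> K * (t - s)" using st by (simp add: set_integral_const_Icc mult.commute)
  have c0: "0 \<le> c" by (simp add: c_def)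
  note N = J_increment_square[OF st(1,2)]
  show n: "(\<integral>\<omega>. (norm (J t \<omega> - J s \<omega>))\<^sup>2 \<partial>M) \<le> c * K * (t - s)"
    using N mult_left_mono[OF k c0] by (simp add: has_bochner_integral_iff mult.assoc)
  have "(t - s) * ?k \<le> (t - s) * (K * (t - s))" using k st by (intro mult_left_mono) auto
  then show i: "(\<integral>\<omega>. (norm (I s t \<omega>))\<^sup>2 \<partial>M) \<le> K * (t - s)\<^sup>2"
    using I_square(2)[OF st(1,2)] by (simp add: power2_eq_square ac_simps)
  have ae: "AE \<omega> in M. (norm (X t \<omega> - X s \<omega>))\<^sup>2 \<le> 2 * (norm (J t \<omega> - J s \<omega>))\<^sup>2 + 2 * (norm (I s t \<omega>))\<^sup>2"
    using increment_equation[OF st(1,2)]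
    by eventually_elim (simp only: I_def norm_square_diff_le)
  have bi: "integrable M (\<lambda>\<omega>. 2 * (norm (J t \<omega> - J s \<omega>))\<^sup>2 + 2 * (norm (I s t \<omega>))\<^sup>2)"
    using N I_square(1)[OF st(1,2)] by (simp add: has_bochner_integral_iff)
  have [measurable]: "X t \<in> borel_measurable M" "X s \<in> borel_measurable M" using X_measurable st by auto
  show xi: "integrable M (\<lambda>\<omega>. (norm (X t \<omega> - X s \<omega>))\<^sup>2)"
    by (rule Bochner_Integration.integrable_bound[OF bi]) (measurable, use ae in eventually_elim, simp)
  have "(\<integral>\<omega>. (norm (X t \<omega> - X s \<omega>))\<^sup>2 \<partial>M) \<le> (\<integral>\<omega>. 2 * (norm (J t \<omega> - J s \<omega>))\<^sup>2 + 2 * (norm (I s t \<omega>))\<^sup>2 \<partial>M)"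
    by (rule integral_mono_AE[OF xi bi ae])
  also have "\<dots> = 2 * (\<integral>\<omega>. (norm (J t \<omega> - J s \<omega>))\<^sup>2 \<partial>M) + 2 * (\<integral>\<omega>. (norm (I s t \<omega>))\<^sup>2 \<partial>M)"
    using N I_square(1)[OF st(1,2)] by (simp add: has_bochner_integral_iff)
  also have "\<dots> \<le> 2 * (c * K * (t - s)) + 2 * (K * (T * (t - s)))"
  proof -
    have "(t - s)\<^sup>2 \<le> T * (t - s)" unfolding power2_eq_square using st by (intro mult_right_mono) auto
    then have "K * (t - s)\<^sup>2 \<le> K * (T * (t - s))" using K(2) by (intro mult_left_mono)
    then show ?thesis using n i by linarith
  qed
  finally show "(\<integral>\<omega>. (norm (X t \<omega> - X s \<omega>))\<^sup>2 \<partial>M) \<le> 2 * (c + T) * K * (t - s)" by (simp add: algebra_simps)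
qed

text \<open>The derivative of \<open>V\<close> predicted by Ito's formula: quadratic variation of
  the noise plus twice the pairing of \<open>X\<close> with its drift \<open>- D\<close>.\<close>

definition V_rate :: "real \<Rightarrow> real" where "V_rate r = c * (\<integral>\<omega>. (norm (D r \<omega>))\<^sup>2 \<partial>M) - 2 * (\<integral>\<omega>. X r \<omega> \<bullet> D r \<omega> \<partial>M)"

text \<open>\<open>Z\<close> will be either \<open>X\<close> or the process frozen at
  \<open>X s\<close>.\<close>

lemma Z_D_Fubini:
  assumes "0 \<le> a" and Z: "\<And>r. 0 \<le> r \<Longrightarrow> Z r \<in> borel_measurable M" "continuous_paths M Z"
    and Z2: "\<And>r. 0 \<le> r \<Longrightarrow> r \<le> \<bar>b\<bar> \<Longrightarrow> integrable M (\<lambda>\<omega>. (norm (Z r \<omega>))\<^sup>2) \<and> (\<integral>\<omega>. (norm (Z r \<omega>))\<^sup>2 \<partial>M) \<le> K"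
  shows "(\<integral>\<omega>. (LINT s:{a..b}|lborel. Z (max 0 s) \<omega> \<bullet> D (max 0 s) \<omega>) \<partial>M) = (LINT s:{a..b}|lborel. (\<integral>\<omega>. Z (max 0 s) \<omega> \<bullet> D (max 0 s) \<omega> \<partial>M))"
    "set_integrable lborel {a..b} (\<lambda>s. \<integral>\<omega>. Z (max 0 s) \<omega> \<bullet> D (max 0 s) \<omega> \<partial>M)"
proof -
  obtain C where C: "0 \<le> C" "\<And>t. 0 \<le> t \<Longrightarrow> t \<le> \<bar>b\<bar> \<Longrightarrow> (\<integral>\<omega>. (norm (D t \<omega>))\<^sup>2 \<partial>M) \<le> C"
    using D_bound[of "\<bar>b\<bar>"] by (meson abs_ge_zero)
  have Zj: "(\<lambda>z. Z (max 0 (snd z)) (fst z)) \<in> borel_measurable (M \<Otimes>\<^sub>M lborel)"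
    by (rule continuous_paths_jointly_measurable[OF Z])
  have j: "(\<lambda>z. Z (max 0 (snd z)) (fst z) \<bullet> D (max 0 (snd z)) (fst z)) \<in> borel_measurable (M \<Otimes>\<^sub>M lborel)"
    by (rule borel_measurable_inner[OF Zj D_joint])
  have b: "(\<integral>\<^sup>+\<omega>. ennreal (norm (Z (max 0 s) \<omega> \<bullet> D (max 0 s) \<omega>)) \<partial>M) \<le> ennreal (K + C)" if "s \<in> {a..b}" for s
  proof -
    have s: "0 \<le> s" "s \<le> \<bar>b\<bar>" "max 0 s = s" using that assms(1) by auto
    note i = inner_integrable(1)[OF Z(1)[OF s(1)] conjunct1[OF Z2[OF s(1,2)]] D_measurable[OF s(1)] D_square_integrable[OF s(1)]]
    show ?thesis unfolding s(3)
    proof (rule nn_integral_norm_le[OF i])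
      have "(\<integral>\<omega>. norm (Z s \<omega> \<bullet> D s \<omega>) \<partial>M) \<le> (\<integral>\<omega>. (norm (Z s \<omega>))\<^sup>2 + (norm (D s \<omega>))\<^sup>2 \<partial>M)"
      proof (rule integral_mono)
        show "norm (Z s \<omega> \<bullet> D s \<omega>) \<le> (norm (Z s \<omega>))\<^sup>2 + (norm (D s \<omega>))\<^sup>2" for \<omega>
          using inner_le_weighted[of 1 "Z s \<omega>" "D s \<omega>"] by simp
      qed (use i Z2[OF s(1,2)] D_square_integrable[OF s(1)] in auto)
      also have "\<dots> = (\<integral>\<omega>. (norm (Z s \<omega>))\<^sup>2 \<partial>M) + (\<integral>\<omega>. (norm (D s \<omega>))\<^sup>2 \<partial>M)"
        using Z2[OF s(1,2)] D_square_integrable[OF s(1)] by simp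
      also have "\<dots> \<le> K + C" using Z2[OF s(1,2)] C(2)[OF s(1,2)] by simp
      finally show "(\<integral>\<omega>. norm (Z s \<omega> \<bullet> D s \<omega>) \<partial>M) \<le> K + C" .
    qed
  qed
  note F = Fubini_time[OF j, of a b "K + C", unfolded fst_conv snd_conv, OF b]
  show "(\<integral>\<omega>. (LINT s:{a..b}|lborel. Z (max 0 s) \<omega> \<bullet> D (max 0 s) \<omega>) \<partial>M) = (LINT s:{a..b}|lborel. (\<integral>\<omega>. Z (max 0 s) \<omega> \<bullet> D (max 0 s) \<omega> \<partial>M))"
    "set_integrable lborel {a..b} (\<lambda>s. \<integral>\<omega>. Z (max 0 s) \<omega> \<bullet> D (max 0 s) \<omega> \<partial>M)"
    using F by auto
qed

lemma XD_integrable: "0 \<le> r \<Longrightarrow> integrable M (\<lambda>\<omega>. X r \<omega> \<bullet> D r \<omega>)"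
  by (intro inner_integrable(1) X_measurable X_square_integrable D_measurable D_square_integrable)

lemma V_rate_set_integrable:
  assumes "0 \<le> a" shows "set_integrable lborel {a..b} (\<lambda>r. V_rate (max 0 r))"
    "set_integrable lborel {a..b} (\<lambda>r. \<integral>\<omega>. X (max 0 r) \<omega> \<bullet> D (max 0 r) \<omega> \<partial>M)"
proof -
  obtain C where C: "\<And>t. 0 \<le> t \<Longrightarrow> t \<le> \<bar>b\<bar> \<Longrightarrow> V t \<le> C" using V_bound[of "\<bar>b\<bar>"] by (meson abs_ge_zero)
  show h: "set_integrable lborel {a..b} (\<lambda>r. \<integral>\<omega>. X (max 0 r) \<omega> \<bullet> D (max 0 r) \<omega> \<partial>M)"
    by (rule Z_D_Fubini(2)[OF assms X_measurable continuous(1), where K=C])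
       (use C in \<open>auto simp: X_square_integrable V_def\<close>)
  show "set_integrable lborel {a..b} (\<lambda>r. V_rate (max 0 r))"
    unfolding V_rate_def by (intro set_integral_diff(1) set_integrable_mult_right D_Fubini(5) h assms)
qed

text \<open>Write \<open>X t\<close> as \<open>X s\<close> plus noise \<open>?N\<close> minus drift
  \<open>?I\<close> and expand the square. The pairing of \<open>X s\<close> with \<open>?N\<close>
  has mean zero, and the second moment of \<open>?N\<close> is exactly the noise part of
  \<open>V_rate\<close>. What remains are errors: the square of \<open>?I\<close>, the mixed term of
  \<open>?N\<close> and \<open>?I\<close>, and the replacement of \<open>X s\<close> by
  \<open>X r\<close> inside the drift; all are at most of order 3/2 in \<open>t - s\<close>.\<close>

lemma V_increment:
  assumes "0 \<le> T"
  shows "\<exists>C. \<forall>s t. 0 \<le> s \<and> s \<le> t \<and> t \<le> T \<longrightarrow>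
    V t - V s \<le> (LINT r:{s..t}|lborel. V_rate (max 0 r)) + C * ((t - s) * sqrt (t - s))"
proof -
  obtain K where K: "0 \<le> K" "\<And>t. 0 \<le> t \<Longrightarrow> t \<le> T \<Longrightarrow> (\<integral>\<omega>. (norm (D t \<omega>))\<^sup>2 \<partial>M) \<le> K" "\<And>t. 0 \<le> t \<Longrightarrow> t \<le> T \<Longrightarrow> V t \<le> K"
    using D_bound[OF assms] by blast
  have Kall: "\<forall>r. 0 \<le> r \<and> r \<le> T \<longrightarrow> (\<integral>\<omega>. (norm (D r \<omega>))\<^sup>2 \<partial>M) \<le> K" using K(2) by blast
  have c0: "0 \<le> c" by (simp add: c_def)
  \<comment> \<open>One summand per error: freezing \<open>X\<close> at time \<open>s\<close>, the
    mixed term, and the squared drift.\<close>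
  define C where "C = (2 * (c + T) * K + K) + (c * K + K) + K * sqrt T"
  have "V t - V s \<le> (LINT r:{s..t}|lborel. V_rate (max 0 r)) + C * ((t - s) * sqrt (t - s))"
    if st: "0 \<le> s" "s \<le> t" "t \<le> T" for s t
  \<comment> \<open>For \<open>s = t\<close> the weight \<open>e\<close> used below would be
    zero.\<close>
  proof (cases "s = t")
    case True
    have "(LINT r:{t..t}|lborel. V_rate (max 0 r)) = 0"
      using set_borel_integral_eq_integral(2)[OF V_rate_set_integrable(1), of t t] st by simp
    then show ?thesis using True by simp
  next
    case False
    define \<delta> where "\<delta> = t - s"
    \<comment> \<open>With this weight both summands of Young's inequality have equal order:
      \<open>\<delta> / e\<close> and \<open>e\<close> when \<open>X\<close> is frozen,
      \<open>\<delta>\<^sup>2 / e\<close> and \<open>e * \<delta>\<close> in the mixed term.\<close>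
    define e where "e = sqrt \<delta>"
    have d: "0 < \<delta>" using False st by (simp add: \<delta>_def)
    have e: "0 < e" "e * e = \<delta>" "e \<le> sqrt T" using d st by (auto simp: e_def \<delta>_def)
    have de: "\<delta> / e = e" using e by (simp add: nonzero_divide_eq_eq)
    let ?N = "\<lambda>\<omega>. J t \<omega> - J s \<omega>" and ?I = "\<lambda>\<omega>. I s t \<omega>"
    note incr = increment_square_le[OF st Kall K(1)]
    have t0: "0 \<le> t" using st by simp
    have Xs: "X s \<in> borel_measurable M" "integrable M (\<lambda>\<omega>. (norm (X s \<omega>))\<^sup>2)"
      using X_measurable X_square_integrable st by auto
    have N: "?N \<in> borel_measurable M" "integrable M (\<lambda>\<omega>. (norm (?N \<omega>))\<^sup>2)"
      using J_increment_measurable[OF st(1,2)] J_increment_square[OF st(1,2)] by (auto simp: has_bochner_integral_iff)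
    have I: "?I \<in> borel_measurable M" "integrable M (\<lambda>\<omega>. (norm (?I \<omega>))\<^sup>2)"
      using I_measurable[OF st(1)] I_square(1)[OF st(1,2)] by auto
    have XN: "has_bochner_integral M (\<lambda>\<omega>. X s \<omega> \<bullet> ?N \<omega>) 0"
      by (rule ito_orthogonal[OF st(1,2) energy_integrable[OF t0] X_measurable_F[OF st(1)] Xs(2)])
    note XI = inner_integrable(1)[OF Xs I] and NI = inner_integrable[OF N I]
    have "V t = (\<integral>\<omega>. (norm (X s \<omega>))\<^sup>2 + (2 * (X s \<omega> \<bullet> ?N \<omega>) - 2 * (X s \<omega> \<bullet> ?I \<omega>) + ((norm (?N \<omega>))\<^sup>2 - 2 * (?N \<omega> \<bullet> ?I \<omega>) + (norm (?I \<omega>))\<^sup>2)) \<partial>M)"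
      unfolding V_def
    proof (rule integral_cong_AE)
      show "AE \<omega> in M. (norm (X t \<omega>))\<^sup>2 = (norm (X s \<omega>))\<^sup>2 + (2 * (X s \<omega> \<bullet> ?N \<omega>) - 2 * (X s \<omega> \<bullet> ?I \<omega>) + ((norm (?N \<omega>))\<^sup>2 - 2 * (?N \<omega> \<bullet> ?I \<omega>) + (norm (?I \<omega>))\<^sup>2))"
        using increment_equation[OF st(1,2)]
      proof eventually_elim
        case (elim \<omega>)
        have "X t \<omega> = X s \<omega> + (?N \<omega> - ?I \<omega>)" using elim unfolding I_def by (simp add: algebra_simps)
        then have "(norm (X t \<omega>))\<^sup>2 = (X s \<omega> + (?N \<omega> - ?I \<omega>)) \<bullet> (X s \<omega> + (?N \<omega> - ?I \<omega>))"
          by (simp only: power2_norm_eq_inner)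
        also have "\<dots> = (norm (X s \<omega>))\<^sup>2 + (2 * (X s \<omega> \<bullet> ?N \<omega>) - 2 * (X s \<omega> \<bullet> ?I \<omega>) + ((norm (?N \<omega>))\<^sup>2 - 2 * (?N \<omega> \<bullet> ?I \<omega>) + (norm (?I \<omega>))\<^sup>2))"
          unfolding power2_norm_eq_inner
          using inner_commute[of "X s \<omega>" "?N \<omega>"] inner_commute[of "X s \<omega>" "?I \<omega>"] inner_commute[of "?N \<omega>" "?I \<omega>"]
          by (simp only: inner_add_left inner_add_right inner_diff_left[of "?N \<omega>" "?I \<omega>"] inner_diff_right[of _ "?N \<omega>" "?I \<omega>"])
        finally show ?case .
      qed
    qed (use X_measurable[OF t0] Xs N I in measurable)
    also have "\<dots> = V s + (2 * 0 - 2 * (\<integral>\<omega>. X s \<omega> \<bullet> ?I \<omega> \<partial>M) + ((\<integral>\<omega>. (norm (?N \<omega>))\<^sup>2 \<partial>M) - 2 * (\<integral>\<omega>. ?N \<omega> \<bullet> ?I \<omega> \<partial>M) + (\<integral>\<omega>. (norm (?I \<omega>))\<^sup>2 \<partial>M)))"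
      using XN Xs N I XI NI(1) by (simp add: V_def has_bochner_integral_iff)
    finally have Vt: "V t - V s = (\<integral>\<omega>. (norm (?N \<omega>))\<^sup>2 \<partial>M) - 2 * (\<integral>\<omega>. X s \<omega> \<bullet> ?I \<omega> \<partial>M) - 2 * (\<integral>\<omega>. ?N \<omega> \<bullet> ?I \<omega> \<partial>M) + (\<integral>\<omega>. (norm (?I \<omega>))\<^sup>2 \<partial>M)"
      by simp
    have I2: "(\<integral>\<omega>. (norm (?I \<omega>))\<^sup>2 \<partial>M) \<le> K * sqrt T * (\<delta> * e)"
    proof -
      have "K * \<delta>\<^sup>2 = K * (e * (\<delta> * e))" unfolding e(2)[symmetric] by (simp add: power2_eq_square)
      also have "\<dots> \<le> K * (sqrt T * (\<delta> * e))" using e d K(1) by (intro mult_left_mono mult_right_mono) auto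
      finally show ?thesis using incr(2) by (simp add: \<delta>_def mult.assoc)
    qed
    have NI2: "2 * \<bar>\<integral>\<omega>. ?N \<omega> \<bullet> ?I \<omega> \<partial>M\<bar> \<le> (c * K + K) * (\<delta> * e)"
    proof -
      have "2 * \<bar>\<integral>\<omega>. ?I \<omega> \<bullet> ?N \<omega> \<partial>M\<bar> \<le> (\<integral>\<omega>. (norm (?I \<omega>))\<^sup>2 \<partial>M) / e + e * (\<integral>\<omega>. (norm (?N \<omega>))\<^sup>2 \<partial>M)"
        by (rule inner_integrable(2)[OF I N e(1)])
      also have "\<dots> \<le> (K * \<delta>\<^sup>2) / e + e * (c * K * \<delta>)"
        using incr(1,2) e(1) by (intro add_mono divide_right_mono mult_left_mono) (auto simp: \<delta>_def)
      also have "(K * \<delta>\<^sup>2) / e = K * (\<delta> * e)" using de by (simp add: power2_eq_square times_divide_eq_right[symmetric] del: times_divide_eq_right)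
      finally show ?thesis by (simp add: inner_commute algebra_simps)
    qed
    let ?h = "\<lambda>r. \<integral>\<omega>. X (max 0 r) \<omega> \<bullet> D (max 0 r) \<omega> \<partial>M" and ?k = "\<lambda>r. \<integral>\<omega>. X s \<omega> \<bullet> D (max 0 r) \<omega> \<partial>M"
    have kF: "(\<integral>\<omega>. X s \<omega> \<bullet> ?I \<omega> \<partial>M) = (LINT r:{s..t}|lborel. ?k r)" "set_integrable lborel {s..t} ?k"
    proof -
      note F = Z_D_Fubini[OF st(1), of "\<lambda>_. X s" t "V s", OF Xs(1), unfolded continuous_paths_def]
      have "X s \<omega> \<bullet> ?I \<omega> = (LINT r:{s..t}|lborel. X s \<omega> \<bullet> D (max 0 r) \<omega>)" if "\<omega> \<in> space M" for \<omega>
      proof -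
        have "(\<integral>r. X s \<omega> \<bullet> (indicator {s..t} r *\<^sub>R D (max 0 r) \<omega>) \<partial>lborel) = X s \<omega> \<bullet> (\<integral>r. indicator {s..t} r *\<^sub>R D (max 0 r) \<omega> \<partial>lborel)"
          by (rule integral_inner_right) (use D_path_integrable(1)[OF that st(1), of t] in \<open>simp add: set_integrable_def\<close>)
        then show ?thesis by (simp add: I_def set_lebesgue_integral_def)
      qed
      then have "(\<integral>\<omega>. X s \<omega> \<bullet> ?I \<omega> \<partial>M) = (\<integral>\<omega>. (LINT r:{s..t}|lborel. X s \<omega> \<bullet> D (max 0 r) \<omega>) \<partial>M)"
        by (intro Bochner_Integration.integral_cong refl)
      then show "(\<integral>\<omega>. X s \<omega> \<bullet> ?I \<omega> \<partial>M) = (LINT r:{s..t}|lborel. ?k r)"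
        using F(1) Xs(2) by (simp add: V_def)
      show "set_integrable lborel {s..t} ?k" using F(2) Xs(2) by (simp add: V_def)
    qed
    note hI = V_rate_set_integrable(2)[OF st(1), of t]
    \<comment> \<open>Price of freezing: \<open>X r - X s\<close> has a second moment of order
      \<delta>, so its pairing with \<open>D r\<close> is of order \<open>sqrt \<delta>\<close>,
      before the integration over \<open>[s, t]\<close> adds a factor \<delta>.\<close>
    have "2 * ?h r - (2 * (c + T) * K + K) * e \<le> 2 * ?k r" if "r \<in> {s..t}" for r
    proof -
      have r: "0 \<le> r" "s \<le> r" "r \<le> T" "max 0 r = r" "r - s \<le> \<delta>" using that st by (auto simp: \<delta>_def)
      note ri = increment_square_le[OF st(1) r(2,3) Kall K(1)]
      have dm: "(\<lambda>\<omega>. X r \<omega> - X s \<omega>) \<in> borel_measurable M" using X_measurable r(1) st(1) by (intro borel_measurable_diff) auto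
      note ii = inner_integrable[OF dm ri(3) D_measurable[OF r(1)] D_square_integrable[OF r(1)]]
      have "2 * \<bar>\<integral>\<omega>. (X r \<omega> - X s \<omega>) \<bullet> D r \<omega> \<partial>M\<bar> \<le> (\<integral>\<omega>. (norm (X r \<omega> - X s \<omega>))\<^sup>2 \<partial>M) / e + e * (\<integral>\<omega>. (norm (D r \<omega>))\<^sup>2 \<partial>M)"
        by (rule ii(2)[OF e(1)])
      also have "\<dots> \<le> (2 * (c + T) * K * \<delta>) / e + e * K"
      proof (intro add_mono divide_right_mono mult_left_mono)
        have "2 * (c + T) * K * (r - s) \<le> 2 * (c + T) * K * \<delta>"
          using r(5) c0 assms K(1) by (intro mult_left_mono) auto
        then show "(\<integral>\<omega>. (norm (X r \<omega> - X s \<omega>))\<^sup>2 \<partial>M) \<le> 2 * (c + T) * K * \<delta>" using ri(4) by linarith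
      qed (use e K(2)[OF r(1,3)] in auto)
      also have "(2 * (c + T) * K * \<delta>) / e = 2 * (c + T) * K * e" using de by (simp add: times_divide_eq_right[symmetric] del: times_divide_eq_right)
      finally have b: "2 * \<bar>\<integral>\<omega>. (X r \<omega> - X s \<omega>) \<bullet> D r \<omega> \<partial>M\<bar> \<le> (2 * (c + T) * K + K) * e" by (simp add: algebra_simps)
      have "(\<integral>\<omega>. (X r \<omega> - X s \<omega>) \<bullet> D r \<omega> \<partial>M) = (\<integral>\<omega>. X r \<omega> \<bullet> D r \<omega> \<partial>M) - (\<integral>\<omega>. X s \<omega> \<bullet> D r \<omega> \<partial>M)"
        unfolding inner_diff_left
        by (rule Bochner_Integration.integral_diff)
           (intro XD_integrable r, intro inner_integrable(1) Xs D_measurable D_square_integrable r)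
      then show ?thesis using b unfolding r(4) by linarith
    qed
    then have "(LINT r:{s..t}|lborel. 2 * ?h r - (2 * (c + T) * K + K) * e) \<le> (LINT r:{s..t}|lborel. 2 * ?k r)"
      by (intro set_integral_mono_Icc set_integral_diff(1) set_integrable_mult_right hI kF(2)
            set_integrable_bounded_Icc[where C="\<bar>(2 * (c + T) * K + K) * e\<bar>"]) auto
    moreover have "(LINT r:{s..t}|lborel. 2 * ?h r - (2 * (c + T) * K + K) * e)
        = 2 * (LINT r:{s..t}|lborel. ?h r) - (2 * (c + T) * K + K) * (\<delta> * e)"
    proof -
      have ci: "set_integrable lborel {s..t} (\<lambda>r. (2 * (c + T) * K + K) * e)"
        by (rule set_integrable_bounded_Icc[where C="\<bar>(2 * (c + T) * K + K) * e\<bar>"]) auto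
      have "(LINT r:{s..t}|lborel. 2 * ?h r - (2 * (c + T) * K + K) * e)
          = (LINT r:{s..t}|lborel. 2 * ?h r) - (LINT r:{s..t}|lborel. (2 * (c + T) * K + K) * e)"
        by (rule set_integral_diff(2)) (use hI ci in auto)
      then show ?thesis using st by (simp add: set_integral_const_Icc \<delta>_def)
    qed
    ultimately have XI2: "- 2 * (\<integral>\<omega>. X s \<omega> \<bullet> ?I \<omega> \<partial>M) \<le> - 2 * (LINT r:{s..t}|lborel. ?h r) + (2 * (c + T) * K + K) * (\<delta> * e)"
      unfolding kF(1) by simp
    have "(LINT r:{s..t}|lborel. V_rate (max 0 r)) = (LINT r:{s..t}|lborel. c * (\<integral>\<omega>. (norm (D (max 0 r) \<omega>))\<^sup>2 \<partial>M)) - (LINT r:{s..t}|lborel. 2 * ?h r)"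
      unfolding V_rate_def by (rule set_integral_diff(2)) (use hI D_Fubini(5)[OF st(1), of t] in auto)
    then have gI: "(LINT r:{s..t}|lborel. V_rate (max 0 r)) = (\<integral>\<omega>. (norm (?N \<omega>))\<^sup>2 \<partial>M) - 2 * (LINT r:{s..t}|lborel. ?h r)"
      using J_increment_square[OF st(1,2)] by (simp add: has_bochner_integral_iff)
    have "V t - V s \<le> (LINT r:{s..t}|lborel. V_rate (max 0 r)) + ((2 * (c + T) * K + K) * (\<delta> * e) + (c * K + K) * (\<delta> * e) + K * sqrt T * (\<delta> * e))"
      using Vt I2 NI2 XI2 gI by linarith
    also have "(2 * (c + T) * K + K) * (\<delta> * e) + (c * K + K) * (\<delta> * e) + K * sqrt T * (\<delta> * e) = C * (\<delta> * e)"
      by (simp only: C_def distrib_right)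
    finally show ?thesis by (simp only: \<delta>_def e_def)
  qed
  then show ?thesis by blast
qed

lemma Y_square_integrable: "0 \<le> t \<Longrightarrow> has_bochner_integral M (\<lambda>\<omega>. (norm (X t \<omega> - m t))\<^sup>2) (V t - p t)"
proof -
  assume t: "0 \<le> t"
  have im: "integrable M (\<lambda>\<omega>. X t \<omega> \<bullet> m t)" using X_integrable[OF t] by simp
  have "(norm (X t \<omega> - m t))\<^sup>2 = (norm (X t \<omega>))\<^sup>2 - 2 * (X t \<omega> \<bullet> m t) + p t" for \<omega>
    by (simp add: p_def power2_norm_eq_inner inner_diff_left inner_diff_right inner_commute)
  moreover have "(\<integral>\<omega>. X t \<omega> \<bullet> m t \<partial>M) = p t"
    using X_integrable[OF t] by (simp add: m_def[symmetric] p_def power2_norm_eq_inner)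
  ultimately show ?thesis
    using X_square_integrable[OF t] im by (simp add: has_bochner_integral_iff V_def prob_space)
qed

lemma W_nonneg: "0 \<le> t \<Longrightarrow> p t \<le> V t"
proof -
  assume t: "0 \<le> t"
  have "0 \<le> (\<integral>\<omega>. (norm (X t \<omega> - m t))\<^sup>2 \<partial>M)" by (rule integral_nonneg_AE) simp
  then show ?thesis unfolding has_bochner_integral_integral_eq[OF Y_square_integrable[OF t]] by simp
qed

lemma \<Lambda>_integrable: "0 \<le> t \<Longrightarrow> integrable M (\<Lambda> t)"
  using \<Lambda>_measurable \<Lambda>_range by (intro integrable_const_bound[of _ 1]) (auto intro!: AE_I2)

lemma ell_range: "0 \<le> t \<Longrightarrow> 0 \<le> ell t \<and> ell t \<le> 1"
proof -
  assume t: "0 \<le> t"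
  have "0 \<le> ell t" unfolding ell_def using \<Lambda>_range[OF t] by (intro integral_nonneg_AE AE_I2) auto
  moreover have "ell t \<le> (\<integral>\<omega>. 1 \<partial>M)"
    unfolding ell_def using \<Lambda>_range[OF t] \<Lambda>_integrable[OF t] by (intro integral_mono) auto
  ultimately show ?thesis by (simp add: prob_space)
qed

text \<open>With \<open>y = X - m\<close> and \<open>l = \<Lambda>\<close> one has
  \<open>D = y + l m\<close> and \<open>X = y + m\<close>. The square of \<open>y\<close> gets the
  coefficient \<open>c - 2 = - 2 \<kappa>\<close>. The coefficient \<open>c l\<^sup>2 - 2 l\<close>
  of \<open>p\<close> is nonpositive because \<open>l\<^sup>2 \<le> l\<close> and
  \<open>c < 2\<close>. In the mixed term \<open>\<bar>c - 1\<bar> \<le> 1\<close>, and Young's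
  inequality with weight \<kappa> spends half of the dissipation on it. The term linear in
  \<open>y\<close> has mean zero.\<close>

lemma V_rate_le:
  assumes t: "0 \<le> t" and c: "c < 2"
  defines "\<kappa> \<equiv> (2 - c) / 2"
  shows "V_rate t \<le> - \<kappa> * (V t - p t) + ell t * p t / \<kappa>"
proof -
  have k: "0 < \<kappa>" using c by (simp add: \<kappa>_def)
  have c0: "0 \<le> c" by (simp add: c_def)
  let ?Y = "\<lambda>\<omega>. X t \<omega> - m t"
  have pt: "c * (norm (D t \<omega>))\<^sup>2 - 2 * (X t \<omega> \<bullet> D t \<omega>) \<le> - \<kappa> * (norm (?Y \<omega>))\<^sup>2 - 2 * (m t \<bullet> ?Y \<omega>) + \<Lambda> t \<omega> * p t / \<kappa>"
    if w: "\<omega> \<in> space M" for \<omega>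
  proof -
    define l where "l = \<Lambda> t \<omega>"
    have l: "0 \<le> l" "l \<le> 1" using \<Lambda>_range[OF t w] by (auto simp: l_def)
    define y where "y = ?Y \<omega>"
    have D: "D t \<omega> = y + l *\<^sub>R m t" and X: "X t \<omega> = y + m t"
      unfolding D_eq[OF t] y_def l_def by (simp_all add: algebra_simps)
    have D2: "(norm (D t \<omega>))\<^sup>2 = (norm y)\<^sup>2 + 2 * l * (y \<bullet> m t) + l\<^sup>2 * p t"
      unfolding D p_def power2_norm_eq_inner by (simp add: inner_add_left inner_add_right inner_commute power2_eq_square algebra_simps)
    have XD: "X t \<omega> \<bullet> D t \<omega> = (norm y)\<^sup>2 + l * (y \<bullet> m t) + m t \<bullet> y + l * p t"
      unfolding D X p_def power2_norm_eq_inner by (simp add: inner_add_left inner_add_right inner_commute algebra_simps)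
    have eq: "c * (norm (D t \<omega>))\<^sup>2 - 2 * (X t \<omega> \<bullet> D t \<omega>) =
        - (2 * \<kappa>) * (norm y)\<^sup>2 + 2 * (c - 1) * (l * (y \<bullet> m t)) + (c * l\<^sup>2 - 2 * l) * p t - 2 * (m t \<bullet> y)"
    proof -
      have kk: "2 * \<kappa> = 2 - c" by (simp add: \<kappa>_def)
      show ?thesis unfolding D2 XD kk by (simp add: algebra_simps)
    qed
    have p0: "0 \<le> p t" by (simp add: p_def)
    have l2: "l\<^sup>2 \<le> l" using l by (simp add: power2_eq_square mult_left_le)
    have "c * l\<^sup>2 \<le> 2 * l" using c c0 l l2 by (intro mult_mono) auto
    then have e1: "(c * l\<^sup>2 - 2 * l) * p t \<le> 0" using p0 by (simp add: mult_le_0_iff)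
    have "2 * (c - 1) * (l * (y \<bullet> m t)) \<le> \<bar>2 * (c - 1) * (l * (y \<bullet> m t))\<bar>" by simp
    also have "\<dots> = \<bar>c - 1\<bar> * (2 * \<bar>(l *\<^sub>R m t) \<bullet> y\<bar>)"
    proof -
      have "\<bar>2 * x * z\<bar> = \<bar>x\<bar> * (2 * \<bar>z\<bar>)" for x z :: real by (simp add: abs_mult)
      then show ?thesis by (simp only: inner_scaleR_left inner_commute[of "m t" y])
    qed
    also have "\<dots> \<le> 1 * (2 * \<bar>(l *\<^sub>R m t) \<bullet> y\<bar>)" using c c0 by (intro mult_right_mono) auto
    also have "\<dots> \<le> (norm (l *\<^sub>R m t))\<^sup>2 / \<kappa> + \<kappa> * (norm y)\<^sup>2" using inner_le_weighted[OF k, of "l *\<^sub>R m t" y] by (simp only: mult_1)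
    also have "(norm (l *\<^sub>R m t))\<^sup>2 = l\<^sup>2 * p t" by (simp add: p_def power_mult_distrib)
    also have "l\<^sup>2 * p t / \<kappa> \<le> l * p t / \<kappa>" using l2 p0 k by (intro divide_right_mono mult_right_mono) auto
    finally show ?thesis using e1 unfolding eq y_def[symmetric] l_def[symmetric] by linarith
  qed
  have Dk: "integrable M (\<lambda>\<omega>. (norm (D t \<omega>))\<^sup>2)" by (rule D_square_integrable[OF t])
  note Y = Y_square_integrable[OF t]
  have Yi: "integrable M (\<lambda>\<omega>. m t \<bullet> ?Y \<omega>)" using X_integrable[OF t] by simp
  have Y0: "(\<integral>\<omega>. m t \<bullet> ?Y \<omega> \<partial>M) = 0"
  proof -
    have "(\<integral>\<omega>. ?Y \<omega> \<partial>M) = 0" using X_integrable[OF t] by (simp add: m_def prob_space)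
    then show ?thesis using X_integrable[OF t] by (subst integral_inner_right) auto
  qed
  have "V_rate t = (\<integral>\<omega>. c * (norm (D t \<omega>))\<^sup>2 - 2 * (X t \<omega> \<bullet> D t \<omega>) \<partial>M)"
    using Dk XD_integrable[OF t] by (simp add: V_rate_def)
  also have "\<dots> \<le> (\<integral>\<omega>. - \<kappa> * (norm (?Y \<omega>))\<^sup>2 - 2 * (m t \<bullet> ?Y \<omega>) + \<Lambda> t \<omega> * p t / \<kappa> \<partial>M)"
  proof (rule integral_mono[OF _ _ pt])
    show "integrable M (\<lambda>\<omega>. c * (norm (D t \<omega>))\<^sup>2 - 2 * (X t \<omega> \<bullet> D t \<omega>))" using Dk XD_integrable[OF t] by simp
    show "integrable M (\<lambda>\<omega>. - \<kappa> * (norm (?Y \<omega>))\<^sup>2 - 2 * (m t \<bullet> ?Y \<omega>) + \<Lambda> t \<omega> * p t / \<kappa>)"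
      using Y Yi \<Lambda>_integrable[OF t] by (intro Bochner_Integration.integrable_add Bochner_Integration.integrable_diff integrable_mult_right
        integrable_divide integrable_mult_left) (auto simp: has_bochner_integral_iff)
  qed
  also have "\<dots> = - \<kappa> * (V t - p t) - 2 * 0 + ell t * p t / \<kappa>"
    using Y Yi \<Lambda>_integrable[OF t] unfolding Y0[symmetric] ell_def by (simp add: has_bochner_integral_iff)
  finally show ?thesis by simp
qed

end

lemma set_integral_eq_integral_Icc:
  fixes f :: "real \<Rightarrow> 'b::euclidean_space"
  assumes "continuous_on {a..b} f" "0 \<le> a"
  shows "(LINT s:{a..b}|lborel. f (max 0 s)) = integral {a..b} f" "set_integrable lborel {a..b} (\<lambda>s. f (max 0 s))"
proof -
  have "continuous_on {a..b} (\<lambda>s. f (max 0 s)) \<longleftrightarrow> continuous_on {a..b} f"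
    using assms(2) by (intro continuous_on_cong) auto
  then show i: "set_integrable lborel {a..b} (\<lambda>s. f (max 0 s))"
    using assms by (intro borel_integrable_atLeastAtMost') simp
  have "integral {a..b} (\<lambda>s. f (max 0 s)) = integral {a..b} f"
    using assms(2) by (intro Henstock_Kurzweil_Integration.integral_cong) auto
  then show "(LINT s:{a..b}|lborel. f (max 0 s)) = integral {a..b} f"
    using set_borel_integral_eq_integral(2)[OF i] by simp
qed

lemma antimono_convergent_at_top:
  fixes f :: "real \<Rightarrow> real"
  assumes mono: "\<And>s t. 0 \<le> s \<Longrightarrow> s \<le> t \<Longrightarrow> f t \<le> f s"
    and below: "\<And>t. 0 \<le> t \<Longrightarrow> B \<le> f t"
  shows "\<exists>l\<ge>B. (f \<longlongrightarrow> l) at_top \<and> (\<forall>t\<ge>0. l \<le> f t)"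
proof -
  have bdd: "bdd_below (f ` {0..})" using below by (intro bdd_belowI[of _ B]) auto
  define l where "l = (INF t\<in>{0..}. f t)"
  have le: "l \<le> f t" if "0 \<le> t" for t
    unfolding l_def using that bdd by (auto intro: cINF_lower)
  have "(f \<longlongrightarrow> l) at_top"
  proof (rule decreasing_tendsto)
    show "\<forall>\<^sub>F t in at_top. l \<le> f t"
      using eventually_ge_at_top[of 0] by eventually_elim (rule le)
    fix x assume "l < x"
    then obtain s where s: "0 \<le> s" "f s < x"
      unfolding l_def using bdd by (subst (asm) cINF_less_iff) auto
    show "\<forall>\<^sub>F t in at_top. f t < x"
      using eventually_ge_at_top[of s] by eventually_elim (use mono s in force)
  qed
  moreover have "B \<le> l" unfolding l_def using below by (intro cINF_greatest) auto
  ultimately show ?thesis using le by blast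
qed

section \<open>Equation for the mean and decay of the variance\<close>

context mean_field_process begin

lemma ell_continuous: "continuous_on {0..} ell"
  unfolding continuous_on_sequentially
proof (intro allI ballI impI, elim conjE)
  fix x :: "nat \<Rightarrow> real" and a :: real
  assume a: "a \<in> {0..}" and x: "\<forall>n. x n \<in> {0..}" and lim: "x \<longlonglongrightarrow> a"
  have x0: "0 \<le> x n" for n using x by auto
  have "(\<lambda>n. \<integral>\<omega>. \<Lambda> (x n) \<omega> \<partial>M) \<longlonglongrightarrow> (\<integral>\<omega>. \<Lambda> a \<omega> \<partial>M)"
  proof (rule integral_dominated_convergence[where w="\<lambda>_. 1"])
    show "AE \<omega> in M. (\<lambda>n. \<Lambda> (x n) \<omega>) \<longlonglongrightarrow> \<Lambda> a \<omega>"
    proof (rule AE_I2)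
      fix \<omega> assume "\<omega> \<in> space M"
      then have "continuous_on {0..} (\<lambda>t. \<Lambda> t \<omega>)" using continuous(2) by (simp add: continuous_paths_def)
      then show "(\<lambda>n. \<Lambda> (x n) \<omega>) \<longlonglongrightarrow> \<Lambda> a \<omega>"
        by (rule continuous_on_tendsto_compose[OF _ lim a]) (use x in auto)
    qed
    show "AE \<omega> in M. norm (\<Lambda> (x n) \<omega>) \<le> 1" for n
      using \<Lambda>_range[OF x0[of n]] by (intro AE_I2) auto
  qed (use \<Lambda>_measurable x0 a in auto)
  then show "(ell \<circ> x) \<longlonglongrightarrow> ell a" by (simp add: ell_def o_def)
qed

lemma ell_max_measurable [measurable]: "(\<lambda>r. ell (max 0 r)) \<in> borel_measurable borel"
  by (intro borel_measurable_continuous_onI continuous_on_compose2[OF ell_continuous]) (auto intro!: continuous_intros)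

lemma mean_D: "0 \<le> r \<Longrightarrow> (\<integral>\<omega>. D r \<omega> \<partial>M) = ell r *\<^sub>R m r"
proof -
  assume r: "0 \<le> r"
  have "(\<integral>\<omega>. D r \<omega> \<partial>M) = (\<integral>\<omega>. X r \<omega> - (1 - \<Lambda> r \<omega>) *\<^sub>R m r \<partial>M)" by (simp add: D_eq[OF r])
  also have "\<dots> = m r - (1 - ell r) *\<^sub>R m r"
    using X_integrable[OF r] \<Lambda>_integrable[OF r] by (simp add: m_def[symmetric] ell_def prob_space)
  finally show ?thesis by (simp add: algebra_simps)
qed

lemma mean_increment:
  assumes "0 \<le> s" "s \<le> t"
  shows "m t - m s = - (LINT r:{s..t}|lborel. ell (max 0 r) *\<^sub>R m (max 0 r))"
proof -
  have t0: "0 \<le> t" using assms by simp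
  let ?N = "\<lambda>\<omega>. J t \<omega> - J s \<omega>"
  have Ii: "integrable M (I s t)" using D_Fubini(1)[OF assms(1)] by (simp add: I_def[abs_def])
  have Xi: "integrable M (X t)" "integrable M (X s)" using X_integrable assms t0 by auto
  have ae: "AE \<omega> in M. (X t \<omega> - X s \<omega>) + I s t \<omega> = ?N \<omega>"
    using increment_equation[OF assms] by eventually_elim (simp add: I_def)
  have Ni: "integrable M ?N"
    using Xi Ii J_increment_measurable[OF assms] by (intro integrable_cong_AE_imp[OF _ _ ae]) auto
  \<comment> \<open>Orthogonality of the noise increment is tested with the constant vector equal to
    its own mean, so \<open>e \<bullet> e = 0\<close>.\<close>
  define e where "e = (\<integral>\<omega>. ?N \<omega> \<partial>M)"
  have "has_bochner_integral M (\<lambda>\<omega>. e \<bullet> ?N \<omega>) 0"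
    by (rule ito_orthogonal[OF assms energy_integrable[OF t0]]) auto
  moreover have "(\<integral>\<omega>. e \<bullet> ?N \<omega> \<partial>M) = e \<bullet> e" unfolding e_def by (rule integral_inner_right) (use Ni in auto)
  ultimately have "e = 0" by (simp add: has_bochner_integral_iff)
  have "m t - m s = (\<integral>\<omega>. X t \<omega> - X s \<omega> \<partial>M)" using Xi by (simp add: m_def)
  also have "\<dots> = (\<integral>\<omega>. ?N \<omega> - I s t \<omega> \<partial>M)"
  proof (rule integral_cong_AE)
    show "AE \<omega> in M. X t \<omega> - X s \<omega> = ?N \<omega> - I s t \<omega>" using ae by eventually_elim (simp add: algebra_simps)
  qed (use Xi Ni Ii in auto)
  also have "\<dots> = - (\<integral>\<omega>. I s t \<omega> \<partial>M)" using Ni Ii \<open>e = 0\<close> by (simp add: e_def)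
  also have "(\<integral>\<omega>. I s t \<omega> \<partial>M) = (LINT r:{s..t}|lborel. ell (max 0 r) *\<^sub>R m (max 0 r))"
    unfolding I_def D_Fubini(2)[OF assms(1)] by (simp add: mean_D)
  finally show ?thesis .
qed

definition L :: "real \<Rightarrow> real" where "L t = integral {0..t} ell"

text \<open>The integral equation has a bounded measurable integrand, which already makes
  \<open>m\<close> continuous. Only then is the integrand continuous and differentiation
  possible.\<close>

lemma m_continuous: "continuous_on {0..T} m"
proof (cases "0 \<le> T")
  case True
  obtain C where C: "0 \<le> C" "\<And>t. 0 \<le> t \<Longrightarrow> t \<le> T \<Longrightarrow> norm (m t) \<le> C" using first_moment_bound[OF True] by blast
  let ?f = "\<lambda>r. ell (max 0 r) *\<^sub>R m (max 0 r)"
  have int: "set_integrable lborel {0..t} ?f" if "t \<le> T" for t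
  proof (rule set_integrable_bounded_Icc[where C=C])
    fix s assume "s \<in> {0..t}"
    then have s: "0 \<le> s" "s \<le> T" "max 0 s = s" using that by auto
    have "norm (?f s) = ell s * norm (m s)" using ell_range[OF s(1)] by (simp add: s(3))
    also have "\<dots> \<le> 1 * C" using ell_range[OF s(1)] C(2)[OF s(1,2)] by (intro mult_mono) auto
    finally show "norm (?f s) \<le> C" by simp
  qed measurable
  have eq: "m 0 - integral {0..t} ?f = m t" if "t \<in> {0..T}" for t
    using mean_increment[of 0 t] set_borel_integral_eq_integral(2)[OF int[of t]] that by (simp add: algebra_simps)
  have "continuous_on {0..T} (\<lambda>t. m 0 - integral {0..t} ?f)"
    by (intro continuous_on_diff continuous_on_const indefinite_integral_continuous_1 set_borel_integral_eq_integral(1) int) simp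
  then show ?thesis by (rule continuous_on_eq) (rule eq)
qed simp

lemma ell_continuous_Icc: "0 \<le> a \<Longrightarrow> continuous_on {a..b} ell"
  by (rule continuous_on_subset[OF ell_continuous]) auto

text \<open>The product \<open>exp (L t) *\<^sub>R m t\<close> has derivative zero. The explicit
  form serves twice: for the evolution of \<open>p\<close>, and for the convergence of
  \<open>m\<close> when \<open>L\<close> is bounded.\<close>

lemma m_exp:
  assumes "0 \<le> T" shows "m T = exp (- L T) *\<^sub>R m 0"
proof -
  have dL: "(L has_vector_derivative ell t) (at t within {0..T})" if "t \<in> {0..T}" for t
    unfolding L_def[abs_def] by (rule integral_has_vector_derivative[OF ell_continuous_Icc[OF order_refl] that])
  have cf: "continuous_on {0..T} (\<lambda>r. ell r *\<^sub>R m r)"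
    by (intro continuous_intros ell_continuous_Icc m_continuous) simp
  have m_eq: "m t = m 0 - integral {0..t} (\<lambda>r. ell r *\<^sub>R m r)" if "t \<in> {0..T}" for t
  proof -
    have "continuous_on {0..t} (\<lambda>r. ell r *\<^sub>R m r)" by (rule continuous_on_subset[OF cf]) (use that in auto)
    from set_integral_eq_integral_Icc(1)[OF this order_refl] show ?thesis
      using mean_increment[of 0 t] that by (simp add: algebra_simps)
  qed
  have dm: "(m has_vector_derivative - (ell t *\<^sub>R m t)) (at t within {0..T})" if "t \<in> {0..T}" for t
  proof -
    have "((\<lambda>t. m 0 - integral {0..t} (\<lambda>r. ell r *\<^sub>R m r)) has_vector_derivative 0 - ell t *\<^sub>R m t) (at t within {0..T})"
      by (intro has_vector_derivative_diff has_vector_derivative_const integral_has_vector_derivative[OF cf that])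
    then have "((\<lambda>t. m 0 - integral {0..t} (\<lambda>r. ell r *\<^sub>R m r)) has_vector_derivative - (ell t *\<^sub>R m t)) (at t within {0..T})" by simp
    note d = this
    show ?thesis by (rule has_vector_derivative_transform[OF that _ d]) (rule m_eq)
  qed
  have "((\<lambda>t. exp (L t) *\<^sub>R m t) has_vector_derivative 0) (at t within {0..T})" if "t \<in> {0..T}" for t
  proof -
    have "((\<lambda>t. exp (L t)) has_real_derivative exp (L t) * ell t) (at t within {0..T})"
      using dL[OF that] by (intro DERIV_chain2[OF DERIV_exp]) (simp add: has_real_derivative_iff_has_vector_derivative)
    from has_vector_derivative_scaleR[OF this dm[OF that]] show ?thesis by simp
  qed
  then obtain v where v: "\<And>t. t \<in> {0..T} \<Longrightarrow> exp (L t) *\<^sub>R m t = v"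
    using has_vector_derivative_zero_constant[of "{0..T}" "\<lambda>t. exp (L t) *\<^sub>R m t"] by auto
  have "exp (L T) *\<^sub>R m T = m 0" using v[of T] v[of 0] assms by (simp add: L_def)
  then have "exp (- L T) *\<^sub>R (exp (L T) *\<^sub>R m T) = exp (- L T) *\<^sub>R m 0" by simp
  then show ?thesis by (simp add: exp_minus)
qed

lemma p_exp: "0 \<le> t \<Longrightarrow> p t = exp (- 2 * L t) * p 0"
proof -
  assume t: "0 \<le> t"
  have "p t = (exp (- L t))\<^sup>2 * p 0" unfolding p_def m_exp[OF t] by (simp add: power_mult_distrib)
  also have "(exp (- L t))\<^sup>2 = exp (- 2 * L t)" by (simp add: power2_eq_square exp_add[symmetric])
  finally show ?thesis .
qed

lemma p_increment:
  assumes "0 \<le> s" "s \<le> t"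
  shows "p s - p t = 2 * (LINT r:{s..t}|lborel. ell (max 0 r) * p (max 0 r))"
    "set_integrable lborel {s..t} (\<lambda>r. ell (max 0 r) * p (max 0 r))"
proof -
  have cp: "continuous_on {s..t} (\<lambda>r. ell r * p r)"
    unfolding p_def using assms
    by (intro continuous_intros ell_continuous_Icc continuous_on_subset[OF m_continuous[of t]]) auto
  have "((\<lambda>r. - 2 * (ell r * p r)) has_integral p t - p s) {s..t}"
  proof (rule fundamental_theorem_of_calculus[OF assms(2)])
    fix r assume r: "r \<in> {s..t}"
    have "(L has_vector_derivative ell r) (at r within {0..t})"
      unfolding L_def[abs_def] using r assms
      by (intro integral_has_vector_derivative ell_continuous_Icc) auto
    then have "(L has_real_derivative ell r) (at r within {s..t})"
      unfolding has_real_derivative_iff_has_vector_derivative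
      by (rule has_vector_derivative_within_subset) (use assms in auto)
    then have "((\<lambda>t. exp (- 2 * L t) * p 0) has_real_derivative - 2 * (ell r * (exp (- 2 * L r) * p 0))) (at r within {s..t})"
      by (auto intro!: derivative_eq_intros)
    then have "((\<lambda>t. exp (- 2 * L t) * p 0) has_vector_derivative - 2 * (ell r * p r)) (at r within {s..t})"
      using p_exp[of r] r assms by (simp add: has_real_derivative_iff_has_vector_derivative)
    note d = this
    show "(p has_vector_derivative - 2 * (ell r * p r)) (at r within {s..t})"
      by (rule has_vector_derivative_transform[OF r _ d]) (rule p_exp, use assms in simp)
  qed
  from integral_unique[OF this] have "p t - p s = integral {s..t} (\<lambda>r. - 2 * (ell r * p r))" by simp
  also have "\<dots> = - 2 * integral {s..t} (\<lambda>r. ell r * p r)" by simp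
  finally show "p s - p t = 2 * (LINT r:{s..t}|lborel. ell (max 0 r) * p (max 0 r))"
    using set_integral_eq_integral_Icc(1)[OF cp assms(1)] by simp
  show "set_integrable lborel {s..t} (\<lambda>r. ell (max 0 r) * p (max 0 r))"
    by (rule set_integral_eq_integral_Icc(2)[OF cp assms(1)])
qed

lemma V_measurable [measurable]: "(\<lambda>r. V (max 0 r)) \<in> borel_measurable borel"
proof -
  have swap: "(\<lambda>p::real \<times> 'w. (snd p, fst p)) \<in> measurable (borel \<Otimes>\<^sub>M M) (M \<Otimes>\<^sub>M lborel)"
    by (intro measurable_Pair) simp_all
  have [measurable]: "(\<lambda>p. X (max 0 (fst p)) (snd p)) \<in> borel_measurable (borel \<Otimes>\<^sub>M M)"
    using measurable_compose[OF swap X_joint] by simp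
  show ?thesis unfolding V_def
    by (intro borel_measurable_lebesgue_integral) (simp add: case_prod_unfold)
qed

lemma W_set_integrable:
  assumes "0 \<le> a" shows "set_integrable lborel {a..b} (\<lambda>r. V (max 0 r) - p (max 0 r))"
proof -
  obtain C where C: "\<And>t. 0 \<le> t \<Longrightarrow> t \<le> \<bar>b\<bar> \<Longrightarrow> V t \<le> C" using V_bound[of "\<bar>b\<bar>"] by (meson abs_ge_zero)
  show ?thesis
  proof (rule set_integrable_bounded_Icc[where C=C])
    fix s assume "s \<in> {a..b}"
    then have s: "0 \<le> s" "s \<le> \<bar>b\<bar>" "max 0 s = s" using assms by auto
    have "0 \<le> p s" by (simp add: p_def)
    then show "norm (V (max 0 s) - p (max 0 s)) \<le> C" using C[OF s(1,2)] W_nonneg[OF s(1)] unfolding s(3) by simp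
  next
    have "(\<lambda>r. p (max 0 r)) \<in> borel_measurable borel" unfolding p_def by measurable
    then show "(\<lambda>r. V (max 0 r) - p (max 0 r)) \<in> borel_measurable borel" by measurable
  qed
qed

lemma lyapunov:
  assumes st: "0 \<le> s" "s \<le> t" and c2: "c < 2"
  defines "\<kappa> \<equiv> (2 - c) / 2"
  shows "V t + p t / (2 * \<kappa>) + \<kappa> * (LINT r:{s..t}|lborel. V (max 0 r) - p (max 0 r)) \<le> V s + p s / (2 * \<kappa>)"
proof -
  have k: "0 < \<kappa>" using c2 by (simp add: \<kappa>_def)
  \<comment> \<open>The dissipated amount is made part of \<phi>, so that the whole inequality is a
    monotonicity statement and follows from small increments alone, without differentiability of
    \<open>V\<close>.\<close>
  define \<phi> where "\<phi> x = V x + p x / (2 * \<kappa>) + \<kappa> * (LINT r:{s..x}|lborel. V (max 0 r) - p (max 0 r))" for x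
  obtain C where "\<forall>x y. 0 \<le> x \<and> x \<le> y \<and> y \<le> t \<longrightarrow> V y - V x \<le> (LINT r:{x..y}|lborel. V_rate (max 0 r)) + C * ((y - x) * sqrt (y - x))"
    using V_increment[OF order_trans[OF st]] by blast
  then have C: "\<And>x y. 0 \<le> x \<Longrightarrow> x \<le> y \<Longrightarrow> y \<le> t \<Longrightarrow> V y - V x \<le> (LINT r:{x..y}|lborel. V_rate (max 0 r)) + C * ((y - x) * sqrt (y - x))"
    by blast
  have "\<phi> t \<le> \<phi> s"
  proof (rule nonincreasing_if_small_increments[OF st(2)])
    fix x y assume xy: "s \<le> x" "x \<le> y" "y \<le> t"
    have x0: "0 \<le> x" using xy st by simp
    let ?W = "LINT r:{x..y}|lborel. V (max 0 r) - p (max 0 r)" and ?P = "LINT r:{x..y}|lborel. ell (max 0 r) * p (max 0 r)"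
    note Wi = W_set_integrable[OF x0, of y] and Pi = p_increment(2)[OF x0 xy(2)]
    have "(LINT r:{x..y}|lborel. V_rate (max 0 r)) \<le> (LINT r:{x..y}|lborel. (ell (max 0 r) * p (max 0 r)) / \<kappa> - \<kappa> * (V (max 0 r) - p (max 0 r)))"
    proof (rule set_integral_mono_Icc)
      show "V_rate (max 0 r) \<le> (ell (max 0 r) * p (max 0 r)) / \<kappa> - \<kappa> * (V (max 0 r) - p (max 0 r))" for r
        using V_rate_le[OF max.cobounded1 c2, of r] unfolding \<kappa>_def by linarith
    qed (intro V_rate_set_integrable(1) x0 set_integral_diff(1) set_integrable_mult_right set_integrable_divide impI Wi Pi)+
    also have "\<dots> = ?P / \<kappa> - \<kappa> * ?W"
      by (subst set_integral_diff(2)) (use Wi Pi in auto)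
    finally have gi: "(LINT r:{x..y}|lborel. V_rate (max 0 r)) \<le> ?P / \<kappa> - \<kappa> * ?W" .
    have split: "(LINT r:{s..y}|lborel. V (max 0 r) - p (max 0 r)) = (LINT r:{s..x}|lborel. V (max 0 r) - p (max 0 r)) + ?W"
      by (rule set_integral_Icc_combine[OF xy(1,2) W_set_integrable[OF st(1)]])
    \<comment> \<open>The factor \<open>1 / (2 * \<kappa>)\<close> is chosen so that this decrease
      cancels the growth term \<open>?P / \<kappa>\<close> exactly.\<close>
    have "p y / (2 * \<kappa>) - p x / (2 * \<kappa>) = - (?P / \<kappa>)"
      using p_increment(1)[OF x0 xy(2)] k by (simp add: field_simps)
    then show "\<phi> y - \<phi> x \<le> C * ((y - x) * sqrt (y - x))"
      using C[OF x0 xy(2,3)] gi unfolding \<phi>_def split distrib_left by linarith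
  qed
  moreover have "(LINT r:{s..s}|lborel. V (max 0 r) - p (max 0 r)) = 0"
    using set_borel_integral_eq_integral(2)[OF W_set_integrable[OF st(1)], of s] by simp
  ultimately show ?thesis by (simp add: \<phi>_def)
qed

text \<open>Integrability alone does not force a nonnegative function to zero; here the limit
  exists, because \<open>V - p\<close> is a combination of the monotone functions \<open>E\<close>
  and \<open>p\<close>. A positive limit would make the dissipated amount grow without bound, beyond
  the initial value of \<open>E\<close>.\<close>

lemma W_tendsto_0:
  assumes c2: "c < 2"
  shows "\<exists>l\<ge>0. (p \<longlongrightarrow> l) at_top \<and> (\<forall>t\<ge>0. l \<le> p t) \<and> ((\<lambda>t. V t - p t) \<longlongrightarrow> 0) at_top"
proof -
  define \<kappa> where "\<kappa> = (2 - c) / 2"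
  have k: "0 < \<kappa>" using c2 by (simp add: \<kappa>_def)
  define E where "E t = V t + p t / (2 * \<kappa>)" for t
  have p0: "0 \<le> p t" for t by (simp add: p_def)
  have Wint: "0 \<le> (LINT r:{s..t}|lborel. V (max 0 r) - p (max 0 r))" if "0 \<le> s" for s t
    unfolding set_lebesgue_integral_def using W_nonneg by (intro integral_nonneg_AE AE_I2) (auto simp: indicator_def)
  have lyap: "E t + \<kappa> * (LINT r:{s..t}|lborel. V (max 0 r) - p (max 0 r)) \<le> E s" if "0 \<le> s" "s \<le> t" for s t
    using lyapunov[OF that c2] by (simp add: E_def \<kappa>_def)
  have Emono: "E t \<le> E s" if "0 \<le> s" "s \<le> t" for s t
    using lyap[OF that] Wint[OF that(1), of t] k mult_nonneg_nonneg[of \<kappa> "LINT r:{s..t}|lborel. V (max 0 r) - p (max 0 r)"] by linarith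
  have V0: "0 \<le> V t" if "0 \<le> t" for t using W_nonneg[OF that] p0[of t] by linarith
  have E0: "0 \<le> E t" if "0 \<le> t" for t using V0[OF that] p0[of t] k by (simp add: E_def)
  have pmono: "p t \<le> p s" if "0 \<le> s" "s \<le> t" for s t
  proof -
    have "0 \<le> (LINT r:{s..t}|lborel. ell (max 0 r) * p (max 0 r))"
      unfolding set_lebesgue_integral_def using ell_range p0 by (intro integral_nonneg_AE AE_I2) (auto simp: indicator_def)
    then show ?thesis using p_increment(1)[OF that] by linarith
  qed
  obtain Einf where Einf: "(E \<longlongrightarrow> Einf) at_top" using antimono_convergent_at_top[of E 0, OF Emono E0] by blast
  obtain pinf where pinf: "0 \<le> pinf" "(p \<longlongrightarrow> pinf) at_top" "\<And>t. 0 \<le> t \<Longrightarrow> pinf \<le> p t"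
    using antimono_convergent_at_top[of p 0, OF pmono p0] by blast
  define w where "w = Einf - (1 + 1 / (2 * \<kappa>)) * pinf"
  have "((\<lambda>t. E t - (1 + 1 / (2 * \<kappa>)) * p t) \<longlongrightarrow> w) at_top"
    unfolding w_def by (intro tendsto_diff tendsto_mult tendsto_const Einf pinf(2))
  then have W: "((\<lambda>t. V t - p t) \<longlongrightarrow> w) at_top" by (simp add: E_def distrib_right)
  have "\<forall>\<^sub>F t in at_top. 0 \<le> V t - p t" using eventually_ge_at_top[of 0] by eventually_elim (simp add: W_nonneg)
  then have w0: "0 \<le> w" by (rule tendsto_lowerbound[OF W]) simp
  have "w = 0"
  proof (rule ccontr)
    assume "w \<noteq> 0"
    then have wp: "0 < w" using w0 by simp
    then have "\<forall>\<^sub>F t in at_top. w / 2 < V t - p t" by (intro order_tendstoD(1)[OF W]) simp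
    then obtain s0 where s0: "\<And>t. s0 \<le> t \<Longrightarrow> w / 2 < V t - p t" by (auto simp: eventually_at_top_linorder)
    define s where "s = max 0 s0"
    \<comment> \<open>The length is chosen so that dissipation at rate at least
      \<open>\<kappa> * w / 2\<close> uses up \<open>E s\<close> and \<open>\<kappa> * w / 2\<close>
      more.\<close>
    define t where "t = s + (2 * E s / (\<kappa> * w) + 1)"
    have s: "0 \<le> s" "s \<le> t" using E0[of s] k wp by (auto simp: s_def t_def)
    have "(LINT r:{s..t}|lborel. w / 2) \<le> (LINT r:{s..t}|lborel. V (max 0 r) - p (max 0 r))"
    proof (rule set_integral_mono_Icc[OF _ W_set_integrable[OF s(1)]])
      show "set_integrable lborel {s..t} (\<lambda>r. w / 2)" by (rule set_integrable_bounded_Icc[where C="\<bar>w / 2\<bar>"]) auto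
      fix r assume "r \<in> {s..t}"
      then have "s0 \<le> r" "max 0 r = r" by (auto simp: s_def)
      then show "w / 2 \<le> V (max 0 r) - p (max 0 r)" using s0[of r] by simp
    qed
    then have "(t - s) * (w / 2) \<le> (LINT r:{s..t}|lborel. V (max 0 r) - p (max 0 r))"
      using s by (simp add: set_integral_const_Icc)
    then have "\<kappa> * ((t - s) * (w / 2)) \<le> \<kappa> * (LINT r:{s..t}|lborel. V (max 0 r) - p (max 0 r))"
      using k by (intro mult_left_mono) auto
    also have "\<dots> \<le> E s" using lyap[OF s] E0[of t] s by simp
    also have "\<kappa> * ((t - s) * (w / 2)) = E s + \<kappa> * w / 2" using k wp by (simp add: t_def field_simps)
    finally show False using mult_pos_pos[OF k wp] by simp
  qed
  then show ?thesis using W pinf by blast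
qed

end

section \<open>Long-time behaviour\<close>

context mean_field_process begin

lemma L_diff:
  assumes "0 \<le> s" "s \<le> t"
  shows "(LINT r:{s..t}|lborel. ell (max 0 r)) = L t - L s" "L s \<le> L t"
proof -
  have "L s + integral {s..t} ell = L t"
    unfolding L_def using assms
    by (intro Henstock_Kurzweil_Integration.integral_combine integrable_continuous_interval ell_continuous_Icc) auto
  then show eq: "(LINT r:{s..t}|lborel. ell (max 0 r)) = L t - L s"
    using set_integral_eq_integral_Icc(1)[OF ell_continuous_Icc[OF assms(1)] assms(1), of t] by simp
  have "0 \<le> (LINT r:{s..t}|lborel. ell (max 0 r))"
    unfolding set_lebesgue_integral_def using ell_range by (intro integral_nonneg_AE AE_I2) (auto simp: indicator_def)
  then show "L s \<le> L t" using eq by simp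
qed

lemma mean_deviation_le:
  assumes "0 \<le> t"
  shows "(\<integral>\<omega>. norm (X t \<omega> - v) \<partial>M) \<le> sqrt (V t - p t) + norm (m t - v)"
proof -
  have X: "X t \<in> borel_measurable M" by (rule X_measurable[OF assms])
  have int: "integrable M (\<lambda>\<omega>. norm (X t \<omega> - w))" for w using X_integrable[OF assms] by simp
  note Y = Y_square_integrable[OF assms]
  have sq: "square_integrable M (\<lambda>\<omega>. norm (X t \<omega> - m t))"
    using Y X by (simp add: square_integrable_def has_bochner_integral_iff)
  have "(\<integral>\<omega>. norm (X t \<omega> - m t) \<partial>M) \<le> \<bar>\<integral>\<omega>. norm (X t \<omega> - m t) * 1 \<partial>M\<bar>" by simp
  also have "\<dots> \<le> sqrt (\<integral>\<omega>. (norm (X t \<omega> - m t))\<^sup>2 \<partial>M) * sqrt (\<integral>\<omega>. 1\<^sup>2 \<partial>M)"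
    by (rule Cauchy_Schwarz_integral[OF sq square_integrable_const[OF finite_measure_axioms]])
  also have "\<dots> = sqrt (V t - p t)" using Y by (simp add: has_bochner_integral_iff prob_space)
  finally have "(\<integral>\<omega>. norm (X t \<omega> - m t) \<partial>M) \<le> sqrt (V t - p t)" .
  moreover have "(\<integral>\<omega>. norm (X t \<omega> - v) \<partial>M) \<le> (\<integral>\<omega>. norm (X t \<omega> - m t) + norm (m t - v) \<partial>M)"
  proof (rule integral_mono[OF int])
    show "integrable M (\<lambda>\<omega>. norm (X t \<omega> - m t) + norm (m t - v))" using int by simp
    show "norm (X t \<omega> - v) \<le> norm (X t \<omega> - m t) + norm (m t - v)" for \<omega>
      using norm_triangle_ineq[of "X t \<omega> - m t" "m t - v"] by simp
  qed
  moreover have "\<dots> = (\<integral>\<omega>. norm (X t \<omega> - m t) \<partial>M) + norm (m t - v)" using int by (simp add: prob_space)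
  ultimately show ?thesis by simp
qed

text \<open>Either the total weight \<open>L\<close> is infinite, which drives the mean and hence the second moment
  to zero, or it is finite and the law of \<open>X\<close> concentrates at a point.\<close>

lemma dichotomy:
  assumes "c < 2"
  shows "(V \<longlongrightarrow> 0) at_top \<or>
    (\<exists>K v. (\<forall>t\<ge>0. L t \<le> K) \<and> ((\<lambda>t. \<integral>\<omega>. norm (X t \<omega> - v) \<partial>M) \<longlongrightarrow> 0) at_top)"
proof -
  obtain pinf where pinf: "0 \<le> pinf" "(p \<longlongrightarrow> pinf) at_top" "\<And>t. 0 \<le> t \<Longrightarrow> pinf \<le> p t" "((\<lambda>t. V t - p t) \<longlongrightarrow> 0) at_top"
    using W_tendsto_0[OF assms] by blast
  show ?thesis
  \<comment> \<open>The distinction is made by the limit of \<open>p\<close> instead of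
    \<open>L\<close>; its first case includes a vanishing initial mean, for which \<open>L\<close>
    may well be bounded.\<close>
  proof (cases "pinf = 0")
    case True
    have "((\<lambda>t. (V t - p t) + p t) \<longlongrightarrow> 0 + 0) at_top"
      using pinf(4) pinf(2)[unfolded True] by (rule tendsto_add)
    then show ?thesis by simp
  next
    case False
    then have pos: "0 < pinf" using pinf(1) by simp
    \<comment> \<open>Obtained by solving \<open>pinf \<le> exp (- 2 * L t) * p 0\<close> for
      \<open>L t\<close>.\<close>
    define K where "K = ln (p 0 / pinf) / 2"
    have K: "L t \<le> K" if "0 \<le> t" for t
    proof -
      have "pinf \<le> exp (- 2 * L t) * p 0" using pinf(3)[OF that] p_exp[OF that] by simp
      then have "exp (2 * L t) * pinf \<le> exp (2 * L t) * (exp (- 2 * L t) * p 0)" by (intro mult_left_mono) auto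
      also have "\<dots> = p 0" by (simp add: exp_minus)
      finally have le: "exp (2 * L t) \<le> p 0 / pinf" using pos by (simp add: pos_le_divide_eq)
      moreover have "0 < p 0 / pinf" using le exp_gt_zero[of "2 * L t"] by linarith
      ultimately have "2 * L t \<le> ln (p 0 / pinf)" by (simp only: ln_ge_iff)
      then show ?thesis by (simp add: K_def)
    qed
    have "\<exists>l\<ge>- K. ((\<lambda>t. - L t) \<longlongrightarrow> l) at_top \<and> (\<forall>t\<ge>0. l \<le> - L t)"
    proof (rule antimono_convergent_at_top)
      show "- L t \<le> - L s" if "0 \<le> s" "s \<le> t" for s t using L_diff(2)[OF that] by simp
      show "- K \<le> - L t" if "0 \<le> t" for t using K[OF that] by simp
    qed
    then obtain l where l: "((\<lambda>t. - L t) \<longlongrightarrow> l) at_top" by blast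
    define v where "v = exp l *\<^sub>R m 0"
    have "((\<lambda>t. exp (- L t) *\<^sub>R m 0) \<longlongrightarrow> v) at_top" unfolding v_def by (rule tendsto_scaleR[OF tendsto_exp[OF l] tendsto_const])
    then have mv: "(m \<longlongrightarrow> v) at_top"
    proof (rule Lim_transform_eventually)
      show "\<forall>\<^sub>F t in at_top. exp (- L t) *\<^sub>R m 0 = m t"
        using eventually_ge_at_top[of 0] by eventually_elim (rule m_exp[symmetric])
    qed
    have "((\<lambda>t. sqrt (V t - p t) + norm (m t - v)) \<longlongrightarrow> sqrt 0 + norm (v - v)) at_top"
      by (rule tendsto_add[OF tendsto_real_sqrt[OF pinf(4)] tendsto_norm[OF tendsto_diff[OF mv tendsto_const]]])
    then have lim: "((\<lambda>t. sqrt (V t - p t) + norm (m t - v)) \<longlongrightarrow> 0) at_top" by simp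
    have "((\<lambda>t. \<integral>\<omega>. norm (X t \<omega> - v) \<partial>M) \<longlongrightarrow> 0) at_top"
    proof (rule tendsto_sandwich[OF _ _ tendsto_const lim])
      show "\<forall>\<^sub>F t in at_top. 0 \<le> (\<integral>\<omega>. norm (X t \<omega> - v) \<partial>M)"
        by (intro always_eventually allI integral_nonneg_AE) simp
      show "\<forall>\<^sub>F t in at_top. (\<integral>\<omega>. norm (X t \<omega> - v) \<partial>M) \<le> sqrt (V t - p t) + norm (m t - v)"
        using eventually_ge_at_top[of 0] by eventually_elim (rule mean_deviation_le)
    qed
    then show ?thesis using K by blast
  qed
qed

text \<open>Average the lower bound over the sample space and integrate it over
  \<open>[t0, t]\<close>. The two occurrences of \<eta>, one explicit and one bounding the mean
  deviation, consume \<open>a / 2\<close> of the rate \<open>a\<close>. The averaged \<Lambda> and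
  the explicit \<open>ell\<close> together cost \<open>2 * K\<close> times an increment of
  \<open>L\<close>, which is bounded. What remains grows linearly in \<open>t\<close>, whereas the
  mean of \<Lambda> can rise by at most 1.\<close>

lemma no_concentration:
  assumes drift_integrable: "AE \<omega> in M. \<forall>t\<ge>0. set_integrable lborel {0..t} (\<lambda>s. f s \<omega>)"
    and drift: "AE \<omega> in M. \<forall>t\<ge>0. \<Lambda> t \<omega> = \<Lambda> 0 \<omega> + (LINT s:{0..t}|lborel. f s \<omega>)"
    and a: "0 < a" and K: "0 < K" and t0: "0 \<le> t0" and \<eta>: "0 \<le> \<eta>" "4 * K * \<eta> = a"
    and dev: "\<And>s. t0 \<le> s \<Longrightarrow> (\<integral>\<omega>. norm (X s \<omega> - v) \<partial>M) \<le> \<eta>"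
    and lower: "\<And>s \<omega>. t0 \<le> s \<Longrightarrow> \<omega> \<in> space M \<Longrightarrow> a - K * (norm (X s \<omega> - v) + \<Lambda> s \<omega> + \<eta> + ell s) \<le> f s \<omega>"
    and L: "\<And>t. 0 \<le> t \<Longrightarrow> L t \<le> R"
  shows False
proof -
  define R' where "R' = max 0 R"
  \<comment> \<open>Gives \<open>(t - t0) * (a / 2) = 2 * K * R' + 2\<close>, so the gain exceeds
    the loss by 2 although at most 1 is possible.\<close>
  define t where "t = t0 + 2 * (2 * K * R' + 2) / a"
  have t: "t0 \<le> t" using a K by (simp add: t_def R'_def)
  let ?h = "\<lambda>\<omega> s. a - K * (norm (X (max 0 s) \<omega> - v) + \<Lambda> (max 0 s) \<omega> + \<eta> + ell (max 0 s))"
  have hm: "(\<lambda>z. ?h (fst z) (snd z)) \<in> borel_measurable (M \<Otimes>\<^sub>M lborel)"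
  proof -
    have [measurable]: "(\<lambda>z. X (max 0 (snd z)) (fst z)) \<in> borel_measurable (M \<Otimes>\<^sub>M borel)"
      "(\<lambda>z. \<Lambda> (max 0 (snd z)) (fst z)) \<in> borel_measurable (M \<Otimes>\<^sub>M borel)"
      using X_joint \<Lambda>_joint by simp_all
    have [measurable]: "(\<lambda>z. ell (max 0 (snd z))) \<in> borel_measurable (M \<Otimes>\<^sub>M borel)"
      by (rule measurable_compose[OF measurable_snd ell_max_measurable])
    show ?thesis by measurable
  qed
  have hint: "integrable M (\<lambda>\<omega>. ?h \<omega> s)" for s
    using X_integrable[of "max 0 s"] \<Lambda>_integrable[of "max 0 s"] by simp
  have hE: "(\<integral>\<omega>. ?h \<omega> s \<partial>M) = a - K * ((\<integral>\<omega>. norm (X (max 0 s) \<omega> - v) \<partial>M) + ell (max 0 s) + \<eta> + ell (max 0 s))" for s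
    using X_integrable[of "max 0 s"] \<Lambda>_integrable[of "max 0 s"] by (simp add: prob_space ell_def)
  have hb: "(\<integral>\<^sup>+\<omega>. ennreal (norm (?h \<omega> s)) \<partial>M) \<le> ennreal (a + K * (\<eta> + 1 + \<eta> + 1))" if "s \<in> {t0..t}" for s
  proof (rule nn_integral_norm_le[OF hint])
    have s: "0 \<le> s" "t0 \<le> s" "max 0 s = s" using that t0 by auto
    have "(\<integral>\<omega>. norm (?h \<omega> s) \<partial>M) \<le> (\<integral>\<omega>. a + K * (norm (X s \<omega> - v) + 1 + \<eta> + 1) \<partial>M)"
    proof (rule integral_mono)
      show "integrable M (\<lambda>\<omega>. norm (?h \<omega> s))" using hint by (rule integrable_norm)
      show "integrable M (\<lambda>\<omega>. a + K * (norm (X s \<omega> - v) + 1 + \<eta> + 1))" using X_integrable[OF s(1)] by simp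
      fix \<omega> assume w: "\<omega> \<in> space M"
      have q: "0 \<le> norm (X s \<omega> - v) + \<Lambda> s \<omega> + \<eta> + ell s" "norm (X s \<omega> - v) + \<Lambda> s \<omega> + \<eta> + ell s \<le> norm (X s \<omega> - v) + 1 + \<eta> + 1"
        using \<Lambda>_range[OF s(1) w] ell_range[OF s(1)] \<eta>(1) by auto
      have "0 \<le> K * (norm (X s \<omega> - v) + \<Lambda> s \<omega> + \<eta> + ell s)"
        "K * (norm (X s \<omega> - v) + \<Lambda> s \<omega> + \<eta> + ell s) \<le> K * (norm (X s \<omega> - v) + 1 + \<eta> + 1)"
        using K q by (auto intro: mult_left_mono mult_nonneg_nonneg)
      then show "norm (?h \<omega> s) \<le> a + K * (norm (X s \<omega> - v) + 1 + \<eta> + 1)"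
        unfolding s(3) real_norm_def using a by linarith
    qed
    also have "\<dots> = a + K * ((\<integral>\<omega>. norm (X s \<omega> - v) \<partial>M) + 1 + \<eta> + 1)" using X_integrable[OF s(1)] by (simp add: prob_space)
    also have "\<dots> \<le> a + K * (\<eta> + 1 + \<eta> + 1)" using dev[OF s(2)] K by (intro add_left_mono mult_left_mono) auto
    finally show "(\<integral>\<omega>. norm (?h \<omega> s) \<partial>M) \<le> a + K * (\<eta> + 1 + \<eta> + 1)" .
  qed
  have F: "integrable M (\<lambda>\<omega>. LINT s:{t0..t}|lborel. ?h \<omega> s)"
    "(\<integral>\<omega>. (LINT s:{t0..t}|lborel. ?h \<omega> s) \<partial>M) = (LINT s:{t0..t}|lborel. (\<integral>\<omega>. ?h \<omega> s \<partial>M))"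
    "set_integrable lborel {t0..t} (\<lambda>s. \<integral>\<omega>. ?h \<omega> s \<partial>M)"
    by (rule Fubini_time[OF hm, unfolded fst_conv snd_conv, OF hb], assumption)+
  have "AE \<omega> in M. (LINT s:{t0..t}|lborel. ?h \<omega> s) \<le> \<Lambda> t \<omega> - \<Lambda> t0 \<omega>"
    using drift_integrable drift AE_space
  proof eventually_elim
    case (elim \<omega>)
    have t0': "0 \<le> t" using t t0 by simp
    have f: "set_integrable lborel {0..t} (\<lambda>s. f s \<omega>)" using elim(1) t0' by blast
    have f': "set_integrable lborel {t0..t} (\<lambda>s. f s \<omega>)" by (rule set_integrable_subset[OF f]) (use t0 in auto)
    have "\<Lambda> t \<omega> - \<Lambda> t0 \<omega> = (LINT s:{0..t}|lborel. f s \<omega>) - (LINT s:{0..t0}|lborel. f s \<omega>)"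
      using elim(2)[rule_format, OF t0'] elim(2)[rule_format, OF t0] by linarith
    also have "\<dots> = (LINT s:{t0..t}|lborel. f s \<omega>)" using set_integral_Icc_combine[OF t0 t f] by linarith
    finally have eq: "\<Lambda> t \<omega> - \<Lambda> t0 \<omega> = (LINT s:{t0..t}|lborel. f s \<omega>)" .
    have cX: "continuous_on {0..} (\<lambda>s. X s \<omega>)" "continuous_on {0..} (\<lambda>s. \<Lambda> s \<omega>)"
      using continuous elim(3) by (auto simp: continuous_paths_def)
    have "continuous_on {t0..t} (\<lambda>s. a - K * (norm (X s \<omega> - v) + \<Lambda> s \<omega> + \<eta> + ell s))"
      using t0 by (intro continuous_intros continuous_on_subset[OF cX(1)] continuous_on_subset[OF cX(2)] ell_continuous_Icc) auto
    from set_integral_eq_integral_Icc(2)[OF this t0]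
    show ?case unfolding eq
      by (rule set_integral_mono_Icc[OF _ f']) (use lower[OF _ elim(3)] t0 in auto)
  qed
  then have "(\<integral>\<omega>. (LINT s:{t0..t}|lborel. ?h \<omega> s) \<partial>M) \<le> (\<integral>\<omega>. \<Lambda> t \<omega> - \<Lambda> t0 \<omega> \<partial>M)"
    using F(1) \<Lambda>_integrable t t0 by (intro integral_mono_AE) auto
  also have "\<dots> = ell t - ell t0" using \<Lambda>_integrable t t0 by (simp add: ell_def)
  also have "\<dots> \<le> 1" using ell_range[of t] ell_range[of t0] t t0 by simp
  finally have up: "(LINT s:{t0..t}|lborel. (\<integral>\<omega>. ?h \<omega> s \<partial>M)) \<le> 1" unfolding F(2) .
  have ei: "set_integrable lborel {t0..t} (\<lambda>s. ell (max 0 s))"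
    by (rule set_integral_eq_integral_Icc(2)[OF ell_continuous_Icc[OF t0] t0])
  have ci: "set_integrable lborel {t0..t} (\<lambda>s. a / 2)" by (rule set_integrable_bounded_Icc[where C="\<bar>a / 2\<bar>"]) auto
  have "(LINT s:{t0..t}|lborel. a / 2 - 2 * K * ell (max 0 s)) \<le> (LINT s:{t0..t}|lborel. (\<integral>\<omega>. ?h \<omega> s \<partial>M))"
  proof (rule set_integral_mono_Icc[OF _ F(3)])
    show "set_integrable lborel {t0..t} (\<lambda>s. a / 2 - 2 * K * ell (max 0 s))"
      using ei ci by (intro set_integral_diff(1) set_integrable_mult_right) auto
    fix s assume "s \<in> {t0..t}"
    then have s: "t0 \<le> s" "max 0 s = s" using t0 by auto
    have "K * (\<integral>\<omega>. norm (X s \<omega> - v) \<partial>M) \<le> K * \<eta>" using dev[OF s(1)] K by (intro mult_left_mono) auto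
    then show "a / 2 - 2 * K * ell (max 0 s) \<le> (\<integral>\<omega>. ?h \<omega> s \<partial>M)"
      unfolding hE unfolding s(2) using \<eta>(2) by (simp add: algebra_simps)
  qed
  moreover have "(LINT s:{t0..t}|lborel. a / 2 - 2 * K * ell (max 0 s)) = (t - t0) * (a / 2) - 2 * K * (L t - L t0)"
    using ei ci t L_diff(1)[OF t0 t] by (subst set_integral_diff(2)) (auto simp: set_integral_const_Icc)
  moreover have "2 * K * (L t - L t0) \<le> 2 * K * R'"
  proof -
    have "L 0 \<le> L t0" by (rule L_diff(2)) (use t0 in auto)
    then have "L t - L t0 \<le> R'" using L[of t] t t0 by (simp add: L_def R'_def)
    then show ?thesis using K by (intro mult_left_mono) auto
  qed
  moreover have "(t - t0) * (a / 2) = 2 * K * R' + 2" using a by (simp add: t_def)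
  ultimately show False using up by linarith
qed

end

section \<open>Wasserstein distance to a Dirac mass\<close>

lemma W1_le_coupling:
  assumes \<gamma>: "\<gamma> \<in> couplings \<mu> \<nu>" and le: "(\<integral>\<^sup>+z. ennreal (dist (fst z) (snd z)) \<partial>\<gamma>) \<le> ennreal r" "0 \<le> r"
  shows "W1 \<mu> \<nu> \<le> r"
proof -
  have "(INF \<gamma>\<in>couplings \<mu> \<nu>. \<integral>\<^sup>+z. ennreal (dist (fst z) (snd z)) \<partial>\<gamma>) \<le> ennreal r"
    using INF_lower[OF \<gamma>] le(1) by (rule order_trans)
  then have "W1 \<mu> \<nu> \<le> enn2real (ennreal r)" unfolding W1_def by (intro enn2real_mono) auto
  then show ?thesis using le(2) by simp
qed

lemma Dirac_P1:
  fixes S :: "'a::euclidean_space set"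
  assumes "x \<in> S"
  shows "return (restrict_space borel S) x \<in> P1 S"
proof -
  have x: "x \<in> space (restrict_space borel S)" using assms by (simp add: space_restrict_space)
  have nm: "norm \<in> borel_measurable (restrict_space (borel :: 'a measure) S)"
    by (intro measurable_restrict_space1) simp
  have "integrable (return (restrict_space borel S) x) norm"
    using nm x by (auto simp: integrable_iff_bounded nn_integral_return)
  then show ?thesis using x by (auto simp: P1_def prob_space_return)
qed

text \<open>The law of \<open>(Z \<omega>, x)\<close> is a coupling, and its cost is the mean
  distance from \<open>Z\<close> to \<open>x\<close>. Most of the proof is bookkeeping for the
  restricted Borel \<sigma>-algebra.\<close>

lemma (in prob_space) W1_Dirac_le:
  fixes Z :: "'a \<Rightarrow> 'b::euclidean_space"
  assumes Z: "Z \<in> measurable M (restrict_space borel S)" and x: "x \<in> S"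
    and le: "(\<integral>\<^sup>+\<omega>. ennreal (dist (Z \<omega>) x) \<partial>M) \<le> ennreal r" "0 \<le> r"
  shows "W1 (distr M (restrict_space borel S) Z) (return (restrict_space borel S) x) \<le> r"
proof -
  let ?R = "restrict_space (borel :: 'b measure) S"
  let ?\<mu> = "distr M ?R Z" and ?\<nu> = "return ?R x"
  let ?f = "\<lambda>\<omega>. (Z \<omega>, x)"
  have xR: "x \<in> space ?R" using x by (simp add: space_restrict_space)
  have f: "?f \<in> measurable M (?\<mu> \<Otimes>\<^sub>M ?\<nu>)" using Z xR by (intro measurable_Pair) auto
  define \<gamma> where "\<gamma> = distr M (?\<mu> \<Otimes>\<^sub>M ?\<nu>) ?f"
  have "\<gamma> \<in> couplings ?\<mu> ?\<nu>"
    unfolding couplings_def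
  proof (intro CollectI conjI)
    show "sets \<gamma> = sets (?\<mu> \<Otimes>\<^sub>M ?\<nu>)" by (simp add: \<gamma>_def)
    have "distr \<gamma> ?\<mu> fst = distr M ?\<mu> (fst \<circ> ?f)" unfolding \<gamma>_def by (rule distr_distr[OF measurable_fst f])
    also have "\<dots> = ?\<mu>" by (intro distr_cong) (auto simp: o_def)
    finally show "distr \<gamma> ?\<mu> fst = ?\<mu>" .
    have "distr \<gamma> ?\<nu> snd = distr M ?\<nu> (snd \<circ> ?f)" unfolding \<gamma>_def by (rule distr_distr[OF measurable_snd f])
    also have "\<dots> = distr M ?\<nu> (\<lambda>_. x)" by (simp add: o_def)
    also have "\<dots> = return ?\<nu> x" using xR by (intro distr_const) simp
    also have "\<dots> = ?\<nu>" by (rule return_cong) simp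
    finally show "distr \<gamma> ?\<nu> snd = ?\<nu>" .
  qed
  moreover have "(\<integral>\<^sup>+z. ennreal (dist (fst z) (snd z)) \<partial>\<gamma>) \<le> ennreal r"
  proof -
    have "(\<lambda>z. z) \<in> measurable ?R borel" by (rule measurable_restrict_space1) simp
    then have i\<mu>: "(\<lambda>z. z) \<in> measurable ?\<mu> borel" and i\<nu>: "(\<lambda>z. z) \<in> measurable ?\<nu> borel"
      by (auto cong: measurable_cong_sets)
    have "(\<lambda>z. dist (fst z) (snd z)) \<in> borel_measurable (?\<mu> \<Otimes>\<^sub>M ?\<nu>)"
      by (intro borel_measurable_dist measurable_compose[OF measurable_fst i\<mu>] measurable_compose[OF measurable_snd i\<nu>])
    then have "(\<integral>\<^sup>+z. ennreal (dist (fst z) (snd z)) \<partial>\<gamma>) = (\<integral>\<^sup>+\<omega>. ennreal (dist (Z \<omega>) x) \<partial>M)"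
      unfolding \<gamma>_def by (subst nn_integral_distr[OF f]) auto
    then show ?thesis using le(1) by simp
  qed
  ultimately show ?thesis using le(2) by (rule W1_le_coupling)
qed

context mean_field_process begin

lemma joint_measurable:
  assumes "0 \<le> s"
  shows "(\<lambda>\<omega>. (X s \<omega>, \<Lambda> s \<omega>)) \<in> measurable M (restrict_space borel state_space)"
proof (rule measurable_restrict_space2)
  show "(\<lambda>\<omega>. (X s \<omega>, \<Lambda> s \<omega>)) \<in> space M \<rightarrow> state_space" using \<Lambda>_range[OF assms] by auto
  have "(\<lambda>\<omega>. (X s \<omega>, \<Lambda> s \<omega>)) \<in> measurable M (borel \<Otimes>\<^sub>M borel)"
    by (intro measurable_Pair X_measurable \<Lambda>_measurable assms)
  then show "(\<lambda>\<omega>. (X s \<omega>, \<Lambda> s \<omega>)) \<in> borel_measurable M" by (simp add: borel_prod)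
qed

lemma dist_joint_le:
  assumes "0 \<le> s" "\<omega> \<in> space M"
  shows "dist (X s \<omega>, \<Lambda> s \<omega>) (v, 0) \<le> norm (X s \<omega> - v) + \<Lambda> s \<omega>"
proof -
  have "dist (X s \<omega>, \<Lambda> s \<omega>) (v, 0) \<le> dist (X s \<omega>) v + dist (\<Lambda> s \<omega>) 0"
    unfolding dist_Pair_Pair by (rule sqrt_sum_squares_le_sum) auto
  then show ?thesis using \<Lambda>_range[OF assms] by (simp add: dist_norm)
qed

lemma joint_law_P1:
  assumes "0 \<le> s" shows "joint_law M X \<Lambda> s \<in> P1 state_space"
proof -
  note Z = joint_measurable[OF assms]
  have nm: "norm \<in> borel_measurable (restrict_space (borel :: ((real^'d) \<times> real) measure) state_space)"
    by (intro measurable_restrict_space1) simp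
  have "integrable M (\<lambda>\<omega>. norm (X s \<omega>, \<Lambda> s \<omega>))"
  proof (rule Bochner_Integration.integrable_bound)
    show "integrable M (\<lambda>\<omega>. norm (X s \<omega>) + \<Lambda> s \<omega>)" using X_integrable[OF assms] \<Lambda>_integrable[OF assms] by simp
    show "(\<lambda>\<omega>. norm (X s \<omega>, \<Lambda> s \<omega>)) \<in> borel_measurable M" by (rule measurable_compose[OF Z nm])
    show "AE \<omega> in M. norm (norm (X s \<omega>, \<Lambda> s \<omega>)) \<le> norm (norm (X s \<omega>) + \<Lambda> s \<omega>)"
    proof (rule AE_I2)
      fix \<omega> assume w: "\<omega> \<in> space M"
      show "norm (norm (X s \<omega>, \<Lambda> s \<omega>)) \<le> norm (norm (X s \<omega>) + \<Lambda> s \<omega>)"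
        using dist_joint_le[OF assms w, of 0] \<Lambda>_range[OF assms w] by (simp add: dist_norm)
    qed
  qed
  then have "integrable (joint_law M X \<Lambda> s) norm"
    unfolding joint_law_def using integrable_distr_eq[OF Z nm] by simp
  then show ?thesis using prob_space_distr[OF Z] by (simp add: P1_def joint_law_def)
qed

lemma W1_joint_law_Dirac_le:
  assumes "0 \<le> s"
  shows "W1 (joint_law M X \<Lambda> s) (return (restrict_space borel state_space) (v, 0)) \<le> (\<integral>\<omega>. norm (X s \<omega> - v) \<partial>M) + ell s"
  unfolding joint_law_def
proof (rule W1_Dirac_le[OF joint_measurable[OF assms]])
  have nonneg: "0 \<le> (\<integral>\<omega>. norm (X s \<omega> - v) \<partial>M)" by (rule integral_nonneg_AE) simp
  then show "0 \<le> (\<integral>\<omega>. norm (X s \<omega> - v) \<partial>M) + ell s" using ell_range[OF assms] by simp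
  have int: "integrable M (\<lambda>\<omega>. norm (X s \<omega> - v) + \<Lambda> s \<omega>)" using X_integrable[OF assms] \<Lambda>_integrable[OF assms] by simp
  have "(\<integral>\<^sup>+\<omega>. ennreal (dist (X s \<omega>, \<Lambda> s \<omega>) (v, 0)) \<partial>M) \<le> (\<integral>\<^sup>+\<omega>. ennreal (norm (X s \<omega> - v) + \<Lambda> s \<omega>) \<partial>M)"
    by (intro nn_integral_mono ennreal_leI dist_joint_le[OF assms])
  also have "\<dots> = ennreal (\<integral>\<omega>. norm (X s \<omega> - v) + \<Lambda> s \<omega> \<partial>M)"
    by (rule nn_integral_eq_integral[OF int]) (use \<Lambda>_range[OF assms] in \<open>auto intro!: AE_I2\<close>)
  also have "(\<integral>\<omega>. norm (X s \<omega> - v) + \<Lambda> s \<omega> \<partial>M) = (\<integral>\<omega>. norm (X s \<omega> - v) \<partial>M) + ell s"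
    using X_integrable[OF assms] \<Lambda>_integrable[OF assms] by (simp add: ell_def)
  finally show "(\<integral>\<^sup>+\<omega>. ennreal (dist (X s \<omega>, \<Lambda> s \<omega>) (v, 0)) \<partial>M) \<le> ennreal ((\<integral>\<omega>. norm (X s \<omega> - v) \<partial>M) + ell s)" .
qed simp

end

theorem theorem4p2:
  fixes \<sigma> :: real
    and T :: "((real^'d) \<times> real) measure \<Rightarrow> (real^'d) \<times> real \<Rightarrow> real"
    and M :: "'w measure"
    and F :: "real \<Rightarrow> 'w measure"
    and B :: "real \<Rightarrow> 'w \<Rightarrow> real^'d"
    and X0 :: "'w \<Rightarrow> real^'d" and \<Lambda>0 :: "'w \<Rightarrow> real"
    and X :: "real \<Rightarrow> 'w \<Rightarrow> real^'d" and \<Lambda> :: "real \<Rightarrow> 'w \<Rightarrow> real"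
  assumes dim: "CARD('d) > 1"
    and sigma_nonneg: "\<sigma> \<ge> 0"
    and T1: "\<exists>L>0. \<forall>\<Psi>1\<in>P1 state_space. \<forall>\<Psi>2\<in>P1 state_space.
        \<forall>x1 x2. \<forall>l1\<in>{0..1}. \<forall>l2\<in>{0..1}.
          \<bar>T \<Psi>1 (x1, l1) - T \<Psi>2 (x2, l2)\<bar> \<le> L * (norm (x1 - x2) + \<bar>l1 - l2\<bar> + W1 \<Psi>1 \<Psi>2)"
    and T2: "\<exists>\<theta>>0. \<forall>\<Psi>\<in>P1 state_space. \<forall>x. \<forall>l\<in>{0..1}. l + \<theta> * T \<Psi> (x, l) \<in> {0..1}"
    and T3: "\<forall>\<Psi>\<in>P1 state_space. \<forall>x. T \<Psi> (x, 0) > 0"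
    and space: "filtered_prob_space M F"
    and brownian: "brownian_motion M F B"
    and X0_meas: "X0 \<in> borel_measurable (F 0)"
    and X0_L4: "integrable M (\<lambda>\<omega>. norm (X0 \<omega>) ^ 4)"
    and Lambda0_meas: "\<Lambda>0 \<in> borel_measurable (F 0)"
    and Lambda0_range: "\<forall>\<omega>\<in>space M. \<Lambda>0 \<omega> \<in> {0..1}"
    and solution: "mean_field_solution M F B \<sigma> T X0 \<Lambda>0 X \<Lambda>"
    and first_moment: "\<forall>t\<ge>0. \<exists>C::real. \<forall>s\<in>{0..t}. (\<integral>\<^sup>+x. ennreal (norm x) \<partial>law M X s) \<le> ennreal C"
    and small_noise: "\<sigma>\<^sup>2 * real CARD('d) < 2"
  shows "((\<lambda>t. \<integral>\<^sup>+\<omega>. ennreal ((norm (X t \<omega>))\<^sup>2) \<partial>M) \<longlongrightarrow> 0) at_top"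
proof -
  obtain J where J: "ito_integral_process M F B (\<lambda>s \<omega>. \<sigma> * norm (deviation M X \<Lambda> s \<omega>)) J"
    and eqX: "AE \<omega> in M. \<forall>t\<ge>0. X t \<omega> = X 0 \<omega> + (LINT s:{0..t}|lborel. - deviation M X \<Lambda> s \<omega>) + J t \<omega>"
    using solution unfolding mean_field_solution_def by blast
  have sol: "adapted F X" "adapted F \<Lambda>" "continuous_paths M X" "continuous_paths M \<Lambda>"
    "\<And>t \<omega>. 0 \<le> t \<Longrightarrow> \<omega> \<in> space M \<Longrightarrow> \<Lambda> t \<omega> \<in> {0..1}"
    "AE \<omega> in M. X 0 \<omega> = X0 \<omega> \<and> \<Lambda> 0 \<omega> = \<Lambda>0 \<omega>"
    "AE \<omega> in M. \<forall>t\<ge>0. set_integrable lborel {0..t} (\<lambda>s. T (joint_law M X \<Lambda> s) (X s \<omega>, \<Lambda> s \<omega>))"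
    "AE \<omega> in M. \<forall>t\<ge>0. \<Lambda> t \<omega> = \<Lambda> 0 \<omega> + (LINT s:{0..t}|lborel. T (joint_law M X \<Lambda> s) (X s \<omega>, \<Lambda> s \<omega>))"
    using solution unfolding mean_field_solution_def by auto
  have sub: "subalgebra M (F 0)" and pM: "prob_space M" using space by (auto simp: filtered_prob_space_def)
  interpret M: prob_space M by (rule pM)
  have X00: "X 0 \<in> borel_measurable M"
    using sol(1) measurable_from_subalg[OF sub] by (auto simp: adapted_def)
  have initial: "integrable M (\<lambda>\<omega>. (norm (X 0 \<omega>))\<^sup>2)"
  proof (rule Bochner_Integration.integrable_bound)
    show "integrable M (\<lambda>\<omega>. 1 + norm (X0 \<omega>) ^ 4)" using X0_L4 by simp
    show "AE \<omega> in M. norm ((norm (X 0 \<omega>))\<^sup>2) \<le> norm (1 + norm (X0 \<omega>) ^ 4)"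
      using sol(6)
    proof eventually_elim
      case (elim \<omega>)
      \<comment> \<open>The elementary bound is applied to the squared norm, which turns the fourth
        moment into a bound for the second.\<close>
      have "norm ((norm (X0 \<omega>))\<^sup>2) \<le> 1 + (norm ((norm (X0 \<omega>))\<^sup>2))\<^sup>2" using norm_le_one_plus_square by blast
      then show ?case using elim by (simp add: power2_eq_square power4_eq_xxxx mult.assoc)
    qed
  qed (use X00 in measurable)
  interpret mean_field_process M F B \<sigma> X \<Lambda> J
    by standard (use space brownian sol J eqX initial first_moment in auto)
  have "c < 2" using small_noise by (simp add: c_def mult.commute)
  from dichotomy[OF this] show ?thesis
  proof (elim disjE exE conjE)
    assume V0: "(V \<longlongrightarrow> 0) at_top"
    have "((\<lambda>t. ennreal (V t)) \<longlongrightarrow> ennreal 0) at_top" by (intro tendsto_ennrealI V0)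
    then have lim: "((\<lambda>t. ennreal (V t)) \<longlongrightarrow> 0) at_top" by simp
    show ?thesis
    proof (rule Lim_transform_eventually[OF lim])
      show "\<forall>\<^sub>F t in at_top. ennreal (V t) = (\<integral>\<^sup>+\<omega>. ennreal ((norm (X t \<omega>))\<^sup>2) \<partial>M)"
        using eventually_ge_at_top[of 0]
        by eventually_elim (simp add: V_def X_square_integrable nn_integral_eq_integral)
    qed
  next
    fix R v
    assume R: "\<forall>t\<ge>0. L t \<le> R" and conc: "((\<lambda>t. \<integral>\<omega>. norm (X t \<omega> - v) \<partial>M) \<longlongrightarrow> 0) at_top"
    obtain K where K: "0 < K" and Lip: "\<And>\<Psi>1 \<Psi>2 x1 x2 l1 l2. \<Psi>1 \<in> P1 state_space \<Longrightarrow> \<Psi>2 \<in> P1 state_space \<Longrightarrow>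
        l1 \<in> {0..1} \<Longrightarrow> l2 \<in> {0..1} \<Longrightarrow>
        \<bar>T \<Psi>1 (x1, l1) - T \<Psi>2 (x2, l2)\<bar> \<le> K * (norm (x1 - x2) + \<bar>l1 - l2\<bar> + W1 \<Psi>1 \<Psi>2)"
      using T1 by blast
    \<comment> \<open>The fixed state of comparison: position at the limit \<open>v\<close> of the
      means, \<Lambda> at 0, which is the value where (T3) applies.\<close>
    define \<Delta> where "\<Delta> = return (restrict_space borel state_space) (v, 0 :: real)"
    have \<Delta>: "\<Delta> \<in> P1 state_space" unfolding \<Delta>_def by (rule Dirac_P1) simp
    define a where "a = T \<Delta> (v, 0)"
    have a: "0 < a" unfolding a_def using T3 \<Delta> by blast
    \<comment> \<open>A quarter suffices: one \<eta> stems from the \<open>W1\<close> distance and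
      one from the mean deviation of \<open>X\<close>, so half of the drift \<open>a\<close> is
      left.\<close>
    define \<eta> where "\<eta> = a / (4 * K)"
    have \<eta>: "0 < \<eta>" "4 * K * \<eta> = a" using a K by (auto simp: \<eta>_def)
    have "\<forall>\<^sub>F t in at_top. (\<integral>\<omega>. norm (X t \<omega> - v) \<partial>M) < \<eta>" by (rule order_tendstoD(2)[OF conc \<eta>(1)])
    then obtain t1 where t1: "\<And>t. t1 \<le> t \<Longrightarrow> (\<integral>\<omega>. norm (X t \<omega> - v) \<partial>M) < \<eta>"
      by (auto simp: eventually_at_top_linorder)
    define t0 where "t0 = max 0 t1"
    have t0: "0 \<le> t0" by (simp add: t0_def)
    have dev: "(\<integral>\<omega>. norm (X s \<omega> - v) \<partial>M) \<le> \<eta>" if "t0 \<le> s" for s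
      using t1[of s] that by (simp add: t0_def)
    \<comment> \<open>(T1) compares the current law and state with \<Delta> and
      \<open>(v, 0)\<close>. The coordinate \<Lambda> is paid for twice, once pointwise and once as
      \<open>ell s\<close> inside \<open>W1\<close>.\<close>
    have lower: "a - K * (norm (X s \<omega> - v) + \<Lambda> s \<omega> + \<eta> + ell s) \<le> T (joint_law M X \<Lambda> s) (X s \<omega>, \<Lambda> s \<omega>)"
      if "t0 \<le> s" "\<omega> \<in> space M" for s \<omega>
    proof -
      have s: "0 \<le> s" using that t0 by simp
      have l: "\<Lambda> s \<omega> \<in> {0..1}" by (rule \<Lambda>_range[OF s that(2)])
      have "W1 (joint_law M X \<Lambda> s) \<Delta> \<le> \<eta> + ell s"
        using W1_joint_law_Dirac_le[OF s, of v] dev[OF that(1)] unfolding \<Delta>_def by linarith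
      then have "K * (norm (X s \<omega> - v) + \<bar>\<Lambda> s \<omega> - 0\<bar> + W1 (joint_law M X \<Lambda> s) \<Delta>) \<le> K * (norm (X s \<omega> - v) + \<Lambda> s \<omega> + \<eta> + ell s)"
        using K l by (intro mult_left_mono) auto
      moreover have "\<bar>T (joint_law M X \<Lambda> s) (X s \<omega>, \<Lambda> s \<omega>) - T \<Delta> (v, 0)\<bar>
          \<le> K * (norm (X s \<omega> - v) + \<bar>\<Lambda> s \<omega> - 0\<bar> + W1 (joint_law M X \<Lambda> s) \<Delta>)"
        by (rule Lip[OF joint_law_P1[OF s] \<Delta> l]) simp
      ultimately show ?thesis unfolding a_def by linarith
    qed
    have "False"
      by (rule no_concentration[OF sol(7,8) a K t0 less_imp_le[OF \<eta>(1)] \<eta>(2) dev lower, of R]) (use R in auto)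
    then show ?thesis ..
  qed
qed

end
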